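(* Let $V_1\xrightarrow{\phi_1}V_2\xrightarrow{\phi_2}V_3\xrightarrow{\phi_3}\cdots$ be an inductive system in the category $\mathbf{AOU}$ of Archimedean order unit spaces and unital positive linear maps. Then $\mathrm{OMAX}(\varinjlim_{\mathbf{AOU}}V_k)$ is unitally completely order isomorphic to $\varinjlim_{\mathbf{OS}}\mathrm{OMAX}(V_k)$, where the latter is the inductive limit of the system $\mathrm{OMAX}(V_1)\xrightarrow{\phi_1}\mathrm{OMAX}(V_2)\xrightarrow{\phi_2}\cdots$ in the category of operator systems.
   Context: An Archimedean order unit (AOU) space is a complex $*$-vector space $V$ with a cone $V^+\subseteq V_h$, $V^+\cap(-V^+)=\{0\}$, and an order unit $e\in V^+$ (for every $x\in V_h$ there is $r>0$ with $re-x\in V^+$) that is Archimedean: $V^+=\{x\in V_h:re+x\in V^+\ \forall r>0\}$. An operator system (not assumed complete) is a matrix ordered $*$-vector space with an Archimedean matrix order unit; $\mathbf{OS}$ is the category of operator systems and unital completely positive maps. A unital complete order isomorphism is a unital linear bijection, completely positive with completely positive inverse. $\mathrm{OMAX}(V)$ is the Archimedeanisation of the matrix ordered $*$-vector space $(V,\{D_n^{\max}(V)\}_n,e)$, where $D_n^{\max}(V)=\{\sum_{i=1}^ka_i\otimes x_i:x_i\in V^+,\ a_i\in M_n^+,\ k\in\mathbb{N}\}\subseteq M_n\otimes V=M_n(V)$. Here the Archimedeanisation of a matrix ordered $*$-vector space $(\mathcal{S},\{C_n\},e)$ with matrix order unit is $\mathcal{S}/N$, where $N=\{s:f(s)=0\text{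 for all unital positive functionals }f\text{ on }\mathcal{S}\}$, with unit $e+N$ and matrix cones consisting of those selfadjoint $X+M_n(N)$ with $re^{(n)}+X+M_n(N)\in C_n+M_n(N)$ for all $r>0$ (for $\mathrm{OMAX}(V)$ with $V$ an AOU space, $N=\{0\}$). A unital positive map $V\to W$ is completely positive as a map $\mathrm{OMAX}(V)\to\mathrm{OMAX}(W)$, so $\mathrm{OMAX}(V_1)\xrightarrow{\phi_1}\mathrm{OMAX}(V_2)\xrightarrow{\phi_2}\cdots$ is an inductive system in $\mathbf{OS}$. The inductive limit of a system $(\{A_k\},\{\alpha_k\})$ in a category is an object $A$ with morphisms $\alpha_{k,\infty}:A_k\to A$, $\alpha_{k+1,\infty}\circ\alpha_k=\alpha_{k,\infty}$, universal with this property. Inductive limits exist in both $\mathbf{AOU}$ and $\mathbf{OS}$ and are unique up to isomorphism. *)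

theory Defs
  imports "HOL-Algebra.AbelCoset" "Jordan_Normal_Form.VS_Connect"
begin

section \<open>Ordered complex *-vector spaces\<close>

text \<open>
  A complex vector space is a module over the field \<^term>\<open>class_ring :: complex ring\<close>.
  The fields \<^const>\<open>monoid.mult\<close> and \<^const>\<open>monoid.one\<close> that a module record inherits from
  rings carry no information and are never constrained. All functions are only relevant on
  carriers.
\<close>

record 'a pointed_star_space = "(complex, 'a) module" +
  star :: "'a \<Rightarrow> 'a"
  order_unit :: 'a

record 'a ordered_star_space = "'a pointed_star_space" +
  pos :: "'a set"

text \<open>
  Matrices over a space \<open>V\<close> are elements of \<^typ>\<open>'a mat\<close> with entries in the carrier;
  \<open>mat_pos S n\<close> is the cone \<open>C\<^sub>n\<close> and is only relevant for \<open>n \<ge> 1\<close>.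
\<close>

record 'a matrix_ordered_star_space = "'a pointed_star_space" +
  mat_pos :: "nat \<Rightarrow> 'a mat set"

definition star_vector_space :: "('a, 'm) pointed_star_space_scheme \<Rightarrow> bool" where
  "star_vector_space V \<longleftrightarrow>
     vectorspace class_ring V \<and>
     (\<forall>x\<in>carrier V. star V x \<in> carrier V \<and> star V (star V x) = x) \<and>
     (\<forall>x\<in>carrier V. \<forall>y\<in>carrier V. star V (x \<oplus>\<^bsub>V\<^esub> y) = star V x \<oplus>\<^bsub>V\<^esub> star V y) \<and>
     (\<forall>c. \<forall>x\<in>carrier V. star V (c \<odot>\<^bsub>V\<^esub> x) = cnj c \<odot>\<^bsub>V\<^esub> star V x)"

definition selfadjoint :: "('a, 'm) pointed_star_space_scheme \<Rightarrow> 'a set" where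
  "selfadjoint V = {x \<in> carrier V. star V x = x}"

definition is_cone :: "('a, 'm) pointed_star_space_scheme \<Rightarrow> 'a set \<Rightarrow> bool" where
  "is_cone V C \<longleftrightarrow>
     C \<subseteq> selfadjoint V \<and> C \<noteq> {} \<and>
     (\<forall>x\<in>C. \<forall>y\<in>C. x \<oplus>\<^bsub>V\<^esub> y \<in> C) \<and>
     (\<forall>r\<ge>0. \<forall>x\<in>C. complex_of_real r \<odot>\<^bsub>V\<^esub> x \<in> C)"

definition is_proper_cone :: "('a, 'm) pointed_star_space_scheme \<Rightarrow> 'a set \<Rightarrow> bool" where
  "is_proper_cone V C \<longleftrightarrow> is_cone V C \<and> C \<inter> (\<lambda>x. \<ominus>\<^bsub>V\<^esub> x) ` C = {\<zero>\<^bsub>V\<^esub>}"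

definition is_order_unit :: "('a, 'm) pointed_star_space_scheme \<Rightarrow> 'a set \<Rightarrow> 'a \<Rightarrow> bool" where
  "is_order_unit V C e \<longleftrightarrow>
     e \<in> C \<and> (\<forall>x\<in>selfadjoint V. \<exists>r>0. complex_of_real r \<odot>\<^bsub>V\<^esub> e \<ominus>\<^bsub>V\<^esub> x \<in> C)"

definition is_archimedean :: "('a, 'm) pointed_star_space_scheme \<Rightarrow> 'a set \<Rightarrow> 'a \<Rightarrow> bool" where
  "is_archimedean V C e \<longleftrightarrow>
     C = {x \<in> selfadjoint V. \<forall>r>0. complex_of_real r \<odot>\<^bsub>V\<^esub> e \<oplus>\<^bsub>V\<^esub> x \<in> C}"

definition aou_space :: "'a ordered_star_space \<Rightarrow> bool" where
  "aou_space V \<longleftrightarrow>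
     star_vector_space V \<and> is_proper_cone V (pos V) \<and>
     is_order_unit V (pos V) (order_unit V) \<and> is_archimedean V (pos V) (order_unit V)"

definition unital_positive_map ::
  "'a ordered_star_space \<Rightarrow> 'b ordered_star_space \<Rightarrow> ('a \<Rightarrow> 'b) \<Rightarrow> bool" where
  "unital_positive_map V W f \<longleftrightarrow>
     f \<in> LinearCombinations.module_hom class_ring V W \<and> f (order_unit V) = order_unit W \<and> f ` pos V \<subseteq> pos W"


section \<open>Operator systems\<close>

text \<open>The *-vector space \<open>M\<^sub>n(V)\<close> with distinguished element \<open>e\<^sup>(\<^sup>n\<^sup>) = diag(e, \<dots>, e)\<close>.\<close>

definition mat_space ::
  "('a, 'm) pointed_star_space_scheme \<Rightarrow> nat \<Rightarrow> 'a mat pointed_star_space" where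
  "mat_space V n =
    \<lparr>carrier = {X \<in> carrier_mat n n. \<forall>i<n. \<forall>j<n. X $$ (i, j) \<in> carrier V},
     monoid.mult = undefined, one = undefined,
     zero = mat n n (\<lambda>_. \<zero>\<^bsub>V\<^esub>),
     add = (\<lambda>X Y. mat n n (\<lambda>ij. X $$ ij \<oplus>\<^bsub>V\<^esub> Y $$ ij)),
     smult = (\<lambda>c X. mat n n (\<lambda>ij. c \<odot>\<^bsub>V\<^esub> X $$ ij)),
     star = (\<lambda>X. mat n n (\<lambda>(i, j). star V (X $$ (j, i)))),
     order_unit = mat n n (\<lambda>(i, j). if i = j then order_unit V else \<zero>\<^bsub>V\<^esub>)\<rparr>"

text \<open>The \<open>m \<times> m\<close> matrix \<open>\<alpha>\<^sup>* X \<alpha>\<close> over \<open>V\<close>, for a complex \<open>n \<times> m\<close> matrix \<open>\<alpha>\<close> and \<open>X \<in> M\<^sub>n(V)\<close>.\<close>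

definition compression ::
  "('a, 'm) pointed_star_space_scheme \<Rightarrow> complex mat \<Rightarrow> 'a mat \<Rightarrow> 'a mat" where
  "compression V \<alpha> X = mat (dim_col \<alpha>) (dim_col \<alpha>) (\<lambda>(i, j).
     \<Oplus>\<^bsub>V\<^esub>k\<in>{..<dim_row \<alpha>}. \<Oplus>\<^bsub>V\<^esub>l\<in>{..<dim_row \<alpha>}.
       (cnj (\<alpha> $$ (k, i)) * \<alpha> $$ (l, j)) \<odot>\<^bsub>V\<^esub> X $$ (k, l))"

definition matrix_ordered :: "'a matrix_ordered_star_space \<Rightarrow> bool" where
  "matrix_ordered S \<longleftrightarrow>
     star_vector_space S \<and>
     (\<forall>n>0. is_proper_cone (mat_space S n) (mat_pos S n)) \<and>
     (\<forall>n>0. \<forall>m>0. \<forall>\<alpha>\<in>carrier_mat n m. \<forall>X\<in>mat_pos S n. compression S \<alpha> X \<in> mat_pos S m)"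

definition operator_system :: "'a matrix_ordered_star_space \<Rightarrow> bool" where
  "operator_system S \<longleftrightarrow>
     matrix_ordered S \<and>
     (\<forall>n>0. is_order_unit (mat_space S n) (mat_pos S n) (order_unit (mat_space S n)) \<and>
            is_archimedean (mat_space S n) (mat_pos S n) (order_unit (mat_space S n)))"

definition completely_positive ::
  "'a matrix_ordered_star_space \<Rightarrow> 'b matrix_ordered_star_space \<Rightarrow> ('a \<Rightarrow> 'b) \<Rightarrow> bool" where
  "completely_positive S T f \<longleftrightarrow>
     f \<in> LinearCombinations.module_hom class_ring S T \<and> (\<forall>n>0. map_mat f ` mat_pos S n \<subseteq> mat_pos T n)"

definition ucp_map ::
  "'a matrix_ordered_star_space \<Rightarrow> 'b matrix_ordered_star_space \<Rightarrow> ('a \<Rightarrow> 'b) \<Rightarrow> bool" where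
  "ucp_map S T f \<longleftrightarrow> completely_positive S T f \<and> f (order_unit S) = order_unit T"

definition unital_complete_order_iso ::
  "'a matrix_ordered_star_space \<Rightarrow> 'b matrix_ordered_star_space \<Rightarrow> ('a \<Rightarrow> 'b) \<Rightarrow> bool" where
  "unital_complete_order_iso S T f \<longleftrightarrow>
     bij_betw f (carrier S) (carrier T) \<and> ucp_map S T f \<and>
     completely_positive T S (inv_into (carrier S) f)"


section \<open>Archimedeanisation and OMAX\<close>

text \<open>Positivity on \<open>S\<close> refers to \<open>C\<^sub>1\<close> under the identification \<open>M\<^sub>1(S) = S\<close>.\<close>

definition unital_positive_functional ::
  "'a matrix_ordered_star_space \<Rightarrow> ('a \<Rightarrow> complex) \<Rightarrow> bool" where
  "unital_positive_functional S f \<longleftrightarrow>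
     (\<forall>x\<in>carrier S. \<forall>y\<in>carrier S. f (x \<oplus>\<^bsub>S\<^esub> y) = f x + f y) \<and>
     (\<forall>c. \<forall>x\<in>carrier S. f (c \<odot>\<^bsub>S\<^esub> x) = c * f x) \<and>
     f (order_unit S) = 1 \<and>
     (\<forall>x\<in>carrier S. mat 1 1 (\<lambda>_. x) \<in> mat_pos S 1 \<longrightarrow> 0 \<le> f x)"

definition null_space :: "'a matrix_ordered_star_space \<Rightarrow> 'a set" where
  "null_space S = {s \<in> carrier S. \<forall>f. unital_positive_functional S f \<longrightarrow> f s = 0}"

text \<open>The quotient \<open>S/N\<close>, whose elements are the cosets of \<open>N\<close>.\<close>

definition quotient_space ::
  "('a, 'm) pointed_star_space_scheme \<Rightarrow> 'a set \<Rightarrow> 'a set pointed_star_space" where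
  "quotient_space S N =
    \<lparr>carrier = a_rcosets\<^bsub>S\<^esub> N,
     monoid.mult = undefined, one = undefined,
     zero = N,
     add = (\<lambda>A B. A <+>\<^bsub>S\<^esub> B),
     smult = (\<lambda>c A. \<Union>x\<in>A. N +>\<^bsub>S\<^esub> (c \<odot>\<^bsub>S\<^esub> x)),
     star = (\<lambda>A. \<Union>x\<in>A. N +>\<^bsub>S\<^esub> (star S x)),
     order_unit = N +>\<^bsub>S\<^esub> (order_unit S)\<rparr>"

text \<open>
  Under \<open>M\<^sub>n(S)/M\<^sub>n(N) = M\<^sub>n(S/N)\<close>, the set \<open>C\<^sub>n + M\<^sub>n(N)\<close> is the image of \<open>C\<^sub>n\<close> under the
  entrywise quotient map.
\<close>

definition archimedeanisation ::
  "'a matrix_ordered_star_space \<Rightarrow> 'a set matrix_ordered_star_space" where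
  "archimedeanisation S =
    (let N = null_space S; Q = quotient_space S N in
     pointed_star_space.extend Q
       (matrix_ordered_star_space.fields
         (\<lambda>n. {X \<in> selfadjoint (mat_space Q n).
            \<forall>r>0. complex_of_real r \<odot>\<^bsub>mat_space Q n\<^esub> order_unit (mat_space Q n)
                    \<oplus>\<^bsub>mat_space Q n\<^esub> X
                  \<in> map_mat (\<lambda>x. N +>\<^bsub>S\<^esub> x) ` mat_pos S n})))"

definition psd_matrices :: "nat \<Rightarrow> complex mat set" where
  "psd_matrices n = {a \<in> carrier_mat n n. \<forall>v\<in>carrier_vec n. 0 \<le> (a *\<^sub>v v) \<bullet>c v}"

definition elementary_tensor ::
  "('a, 'm) pointed_star_space_scheme \<Rightarrow> complex mat \<Rightarrow> 'a \<Rightarrow> 'a mat" where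
  "elementary_tensor V a x = map_mat (\<lambda>c. c \<odot>\<^bsub>V\<^esub> x) a"

definition D_max :: "'a ordered_star_space \<Rightarrow> nat \<Rightarrow> 'a mat set" where
  "D_max V n =
    {\<Oplus>\<^bsub>mat_space V n\<^esub>i\<in>{..<k}. elementary_tensor V (a i) (x i) | (k::nat) a x.
       \<forall>i<k. a i \<in> psd_matrices n \<and> x i \<in> pos V}"

definition max_matrix_ordering :: "'a ordered_star_space \<Rightarrow> 'a matrix_ordered_star_space" where
  "max_matrix_ordering V =
     pointed_star_space.extend (pointed_star_space.truncate V)
       (matrix_ordered_star_space.fields (D_max V))"

definition OMAX :: "'a ordered_star_space \<Rightarrow> 'a set matrix_ordered_star_space" where
  "OMAX V = archimedeanisation (max_matrix_ordering V)"

text \<open>The map \<open>x + N\<^sub>V \<mapsto> f x + N\<^sub>W\<close> from \<open>OMAX V\<close> to \<open>OMAX W\<close> given by \<open>f : V \<rightarrow> W\<close>.\<close>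

definition OMAX_map :: "'b ordered_star_space \<Rightarrow> ('a \<Rightarrow> 'b) \<Rightarrow> 'a set \<Rightarrow> 'b set" where
  "OMAX_map W f A = (\<Union>x\<in>A. null_space (max_matrix_ordering W) +>\<^bsub>W\<^esub> f x)"


section \<open>Inductive limits\<close>

text \<open>
  A category is given by its class of objects (records with a carrier in a fixed type, which
  serves as the universe) and its class of morphisms, where morphisms are identified when they
  agree on the carrier of their source. The universal property ranges over all objects of the
  universe.
\<close>

definition inductive_system ::
  "(('a, 'm) partial_object_scheme \<Rightarrow> bool) \<Rightarrow>
   (('a, 'm) partial_object_scheme \<Rightarrow> ('a, 'm) partial_object_scheme \<Rightarrow> ('a \<Rightarrow> 'a) \<Rightarrow> bool) \<Rightarrow>
   (nat \<Rightarrow> ('a, 'm) partial_object_scheme) \<Rightarrow> (nat \<Rightarrow> 'a \<Rightarrow> 'a) \<Rightarrow> bool" where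
  "inductive_system obj mor A \<alpha> \<longleftrightarrow> (\<forall>k. obj (A k)) \<and> (\<forall>k. mor (A k) (A (Suc k)) (\<alpha> k))"

definition cocone ::
  "(('a, 'm) partial_object_scheme \<Rightarrow> bool) \<Rightarrow>
   (('a, 'm) partial_object_scheme \<Rightarrow> ('a, 'm) partial_object_scheme \<Rightarrow> ('a \<Rightarrow> 'a) \<Rightarrow> bool) \<Rightarrow>
   (nat \<Rightarrow> ('a, 'm) partial_object_scheme) \<Rightarrow> (nat \<Rightarrow> 'a \<Rightarrow> 'a) \<Rightarrow>
   ('a, 'm) partial_object_scheme \<Rightarrow> (nat \<Rightarrow> 'a \<Rightarrow> 'a) \<Rightarrow> bool" where
  "cocone obj mor A \<alpha> B \<beta> \<longleftrightarrow>
     obj B \<and> (\<forall>k. mor (A k) B (\<beta> k)) \<and> (\<forall>k. \<forall>x\<in>carrier (A k). \<beta> (Suc k) (\<alpha> k x) = \<beta> k x)"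

definition factorisation ::
  "(('a, 'm) partial_object_scheme \<Rightarrow> ('a, 'm) partial_object_scheme \<Rightarrow> ('a \<Rightarrow> 'a) \<Rightarrow> bool) \<Rightarrow>
   (nat \<Rightarrow> ('a, 'm) partial_object_scheme) \<Rightarrow>
   ('a, 'm) partial_object_scheme \<Rightarrow> (nat \<Rightarrow> 'a \<Rightarrow> 'a) \<Rightarrow>
   ('a, 'm) partial_object_scheme \<Rightarrow> (nat \<Rightarrow> 'a \<Rightarrow> 'a) \<Rightarrow> ('a \<Rightarrow> 'a) \<Rightarrow> bool" where
  "factorisation mor A L \<iota> B \<beta> u \<longleftrightarrow>
     mor L B u \<and> (\<forall>k. \<forall>x\<in>carrier (A k). u (\<iota> k x) = \<beta> k x)"

definition is_inductive_limit ::
  "(('a, 'm) partial_object_scheme \<Rightarrow> bool) \<Rightarrow>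
   (('a, 'm) partial_object_scheme \<Rightarrow> ('a, 'm) partial_object_scheme \<Rightarrow> ('a \<Rightarrow> 'a) \<Rightarrow> bool) \<Rightarrow>
   (nat \<Rightarrow> ('a, 'm) partial_object_scheme) \<Rightarrow> (nat \<Rightarrow> 'a \<Rightarrow> 'a) \<Rightarrow>
   ('a, 'm) partial_object_scheme \<Rightarrow> (nat \<Rightarrow> 'a \<Rightarrow> 'a) \<Rightarrow> bool" where
  "is_inductive_limit obj mor A \<alpha> L \<iota> \<longleftrightarrow>
     cocone obj mor A \<alpha> L \<iota> \<and>
     (\<forall>B \<beta>. cocone obj mor A \<alpha> B \<beta> \<longrightarrow>
        (\<exists>u. factorisation mor A L \<iota> B \<beta> u) \<and>
        (\<forall>u v. factorisation mor A L \<iota> B \<beta> u \<and> factorisation mor A L \<iota> B \<beta> v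
           \<longrightarrow> (\<forall>x\<in>carrier L. u x = v x)))"

end

(*
  OMAX is left adjoint to the functor sending an operator system T to the AOU space of its first
  matrix level, so it preserves inductive limits. A unital positive map f from V to this level
  extends to OMAX V because a positive semidefinite matrix is a sum of rank one matrices w* w,
  whence f maps a (x) x to a sum of compressions of the 1 x 1 matrix f x. Since the states of an AOU
  space separate its points, the Archimedeanisation divides out nothing, and OMAX V lives on V.

  The limit S receives a map from OMAX L by the universal property of L, and OMAX L receives a map
  from S by that of S; both composites are identities by uniqueness. The only set-theoretic point
  is that the universal property of L quantifies over spaces on the type 'a, whereas S lives on
  'a set: one uses the subspace of S spanned by the images of the V k, which embeds into 'a.
*)

theory Submission
  imports Defs
begin

section \<open>Star vector spaces\<close>

text \<open>Before the adjunction can be used, \<open>OMAX V\<close> has to be an operator system,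
  and each axiom has its own obstacle. For the order unit, every selfadjoint matrix over
  \<open>V\<close> has to be dominated by a multiple of the diagonal unit; it is split into tensors
  of a hermitian scalar matrix with a selfadjoint element, which are dominated by an explicit
  identity. Properness of the closed cones rests on states: applied entrywise they produce positive
  semidefinite scalar matrices, so an element that is positive along with its negative vanishes
  under every state. Stability under compression is a matter of tolerances, since compression
  replaces the unit by \<alpha>* \<alpha>, which is only bounded by a multiple of the unit.
  Separation by states uses neither norms nor the extension of functionals from subspaces: the
  positive cone is enlarged to one that orders the selfadjoint part totally, and a functional is
  read off as a Dedekind cut. The cosets in \<open>OMAX V\<close> are singletons of a different type
  than the elements of \<open>V\<close>, so the cones are studied on \<open>V\<close> and then
  transported along x \<mapsto> {x}.\<close>

lemma star_vector_spaceI: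
  fixes V :: "('a, 'm) pointed_star_space_scheme" (structure)
  assumes add: "\<And>x y. x \<in> carrier V \<Longrightarrow> y \<in> carrier V \<Longrightarrow> x \<oplus> y \<in> carrier V"
    and zero: "\<zero> \<in> carrier V"
    and assoc: "\<And>x y z. x \<in> carrier V \<Longrightarrow> y \<in> carrier V \<Longrightarrow> z \<in> carrier V \<Longrightarrow>
      (x \<oplus> y) \<oplus> z = x \<oplus> (y \<oplus> z)"
    and comm: "\<And>x y. x \<in> carrier V \<Longrightarrow> y \<in> carrier V \<Longrightarrow> x \<oplus> y = y \<oplus> x"
    and l_zero: "\<And>x. x \<in> carrier V \<Longrightarrow> \<zero> \<oplus> x = x"
    and smult: "\<And>c x. x \<in> carrier V \<Longrightarrow> c \<odot>\<^bsub>V\<^esub> x \<in> carrier V"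
    and smult_l: "\<And>c d x. x \<in> carrier V \<Longrightarrow> (c + d) \<odot>\<^bsub>V\<^esub> x = c \<odot>\<^bsub>V\<^esub> x \<oplus> d \<odot>\<^bsub>V\<^esub> x"
    and smult_r: "\<And>c x y. x \<in> carrier V \<Longrightarrow> y \<in> carrier V \<Longrightarrow>
      c \<odot>\<^bsub>V\<^esub> (x \<oplus> y) = c \<odot>\<^bsub>V\<^esub> x \<oplus> c \<odot>\<^bsub>V\<^esub> y"
    and smult_assoc: "\<And>c d x. x \<in> carrier V \<Longrightarrow> (c * d) \<odot>\<^bsub>V\<^esub> x = c \<odot>\<^bsub>V\<^esub> (d \<odot>\<^bsub>V\<^esub> x)"
    and smult_one: "\<And>x. x \<in> carrier V \<Longrightarrow> 1 \<odot>\<^bsub>V\<^esub> x = x"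
    and smult_zero: "\<And>x. x \<in> carrier V \<Longrightarrow> 0 \<odot>\<^bsub>V\<^esub> x = \<zero>"
    and star: "\<And>x. x \<in> carrier V \<Longrightarrow> star V x \<in> carrier V"
    and star_star: "\<And>x. x \<in> carrier V \<Longrightarrow> star V (star V x) = x"
    and star_add: "\<And>x y. x \<in> carrier V \<Longrightarrow> y \<in> carrier V \<Longrightarrow> star V (x \<oplus> y) = star V x \<oplus> star V y"
    and star_smult: "\<And>c x. x \<in> carrier V \<Longrightarrow> star V (c \<odot>\<^bsub>V\<^esub> x) = cnj c \<odot>\<^bsub>V\<^esub> star V x"
  shows "star_vector_space V"
proof -
  \<comment> \<open>\<open>0 x = 0\<close> stands in for the existence of additive inverses: it
    turns (-1) x into one.\<close>
  have inv: "\<exists>y\<in>carrier V. y \<oplus> x = \<zero>" if "x \<in> carrier V" for x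
  proof
    show "(- 1) \<odot>\<^bsub>V\<^esub> x \<oplus> x = \<zero>"
      using that smult_l[of x "- 1" 1] smult_one smult_zero by simp
    show "(- 1) \<odot>\<^bsub>V\<^esub> x \<in> carrier V" using that smult by blast
  qed
  have "abelian_group V"
    by (rule abelian_groupI) (use assms inv in auto)
  then have "module class_ring V"
    by (intro moduleI class_cring.is_cring) (use assms in auto)
  moreover have "field (class_ring :: complex ring)"
    using class_field.field_axioms .
  ultimately have "vectorspace class_ring V"
    unfolding vectorspace_def by blast
  then show ?thesis
    unfolding star_vector_space_def using star star_star star_add star_smult by blast
qed

locale star_space =
  fixes V :: "('a, 'm) pointed_star_space_scheme" (structure)
  assumes star_vector_space: "star_vector_space V"
begin

lemma module: "module class_ring V"
  using star_vector_space unfolding star_vector_space_def vectorspace_def by blast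

sublocale abelian_group V
  using module by (rule module.axioms)

lemma smult_closed [simp, intro]: "x \<in> carrier V \<Longrightarrow> c \<odot>\<^bsub>V\<^esub> x \<in> carrier V"
  using module.smult_closed[OF module] by simp

lemma smult_add_left: "x \<in> carrier V \<Longrightarrow> (c + d) \<odot>\<^bsub>V\<^esub> x = c \<odot>\<^bsub>V\<^esub> x \<oplus> d \<odot>\<^bsub>V\<^esub> x"
  using module.smult_l_distr[OF module, of c d x] by simp

lemma smult_add_right:
  "x \<in> carrier V \<Longrightarrow> y \<in> carrier V \<Longrightarrow> c \<odot>\<^bsub>V\<^esub> (x \<oplus> y) = c \<odot>\<^bsub>V\<^esub> x \<oplus> c \<odot>\<^bsub>V\<^esub> y"
  using module.smult_r_distr[OF module, of c x y] by simp

lemma smult_smult [simp]: "x \<in> carrier V \<Longrightarrow> c \<odot>\<^bsub>V\<^esub> (d \<odot>\<^bsub>V\<^esub> x) = (c * d) \<odot>\<^bsub>V\<^esub> x"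
  using module.smult_assoc1[OF module, of c d x] by simp

lemma smult_one [simp]: "x \<in> carrier V \<Longrightarrow> 1 \<odot>\<^bsub>V\<^esub> x = x"
  using module.smult_one[OF module, of x] by simp

lemma smult_zero_left [simp]: "x \<in> carrier V \<Longrightarrow> 0 \<odot>\<^bsub>V\<^esub> x = \<zero>"
  using module.smult_l_null[OF module, of x] by simp

lemma smult_zero_right [simp]: "c \<odot>\<^bsub>V\<^esub> \<zero> = \<zero>"
  using module.smult_r_null[OF module, of c] by simp

lemma a_inv_eq_smult: "x \<in> carrier V \<Longrightarrow> \<ominus> x = (- 1) \<odot>\<^bsub>V\<^esub> x"
  using smult_add_left[of x "- 1" 1] minus_equality[of "(- 1) \<odot>\<^bsub>V\<^esub> x" x] by simp

lemma minus_eq_smult: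
  "x \<in> carrier V \<Longrightarrow> y \<in> carrier V \<Longrightarrow> x \<ominus> y = x \<oplus> (- 1) \<odot>\<^bsub>V\<^esub> y"
  by (simp add: minus_eq a_inv_eq_smult)

lemma star_closed [simp, intro]: "x \<in> carrier V \<Longrightarrow> star V x \<in> carrier V"
  using star_vector_space unfolding star_vector_space_def by blast

lemma star_star [simp]: "x \<in> carrier V \<Longrightarrow> star V (star V x) = x"
  using star_vector_space unfolding star_vector_space_def by blast

lemma star_add:
  "x \<in> carrier V \<Longrightarrow> y \<in> carrier V \<Longrightarrow> star V (x \<oplus> y) = star V x \<oplus> star V y"
  using star_vector_space unfolding star_vector_space_def by blast

lemma star_smult: "x \<in> carrier V \<Longrightarrow> star V (c \<odot>\<^bsub>V\<^esub> x) = cnj c \<odot>\<^bsub>V\<^esub> star V x"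
  using star_vector_space unfolding star_vector_space_def by blast

lemma star_zero [simp]: "star V \<zero> = \<zero>"
  using star_smult[of \<zero> 0] by simp

lemma selfadjointD: "x \<in> selfadjoint V \<Longrightarrow> x \<in> carrier V" "x \<in> selfadjoint V \<Longrightarrow> star V x = x"
  unfolding selfadjoint_def by auto

lemma selfadjointI: "x \<in> carrier V \<Longrightarrow> star V x = x \<Longrightarrow> x \<in> selfadjoint V"
  unfolding selfadjoint_def by auto

lemma selfadjoint_zero [simp, intro]: "\<zero> \<in> selfadjoint V"
  by (simp add: selfadjoint_def)

lemma selfadjoint_add [intro]:
  "x \<in> selfadjoint V \<Longrightarrow> y \<in> selfadjoint V \<Longrightarrow> x \<oplus> y \<in> selfadjoint V"
  by (simp add: selfadjoint_def star_add)

lemma selfadjoint_smult [intro]: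
  "x \<in> selfadjoint V \<Longrightarrow> complex_of_real r \<odot>\<^bsub>V\<^esub> x \<in> selfadjoint V"
  by (simp add: selfadjoint_def star_smult)

lemma selfadjoint_uminus: "x \<in> selfadjoint V \<Longrightarrow> (- 1) \<odot>\<^bsub>V\<^esub> x \<in> selfadjoint V"
  using selfadjoint_smult[of x "- 1"] by simp

lemma smult_sum_left:
  assumes "finite A" "x \<in> carrier V"
  shows "(\<Oplus>k\<in>A. g k \<odot>\<^bsub>V\<^esub> x) = (\<Sum>k\<in>A. g k) \<odot>\<^bsub>V\<^esub> x"
  using assms by (induction A rule: finite_induct) (auto simp: smult_add_left)

section \<open>Selfadjoint real and imaginary parts of an element\<close>

definition real_part :: "'a \<Rightarrow> 'a" where
  "real_part x = (1/2) \<odot>\<^bsub>V\<^esub> (x \<oplus> star V x)"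

definition imag_part :: "'a \<Rightarrow> 'a" where
  "imag_part x = (- \<i>/2) \<odot>\<^bsub>V\<^esub> (x \<oplus> (- 1) \<odot>\<^bsub>V\<^esub> star V x)"

lemma real_part_selfadjoint: "x \<in> carrier V \<Longrightarrow> real_part x \<in> selfadjoint V"
  by (rule selfadjointI) (simp_all add: real_part_def star_smult star_add a_comm)

lemma imag_part_selfadjoint: "x \<in> carrier V \<Longrightarrow> imag_part x \<in> selfadjoint V"
  by (rule selfadjointI) (simp_all add: imag_part_def star_smult star_add a_comm smult_add_right)

lemma real_imag_decomp:
  assumes "x \<in> carrier V"
  shows "real_part x \<oplus> \<i> \<odot>\<^bsub>V\<^esub> imag_part x = x"
proof -
  have "real_part x \<oplus> \<i> \<odot>\<^bsub>V\<^esub> imag_part x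
      = ((1/2) \<odot>\<^bsub>V\<^esub> x \<oplus> (1/2) \<odot>\<^bsub>V\<^esub> star V x) \<oplus> ((1/2) \<odot>\<^bsub>V\<^esub> x \<oplus> (-1/2) \<odot>\<^bsub>V\<^esub> star V x)"
    using assms by (simp add: real_part_def imag_part_def smult_add_right)
  also have "\<dots> = ((1/2) \<odot>\<^bsub>V\<^esub> x \<oplus> (1/2) \<odot>\<^bsub>V\<^esub> x) \<oplus> ((1/2) \<odot>\<^bsub>V\<^esub> star V x \<oplus> (-1/2) \<odot>\<^bsub>V\<^esub> star V x)"
    using assms by (simp add: a_ac)
  also have "\<dots> = x"
    using assms by (simp flip: smult_add_left)
  finally show ?thesis .
qed

lemma real_part_add:
  "x \<in> carrier V \<Longrightarrow> y \<in> carrier V \<Longrightarrow> real_part (x \<oplus> y) = real_part x \<oplus> real_part y"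
  by (simp add: real_part_def star_add smult_add_right a_ac)

lemma imag_part_add:
  "x \<in> carrier V \<Longrightarrow> y \<in> carrier V \<Longrightarrow> imag_part (x \<oplus> y) = imag_part x \<oplus> imag_part y"
  by (simp add: imag_part_def star_add smult_add_right a_ac)

lemma real_part_smult_real:
  "x \<in> carrier V \<Longrightarrow> real_part (complex_of_real r \<odot>\<^bsub>V\<^esub> x) = complex_of_real r \<odot>\<^bsub>V\<^esub> real_part x"
  by (simp add: real_part_def star_smult smult_add_right mult.commute)

lemma imag_part_smult_real:
  "x \<in> carrier V \<Longrightarrow> imag_part (complex_of_real r \<odot>\<^bsub>V\<^esub> x) = complex_of_real r \<odot>\<^bsub>V\<^esub> imag_part x"
  by (simp add: imag_part_def star_smult smult_add_right mult.commute)

text \<open>Multiplication by \<i> rotates the pair of parts by a quarter turn; this makes a real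
  functional that is extended through the parts complex linear.\<close>

lemma real_part_smult_ii:
  "x \<in> carrier V \<Longrightarrow> real_part (\<i> \<odot>\<^bsub>V\<^esub> x) = (- 1) \<odot>\<^bsub>V\<^esub> imag_part x"
  by (simp add: real_part_def imag_part_def star_smult smult_add_right)

lemma imag_part_smult_ii: "x \<in> carrier V \<Longrightarrow> imag_part (\<i> \<odot>\<^bsub>V\<^esub> x) = real_part x"
  by (simp add: real_part_def imag_part_def star_smult smult_add_right)

lemma real_part_of_selfadjoint: "x \<in> selfadjoint V \<Longrightarrow> real_part x = x"
  using smult_add_left[of x "1/2" "1/2"] by (simp add: real_part_def smult_add_right selfadjointD)

lemma imag_part_of_selfadjoint: "x \<in> selfadjoint V \<Longrightarrow> imag_part x = \<zero>"
  using r_neg[of x] by (simp add: imag_part_def selfadjointD a_inv_eq_smult)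

end

section \<open>Cones and order units\<close>

context star_space
begin

lemma coneD:
  assumes "is_cone V C"
  shows "x \<in> C \<Longrightarrow> x \<in> selfadjoint V" "x \<in> C \<Longrightarrow> x \<in> carrier V"
    "x \<in> C \<Longrightarrow> y \<in> C \<Longrightarrow> x \<oplus> y \<in> C"
    "x \<in> C \<Longrightarrow> 0 \<le> r \<Longrightarrow> complex_of_real r \<odot>\<^bsub>V\<^esub> x \<in> C"
  using assms selfadjointD unfolding is_cone_def by blast+

lemma cone_zero: "is_cone V C \<Longrightarrow> \<zero> \<in> C"
proof -
  assume C: "is_cone V C"
  then obtain x where "x \<in> C" unfolding is_cone_def by blast
  then show ?thesis using coneD(2,4)[OF C, of x] by (force dest: spec[of _ 0])
qed

lemma cone_smult_cancel:
  assumes "is_cone V C" "0 < r" "x \<in> carrier V" "complex_of_real r \<odot>\<^bsub>V\<^esub> x \<in> C"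
  shows "x \<in> C"
  using coneD(4)[OF assms(1,4), of "1 / r"] assms(2,3) by simp

text \<open>The set \<open>D\<close> is the smallest cone that contains \<open>C\<close> and y.
  Adjoining x to a maximal cone shows that this cone is total, and adjoining -w to the positive cone
  forces a functional to be nonpositive at w.\<close>

lemma cone_adjoin:
  assumes "is_cone V C" "y \<in> selfadjoint V"
  defines "D \<equiv> {c \<oplus> complex_of_real t \<odot>\<^bsub>V\<^esub> y | c t. c \<in> C \<and> 0 \<le> t}"
  shows "is_cone V D" "C \<subseteq> D" "y \<in> D"
proof -
  note C = coneD[OF assms(1)] and y = selfadjointD[OF assms(2)]
  have mem: "c \<oplus> complex_of_real t \<odot>\<^bsub>V\<^esub> y \<in> D" if "c \<in> C" "0 \<le> t" for c t
    using that unfolding D_def by blast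
  show "C \<subseteq> D"
  proof
    fix c assume "c \<in> C"
    then show "c \<in> D" using mem[of c 0] C(2) y(1) by simp
  qed
  show "y \<in> D" using mem[OF cone_zero[OF assms(1)], of 1] y(1) by simp
  show "is_cone V D"
    unfolding is_cone_def
  proof (intro conjI ballI allI impI)
    show "D \<subseteq> selfadjoint V" using C(1) assms(2) unfolding D_def by blast
    show "D \<noteq> {}" using \<open>y \<in> D\<close> by blast
    fix u assume "u \<in> D"
    then obtain c t where u: "u = c \<oplus> complex_of_real t \<odot>\<^bsub>V\<^esub> y" "c \<in> C" "0 \<le> t"
      unfolding D_def by blast
    show "complex_of_real r \<odot>\<^bsub>V\<^esub> u \<in> D" if "0 \<le> r" for r
      using mem[of "complex_of_real r \<odot>\<^bsub>V\<^esub> c" "r * t"] u C that y(1)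
      by (simp add: smult_add_right)
    fix v assume "v \<in> D"
    then obtain d s where v: "v = d \<oplus> complex_of_real s \<odot>\<^bsub>V\<^esub> y" "d \<in> C" "0 \<le> s"
      unfolding D_def by blast
    show "u \<oplus> v \<in> D"
      using mem[of "c \<oplus> d" "t + s"] u v C y(1) by (simp add: smult_add_left a_ac)
  qed
qed

end

section \<open>States separate the points of an AOU space\<close>

context star_space
begin

lemma order_unitD:
  assumes "is_order_unit V C e" "is_cone V C"
  shows "e \<in> C" "x \<in> selfadjoint V \<Longrightarrow> \<exists>r>0. complex_of_real r \<odot>\<^bsub>V\<^esub> e \<oplus> (- 1) \<odot>\<^bsub>V\<^esub> x \<in> C"
proof -
  show "e \<in> C" using assms unfolding is_order_unit_def by blast
  show "\<exists>r>0. complex_of_real r \<odot>\<^bsub>V\<^esub> e \<oplus> (- 1) \<odot>\<^bsub>V\<^esub> x \<in> C" if x: "x \<in> selfadjoint V"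
  proof -
    obtain r where "r > 0" "complex_of_real r \<odot>\<^bsub>V\<^esub> e \<ominus> x \<in> C"
      using assms x unfolding is_order_unit_def by blast
    moreover have "e \<in> carrier V" using \<open>e \<in> C\<close> coneD(2)[OF assms(2)] by blast
    ultimately show ?thesis using x selfadjointD(1)[OF x] by (auto simp: minus_eq_smult)
  qed
qed

text \<open>One constant serves both signs: the one-sided bounds for x and -x are added, which is
  harmless because e is positive.\<close>

lemma order_unit_bounds:
  assumes "is_cone V C" "is_order_unit V C e" "x \<in> selfadjoint V"
  shows "\<exists>r>0. complex_of_real r \<odot>\<^bsub>V\<^esub> e \<oplus> (- 1) \<odot>\<^bsub>V\<^esub> x \<in> C \<and> complex_of_real r \<odot>\<^bsub>V\<^esub> e \<oplus> x \<in> C"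
proof -
  note C = coneD[OF assms(1)] and x = selfadjointD[OF assms(3)]
  have e: "e \<in> C" "e \<in> carrier V" using order_unitD(1)[OF assms(2,1)] C(2) by auto
  obtain r where r: "r > 0" "complex_of_real r \<odot>\<^bsub>V\<^esub> e \<oplus> (- 1) \<odot>\<^bsub>V\<^esub> x \<in> C"
    using order_unitD(2)[OF assms(2,1,3)] by blast
  obtain s where s: "s > 0" "complex_of_real s \<odot>\<^bsub>V\<^esub> e \<oplus> x \<in> C"
    using order_unitD(2)[OF assms(2,1) selfadjoint_uminus[OF assms(3)]] x by auto
  have "complex_of_real s \<odot>\<^bsub>V\<^esub> e \<oplus> (complex_of_real r \<odot>\<^bsub>V\<^esub> e \<oplus> (- 1) \<odot>\<^bsub>V\<^esub> x) \<in> C"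
    using C(3,4) e r s by simp
  moreover have "complex_of_real r \<odot>\<^bsub>V\<^esub> e \<oplus> (complex_of_real s \<odot>\<^bsub>V\<^esub> e \<oplus> x) \<in> C"
    using C(3,4) e r s by simp
  ultimately show ?thesis
    using r(1) s(1) e x by (intro exI[of _ "r + s"]) (simp add: smult_add_left a_ac)
qed

text \<open>Zorn's lemma on the cones that contain \<open>C\<close> and avoid n. The union of a
  nonempty chain is again such a cone, because any two of its elements lie in a common
  member.\<close>

lemma maximal_cone:
  assumes "is_cone V C" "n \<in> carrier V" "n \<notin> C"
  obtains M where "is_cone V M" "C \<subseteq> M" "n \<notin> M"
    "\<And>D. is_cone V D \<Longrightarrow> M \<subseteq> D \<Longrightarrow> n \<notin> D \<Longrightarrow> D = M"
proof -
  define \<A> where "\<A> = {D. is_cone V D \<and> C \<subseteq> D \<and> n \<notin> D}"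
  have "C \<in> \<A>" using assms unfolding \<A>_def by blast
  moreover have "\<Union>\<C> \<in> \<A>" if ne: "\<C> \<noteq> {}" and chain: "subset.chain \<A> \<C>" for \<C>
  proof -
    have mem: "is_cone V D" "C \<subseteq> D" "n \<notin> D" if "D \<in> \<C>" for D
      using chain that unfolding subset.chain_def \<A>_def by blast+
    have tot: "D \<subseteq> E \<or> E \<subseteq> D" if "D \<in> \<C>" "E \<in> \<C>" for D E
      using chain that unfolding subset.chain_def by blast
    have "is_cone V (\<Union>\<C>)"
      unfolding is_cone_def
    proof (intro conjI ballI allI impI)
      show "\<Union>\<C> \<subseteq> selfadjoint V" using coneD(1)[OF mem(1)] by blast
      show "\<Union>\<C> \<noteq> {}" using ne cone_zero[OF mem(1)] by blast
      show "complex_of_real r \<odot>\<^bsub>V\<^esub> x \<in> \<Union>\<C>" if "0 \<le> r" "x \<in> \<Union>\<C>" for r x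
        using coneD(4)[OF mem(1)] that by blast
      fix x y assume "x \<in> \<Union>\<C>" "y \<in> \<Union>\<C>"
      then obtain D where "D \<in> \<C>" "x \<in> D" "y \<in> D"
        using tot by (metis UnionE in_mono)
      then show "x \<oplus> y \<in> \<Union>\<C>" using coneD(3)[OF mem(1)] by blast
    qed
    moreover have "C \<subseteq> \<Union>\<C>" "n \<notin> \<Union>\<C>" using ne mem by blast+
    ultimately show ?thesis unfolding \<A>_def by blast
  qed
  ultimately obtain M where M: "M \<in> \<A>" "\<forall>D\<in>\<A>. M \<subseteq> D \<longrightarrow> D = M"
    using subset_Zorn_nonempty[of \<A>] by (metis empty_iff)
  show thesis
  proof (rule that[of M])
    show "is_cone V M" "C \<subseteq> M" "n \<notin> M" using M(1) unfolding \<A>_def by auto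
    show "D = M" if "is_cone V D" "M \<subseteq> D" "n \<notin> D" for D
      using M that \<open>C \<subseteq> M\<close> unfolding \<A>_def by blast
  qed
qed

text \<open>
  A cone that is maximal among those not containing \<open>-e\<close> totally orders the selfadjoint part, so
  that every selfadjoint \<open>x\<close> cuts the multiples of \<open>e\<close> at a single real number.
\<close>

lemma maximal_cone_total:
  assumes M: "is_cone V M" "(- 1) \<odot>\<^bsub>V\<^esub> e \<notin> M" "e \<in> M"
    and max: "\<And>D. is_cone V D \<Longrightarrow> M \<subseteq> D \<Longrightarrow> (- 1) \<odot>\<^bsub>V\<^esub> e \<notin> D \<Longrightarrow> D = M"
    and x: "x \<in> selfadjoint V" "x \<notin> M"
  shows "(- 1) \<odot>\<^bsub>V\<^esub> x \<in> M"
proof -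
  note C = coneD[OF M(1)] and xc = selfadjointD[OF x(1)]
  have e: "e \<in> carrier V" using M C by blast
  define D where "D = {c \<oplus> complex_of_real t \<odot>\<^bsub>V\<^esub> x | c t. c \<in> M \<and> 0 \<le> t}"
  note D = cone_adjoin[OF M(1) x(1), folded D_def]
  have "(- 1) \<odot>\<^bsub>V\<^esub> e \<in> D" using max[OF D(1,2)] D(3) x(2) by blast
  then obtain c t where c: "(- 1) \<odot>\<^bsub>V\<^esub> e = c \<oplus> complex_of_real t \<odot>\<^bsub>V\<^esub> x" "c \<in> M" "0 \<le> t"
    unfolding D_def by blast
  have cc: "c \<in> carrier V" using c C by blast
  have "t \<noteq> 0"
  proof
    assume "t = 0"
    then have "(- 1) \<odot>\<^bsub>V\<^esub> e = c" using c(1) xc cc by simp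
    then show False using c(2) M(2) by simp
  qed
  \<comment> \<open>Adding e to the equation for -e and moving the multiple of x to the other side
    gives t (-x) = c + e, an element of \<open>M\<close>; then t > 0 is cancelled.\<close>
  have "c \<oplus> e = (c \<oplus> e) \<oplus> (complex_of_real t \<odot>\<^bsub>V\<^esub> x \<oplus> (- complex_of_real t) \<odot>\<^bsub>V\<^esub> x)"
    using cc e xc by (simp flip: smult_add_left)
  also have "\<dots> = e \<oplus> ((c \<oplus> complex_of_real t \<odot>\<^bsub>V\<^esub> x) \<oplus> (- complex_of_real t) \<odot>\<^bsub>V\<^esub> x)"
    using cc e xc by (simp add: a_ac)
  also have "\<dots> = (e \<oplus> (- 1) \<odot>\<^bsub>V\<^esub> e) \<oplus> (- complex_of_real t) \<odot>\<^bsub>V\<^esub> x"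
    unfolding c(1)[symmetric] using e xc by (simp add: a_assoc)
  also have "e \<oplus> (- 1) \<odot>\<^bsub>V\<^esub> e = \<zero>" using r_neg[OF e] e by (simp add: a_inv_eq_smult)
  finally have "complex_of_real t \<odot>\<^bsub>V\<^esub> ((- 1) \<odot>\<^bsub>V\<^esub> x) = c \<oplus> e" using xc by simp
  then show ?thesis
    using cone_smult_cancel[OF M(1), of t "(- 1) \<odot>\<^bsub>V\<^esub> x"] C(3)[OF c(2) M(3)] c(3) \<open>t \<noteq> 0\<close> xc by simp
qed

definition real_linear :: "('a \<Rightarrow> real) \<Rightarrow> bool" where
  "real_linear f \<longleftrightarrow>
     (\<forall>x\<in>selfadjoint V. \<forall>y\<in>selfadjoint V. f (x \<oplus> y) = f x + f y) \<and>
     (\<forall>r. \<forall>x\<in>selfadjoint V. f (complex_of_real r \<odot>\<^bsub>V\<^esub> x) = r * f x)"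

lemma real_linearD:
  assumes "real_linear f" "x \<in> selfadjoint V"
  shows "y \<in> selfadjoint V \<Longrightarrow> f (x \<oplus> y) = f x + f y" "f (complex_of_real r \<odot>\<^bsub>V\<^esub> x) = r * f x"
  using assms unfolding real_linear_def by blast+

text \<open>The value at x is a Dedekind cut: the r with x - r e in \<open>M\<close> lie below those
  with r e - x in \<open>M\<close>. Totality makes the two sets cover the line, the absence of -e
  makes them meet in at most one point, and the order unit makes both nonempty.\<close>

lemma total_cone_functional:
  assumes M: "is_cone V M" and n: "(- 1) \<odot>\<^bsub>V\<^esub> e \<notin> M" and ou: "is_order_unit V M e"
    and tot: "\<And>x. x \<in> selfadjoint V \<Longrightarrow> x \<in> M \<or> (- 1) \<odot>\<^bsub>V\<^esub> x \<in> M"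
  shows "\<exists>f. real_linear f \<and> f e = 1 \<and> (\<forall>x\<in>M. 0 \<le> f x)"
proof -
  note C = coneD[OF M]
  have eM: "e \<in> M" and e: "e \<in> carrier V" using order_unitD(1)[OF ou M] C by auto
  define le where "le x r \<longleftrightarrow> complex_of_real r \<odot>\<^bsub>V\<^esub> e \<oplus> (- 1) \<odot>\<^bsub>V\<^esub> x \<in> M" for x r
  define ge where "ge x r \<longleftrightarrow> complex_of_real (- r) \<odot>\<^bsub>V\<^esub> e \<oplus> x \<in> M" for x r
  have neg: "0 \<le> r" if "complex_of_real r \<odot>\<^bsub>V\<^esub> e \<in> M" for r
  proof (rule ccontr)
    assume "\<not> 0 \<le> r"
    then show False
      using n cone_smult_cancel[OF M, of "- r" "(- 1) \<odot>\<^bsub>V\<^esub> e"] that e by auto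
  qed
  have dich: "le x r \<or> ge x r" if x: "x \<in> selfadjoint V" for x r
  proof -
    have "complex_of_real r \<odot>\<^bsub>V\<^esub> e \<oplus> (- 1) \<odot>\<^bsub>V\<^esub> x \<in> selfadjoint V"
      using C(1)[OF eM] x by (intro selfadjoint_add selfadjoint_smult selfadjoint_uminus)
    from tot[OF this] show ?thesis
      using e selfadjointD[OF x] unfolding le_def ge_def by (auto simp: smult_add_right)
  qed
  have add: "0 \<le> r + s" if "complex_of_real r \<odot>\<^bsub>V\<^esub> e \<oplus> (- 1) \<odot>\<^bsub>V\<^esub> x \<in> M"
      "complex_of_real s \<odot>\<^bsub>V\<^esub> e \<oplus> x \<in> M" "x \<in> carrier V" for r s x
  proof -
    have "(complex_of_real r \<odot>\<^bsub>V\<^esub> e \<oplus> (- 1) \<odot>\<^bsub>V\<^esub> x) \<oplus> (complex_of_real s \<odot>\<^bsub>V\<^esub> e \<oplus> x)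
      = (complex_of_real r \<odot>\<^bsub>V\<^esub> e \<oplus> complex_of_real s \<odot>\<^bsub>V\<^esub> e) \<oplus> (x \<oplus> (- 1) \<odot>\<^bsub>V\<^esub> x)"
      using e that by (simp add: a_ac)
    also have "x \<oplus> (- 1) \<odot>\<^bsub>V\<^esub> x = \<zero>" using that r_neg[of x] by (simp add: a_inv_eq_smult)
    finally have "complex_of_real (r + s) \<odot>\<^bsub>V\<^esub> e \<in> M"
      using C(3)[OF that(1,2)] e by (simp add: smult_add_left)
    then show ?thesis by (rule neg)
  qed
  have le_ge: "s \<le> r" if "le x r" "ge x s" "x \<in> carrier V" for x r s
    using add[of r x "- s"] that unfolding le_def ge_def by simp
  define f where "f x = Sup {r. ge x r}" for x
  have ge_ne: "\<exists>r. ge x r" and le_ne: "\<exists>r. le x r" if x: "x \<in> selfadjoint V" for x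
  proof -
    obtain r where "complex_of_real r \<odot>\<^bsub>V\<^esub> e \<oplus> (- 1) \<odot>\<^bsub>V\<^esub> x \<in> M" "complex_of_real r \<odot>\<^bsub>V\<^esub> e \<oplus> x \<in> M"
      using order_unit_bounds[OF M ou x] by blast
    then have "le x r" "ge x (- r)" unfolding le_def ge_def by auto
    then show "\<exists>r. ge x r" "\<exists>r. le x r" by blast+
  qed
  have le_f: "s \<le> f x" if x: "x \<in> selfadjoint V" "ge x s" for x s
  proof -
    obtain b where "le x b" using le_ne[OF x(1)] by blast
    then have "bdd_above {r. ge x r}"
      using le_ge[OF _ _ selfadjointD(1)[OF x(1)]] by (intro bdd_aboveI[of _ b]) auto
    then show ?thesis unfolding f_def using x(2) by (intro cSup_upper) auto
  qed
  have f_le: "f x \<le> r" if "x \<in> selfadjoint V" "le x r" for x r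
    unfolding f_def
    by (rule cSup_least) (use that ge_ne le_ge selfadjointD in auto)
  have le_above: "le x r" if "x \<in> selfadjoint V" "f x < r" for x r
    using dich[OF that(1), of r] le_f[OF that(1), of r] that(2) by auto
  have ge_below: "ge x r" if "x \<in> selfadjoint V" "r < f x" for x r
    using dich[OF that(1), of r] f_le[OF that(1), of r] that(2) by auto
  \<comment> \<open>\<open>M\<close> need not be Archimedean, so \<open>le\<close> or
    \<open>ge\<close> may fail at the cut point itself; values are therefore determined up to an
    arbitrarily small error.\<close>
  have f_eqI: "f x = a" if x: "x \<in> selfadjoint V"
      and "\<And>\<epsilon>. \<epsilon> > 0 \<Longrightarrow> le x (a + \<epsilon>)" "\<And>\<epsilon>. \<epsilon> > 0 \<Longrightarrow> ge x (a - \<epsilon>)" for x a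
  proof (rule antisym)
    show "f x \<le> a" by (rule field_le_epsilon) (rule f_le[OF x that(2)])
    show "a \<le> f x" by (rule field_le_epsilon) (use le_f[OF x that(3)] in \<open>simp add: diff_le_eq\<close>)
  qed
  have le_add: "le (x \<oplus> y) (r + s)" if "le x r" "le y s" "x \<in> carrier V" "y \<in> carrier V" for x y r s
    using C(3)[OF that(1,2)[unfolded le_def]] that(3,4) e unfolding le_def
    by (simp add: smult_add_left smult_add_right a_ac)
  have ge_add: "ge (x \<oplus> y) (r + s)" if "ge x r" "ge y s" "x \<in> carrier V" "y \<in> carrier V" for x y r s
  proof -
    have sum: "complex_of_real (- (r + s)) = complex_of_real (- r) + complex_of_real (- s)" by simp
    show ?thesis
      using C(3)[OF that(1,2)[unfolded ge_def]] that(3,4) e unfolding ge_def sum smult_add_left[OF e]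
      by (simp add: a_ac del: of_real_minus)
  qed
  have le_scale: "le (complex_of_real t \<odot>\<^bsub>V\<^esub> x) (t * r)"
    if "le x r" "0 \<le> t" "x \<in> carrier V" for x r t
    using C(4)[OF that(1)[unfolded le_def] that(2)] that(3) e unfolding le_def
    by (simp add: smult_add_right)
  have ge_scale: "ge (complex_of_real t \<odot>\<^bsub>V\<^esub> x) (t * r)"
    if "ge x r" "0 \<le> t" "x \<in> carrier V" for x r t
    using C(4)[OF that(1)[unfolded ge_def] that(2)] that(3) e unfolding ge_def
    by (simp add: smult_add_right)
  have f_add: "f (x \<oplus> y) = f x + f y" if x: "x \<in> selfadjoint V" and y: "y \<in> selfadjoint V" for x y
  proof (rule f_eqI)
    show "x \<oplus> y \<in> selfadjoint V" using x y by blast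
    fix \<epsilon> :: real assume "\<epsilon> > 0"
    show "le (x \<oplus> y) (f x + f y + \<epsilon>)"
      using le_add[OF le_above[OF x, of "f x + \<epsilon>/2"] le_above[OF y, of "f y + \<epsilon>/2"]]
        \<open>\<epsilon> > 0\<close> selfadjointD(1)[OF x] selfadjointD(1)[OF y] by (simp add: algebra_simps)
    show "ge (x \<oplus> y) (f x + f y - \<epsilon>)"
      using ge_add[OF ge_below[OF x, of "f x - \<epsilon>/2"] ge_below[OF y, of "f y - \<epsilon>/2"]]
        \<open>\<epsilon> > 0\<close> selfadjointD(1)[OF x] selfadjointD(1)[OF y] by (simp add: algebra_simps)
  qed
  \<comment> \<open>Negative factors exchange the two sides of the cut, so they are treated
    afterwards through additivity.\<close>
  have scale: "f (complex_of_real t \<odot>\<^bsub>V\<^esub> x) = t * f x" if x: "x \<in> selfadjoint V" and t: "0 < t" for t x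
  proof (rule f_eqI)
    show "complex_of_real t \<odot>\<^bsub>V\<^esub> x \<in> selfadjoint V" using x by blast
    fix \<epsilon> :: real assume "\<epsilon> > 0"
    then have "0 < \<epsilon> / t" "t * (\<epsilon> / t) = \<epsilon>" using t by auto
    then show "le (complex_of_real t \<odot>\<^bsub>V\<^esub> x) (t * f x + \<epsilon>)" "ge (complex_of_real t \<odot>\<^bsub>V\<^esub> x) (t * f x - \<epsilon>)"
      using le_scale[OF le_above[OF x, of "f x + \<epsilon>/t"], of t] t selfadjointD[OF x]
        ge_scale[OF ge_below[OF x, of "f x - \<epsilon>/t"], of t]
      by (simp_all add: distrib_left right_diff_distrib)
  qed
  have f0: "f \<zero> = 0" using f_add[of \<zero> \<zero>] by simp
  have f_smult: "f (complex_of_real r \<odot>\<^bsub>V\<^esub> x) = r * f x" if x: "x \<in> selfadjoint V" for r x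
  proof -
    consider "r > 0" | "r = 0" | "r < 0" by linarith
    then show ?thesis
    proof cases
      case 1 then show ?thesis using scale[OF x] by blast
    next
      case 2 then show ?thesis using f0 selfadjointD[OF x] by simp
    next
      case 3
      have "complex_of_real r \<odot>\<^bsub>V\<^esub> x \<oplus> complex_of_real (- r) \<odot>\<^bsub>V\<^esub> x = \<zero>"
        using selfadjointD[OF x] by (simp flip: smult_add_left)
      then have "f (complex_of_real r \<odot>\<^bsub>V\<^esub> x) + f (complex_of_real (- r) \<odot>\<^bsub>V\<^esub> x) = 0"
        using f_add[of "complex_of_real r \<odot>\<^bsub>V\<^esub> x" "complex_of_real (- r) \<odot>\<^bsub>V\<^esub> x"] x f0
        by (simp add: selfadjoint_smult del: of_real_minus)
      then show ?thesis using scale[OF x, of "- r"] 3 by simp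
    qed
  qed
  have "f e = 1"
  proof (rule f_eqI)
    show "e \<in> selfadjoint V" using C(1) eM by blast
    fix \<epsilon> :: real assume "\<epsilon> > 0"
    then show "le e (1 + \<epsilon>)" "ge e (1 - \<epsilon>)"
      using C(4)[OF eM, of \<epsilon>] e unfolding le_def ge_def
      by (simp_all flip: smult_add_left)
        (use smult_add_left[OF e, of "complex_of_real \<epsilon> - 1" 1] in simp)
  qed
  moreover have "0 \<le> f x" if "x \<in> M" for x
    using le_f[of x 0] C(1,2) that e unfolding ge_def by simp
  ultimately show ?thesis
    using f_add f_smult unfolding real_linear_def by blast
qed

end

locale aou = star_space V for V :: "'a ordered_star_space" (structure) +
  assumes aou_space: "aou_space V"

lemma aouI: "aou_space V \<Longrightarrow> aou V"
  unfolding aou_def star_space_def aou_axioms_def aou_space_def by blast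

context aou
begin

abbreviation "e \<equiv> order_unit V"

lemma cone_pos: "is_cone V (pos V)"
  and order_unit_pos: "is_order_unit V (pos V) e"
  and archimedean_pos: "is_archimedean V (pos V) e"
  and proper_pos: "pos V \<inter> (\<lambda>x. \<ominus> x) ` pos V = {\<zero>}"
  using aou_space unfolding aou_space_def is_proper_cone_def by simp_all

lemmas posD = coneD[OF cone_pos]

lemma unit_pos [simp, intro]: "e \<in> pos V"
  using order_unit_pos unfolding is_order_unit_def by blast

lemma unit_carrier [simp, intro]: "e \<in> carrier V"
  using posD(2) by blast

lemma pos_antisym: "x \<in> pos V \<Longrightarrow> (- 1) \<odot>\<^bsub>V\<^esub> x \<in> pos V \<Longrightarrow> x = \<zero>"
proof -
  assume x: "x \<in> pos V" and nx: "(- 1) \<odot>\<^bsub>V\<^esub> x \<in> pos V"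
  have "x = \<ominus> ((- 1) \<odot>\<^bsub>V\<^esub> x)" using posD(2)[OF x] by (simp add: a_inv_eq_smult)
  then have "x \<in> (\<lambda>x. \<ominus> x) ` pos V" using nx by blast
  then show ?thesis using proper_pos x by blast
qed

lemma pos_archimedean:
  assumes "x \<in> selfadjoint V" "\<And>r. r > 0 \<Longrightarrow> complex_of_real r \<odot>\<^bsub>V\<^esub> e \<oplus> x \<in> pos V"
  shows "x \<in> pos V"
  using archimedean_pos assms unfolding is_archimedean_def by blast

text \<open>
  If \<open>x\<close> is not positive, then neither is \<open>w = re + x\<close> for some \<open>r > 0\<close>; enlarging the cone by \<open>-w\<close>
  yields a state that is nonpositive at \<open>w\<close>, hence negative at \<open>x\<close>.
\<close>

lemma negative_functional:
  assumes x: "x \<in> selfadjoint V" "x \<notin> pos V"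
  shows "\<exists>f. real_linear f \<and> f e = 1 \<and> (\<forall>x\<in>pos V. 0 \<le> f x) \<and> f x < 0"
proof -
  obtain r where r: "r > 0" "complex_of_real r \<odot>\<^bsub>V\<^esub> e \<oplus> x \<notin> pos V"
    using pos_archimedean[OF x(1)] x(2) by blast
  define w where "w = complex_of_real r \<odot>\<^bsub>V\<^esub> e \<oplus> x"
  have esa: "e \<in> selfadjoint V" using posD(1) by blast
  have w: "w \<in> selfadjoint V" "w \<notin> pos V"
    using r x(1) esa unfolding w_def by auto
  have wc: "w \<in> carrier V" using w selfadjointD by blast
  define nw where "nw = (- 1) \<odot>\<^bsub>V\<^esub> w"
  have nw: "nw \<in> selfadjoint V" using selfadjoint_uminus[OF w(1)] nw_def by simp
  define D where "D = {c \<oplus> complex_of_real t \<odot>\<^bsub>V\<^esub> nw | c t. c \<in> pos V \<and> 0 \<le> t}"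
  note D = cone_adjoin[OF cone_pos nw, folded D_def]
  \<comment> \<open>Otherwise t w = c + e for a positive c. For t > 0 this makes w positive; for t =
    0 both e and -e are positive, whence e = 0.\<close>
  have "(- 1) \<odot>\<^bsub>V\<^esub> e \<notin> D"
  proof
    assume "(- 1) \<odot>\<^bsub>V\<^esub> e \<in> D"
    then obtain c t where c: "(- 1) \<odot>\<^bsub>V\<^esub> e = c \<oplus> complex_of_real t \<odot>\<^bsub>V\<^esub> nw" "c \<in> pos V" "0 \<le> t"
      unfolding D_def by blast
    have cc: "c \<in> carrier V" using c posD by blast
    have tw: "complex_of_real t \<odot>\<^bsub>V\<^esub> w = c \<oplus> e"
    proof -
      have "complex_of_real t \<odot>\<^bsub>V\<^esub> w
          = ((- 1) \<odot>\<^bsub>V\<^esub> e \<oplus> e) \<oplus> complex_of_real t \<odot>\<^bsub>V\<^esub> w"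
        using wc l_neg[of e] by (simp add: a_inv_eq_smult)
      also have "\<dots> = (c \<oplus> e) \<oplus> ((- complex_of_real t) \<odot>\<^bsub>V\<^esub> w \<oplus> complex_of_real t \<odot>\<^bsub>V\<^esub> w)"
        unfolding c(1) nw_def using cc wc by (simp add: a_ac)
      also have "\<dots> = c \<oplus> e" using cc wc by (simp flip: smult_add_left)
      finally show ?thesis .
    qed
    show False
    proof (cases "t = 0")
      case False
      then show ?thesis
        using cone_smult_cancel[OF cone_pos, of t w] tw posD(3)[OF c(2) unit_pos] c(3) w(2) wc by simp
    next
      case True
      then have "(- 1) \<odot>\<^bsub>V\<^esub> e = c" using c(1) cc selfadjointD(1)[OF nw] by simp
      then have "e = \<zero>" using pos_antisym[OF unit_pos] c(2) by simp
      \<comment> \<open>For e = 0 the order unit bound for -w says that w is positive.\<close>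
      then show False
        using order_unitD(2)[OF order_unit_pos cone_pos nw] w(2) wc unfolding nw_def by auto
    qed
  qed
  then obtain M where M: "is_cone V M" "D \<subseteq> M" "(- 1) \<odot>\<^bsub>V\<^esub> e \<notin> M"
    and max: "\<And>D. is_cone V D \<Longrightarrow> M \<subseteq> D \<Longrightarrow> (- 1) \<odot>\<^bsub>V\<^esub> e \<notin> D \<Longrightarrow> D = M"
    using maximal_cone[OF D(1), of "(- 1) \<odot>\<^bsub>V\<^esub> e"] by auto
  have sub: "pos V \<subseteq> M" "nw \<in> M" using D M(2) by auto
  have ou: "is_order_unit V M e"
    using order_unit_pos sub(1) unfolding is_order_unit_def by blast
  have tot: "x \<in> M \<or> (- 1) \<odot>\<^bsub>V\<^esub> x \<in> M" if "x \<in> selfadjoint V" for x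
    using maximal_cone_total[OF M(1,3) _ max that] sub(1) by blast
  obtain f where f: "real_linear f" "f e = 1" "\<forall>x\<in>M. 0 \<le> f x"
    using total_cone_functional[OF M(1,3) ou tot] by blast
  have "0 \<le> - f w" using real_linearD(2)[OF f(1) w(1), of "- 1"] bspec[OF f(3) sub(2)] unfolding nw_def by simp
  moreover have "f w = r + f x"
    using real_linearD(1)[OF f(1) selfadjoint_smult[OF esa] x(1)] real_linearD(2)[OF f(1) esa] f(2)
    unfolding w_def by simp
  ultimately have "f x < 0" using r(1) by simp
  then show ?thesis using f sub(1) by blast
qed

text \<open>Positivity refers to the order of the complex numbers, in which \<open>0 \<le> z\<close>
  also asserts that z is real.\<close>

definition state :: "('a \<Rightarrow> complex) \<Rightarrow> bool" where
  "state F \<longleftrightarrow>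
     (\<forall>x\<in>carrier V. \<forall>y\<in>carrier V. F (x \<oplus> y) = F x + F y) \<and>
     (\<forall>c. \<forall>x\<in>carrier V. F (c \<odot>\<^bsub>V\<^esub> x) = c * F x) \<and>
     F e = 1 \<and> (\<forall>x\<in>pos V. 0 \<le> F x)"

text \<open>The parts are real linear and are exchanged up to sign by \<i>, which gives complex
  linearity. A positive element is selfadjoint, so its imaginary part vanishes and its value is the
  one given by f.\<close>

lemma functional_complexify:
  assumes lin: "real_linear f" and unit: "f e = 1" and pos: "\<forall>x\<in>pos V. 0 \<le> f x"
  shows "state (\<lambda>x. Complex (f (real_part x)) (f (imag_part x)))" (is "state ?F")
proof -
  note add = real_linearD(1)[OF lin] and smult = real_linearD(2)[OF lin]
  have Fadd: "?F (x \<oplus> y) = ?F x + ?F y" if "x \<in> carrier V" "y \<in> carrier V" for x y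
    using that by (simp add: real_part_add imag_part_add add real_part_selfadjoint imag_part_selfadjoint
        complex_eq_iff)
  have Freal: "?F (complex_of_real r \<odot>\<^bsub>V\<^esub> x) = complex_of_real r * ?F x" if "x \<in> carrier V" for r x
    using that by (simp add: real_part_smult_real imag_part_smult_real smult
        real_part_selfadjoint imag_part_selfadjoint complex_eq_iff)
  have Fii: "?F (\<i> \<odot>\<^bsub>V\<^esub> x) = \<i> * ?F x" if "x \<in> carrier V" for x
    using that smult[of "imag_part x" "- 1"]
    by (simp add: real_part_smult_ii imag_part_smult_ii imag_part_selfadjoint complex_eq_iff)
  have Fsmult: "?F (c \<odot>\<^bsub>V\<^esub> x) = c * ?F x" if x: "x \<in> carrier V" for c x
  proof -
    have "c \<odot>\<^bsub>V\<^esub> x = complex_of_real (Re c) \<odot>\<^bsub>V\<^esub> x \<oplus> complex_of_real (Im c) \<odot>\<^bsub>V\<^esub> (\<i> \<odot>\<^bsub>V\<^esub> x)"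
      using x complex_eq[of c] smult_add_left[OF x, of "complex_of_real (Re c)" "\<i> * complex_of_real (Im c)"]
      by (simp add: mult.commute)
    then have "?F (c \<odot>\<^bsub>V\<^esub> x) = complex_of_real (Re c) * ?F x + complex_of_real (Im c) * (\<i> * ?F x)"
      by (simp only: Fadd[OF smult_closed[OF x] smult_closed[OF smult_closed[OF x]]] Freal[OF x]
          Freal[OF smult_closed[OF x]] Fii[OF x])
    also have "\<dots> = (complex_of_real (Re c) + \<i> * complex_of_real (Im c)) * ?F x"
      by (simp add: algebra_simps)
    finally show ?thesis using complex_eq[of c] by simp
  qed
  have sa: "?F x = complex_of_real (f x)" if "x \<in> selfadjoint V" for x
    using that smult[of \<zero> 0]
    by (simp add: real_part_of_selfadjoint imag_part_of_selfadjoint complex_eq_iff)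
  show ?thesis
    unfolding state_def
    using Fadd Fsmult sa unit pos posD(1) by (auto simp: less_eq_complex_def)
qed

text \<open>A selfadjoint element killed by all states is positive along with its negative, hence
  zero. For general x this is applied to both parts, which states kill because they also kill the
  adjoint of x.\<close>

theorem states_separate:
  assumes "x \<in> carrier V" "\<And>F. state F \<Longrightarrow> F x = 0"
  shows "x = \<zero>"
proof -
  have pos: "y \<in> pos V" if y: "y \<in> selfadjoint V" and F: "\<And>F. state F \<Longrightarrow> F y = 0" for y
  proof (rule ccontr)
    assume "y \<notin> pos V"
    then obtain f where f: "real_linear f" "f e = 1" "\<forall>x\<in>pos V. 0 \<le> f x" "f y < 0"
      using negative_functional[OF y] by blast
    have "Complex (f (real_part y)) (f (imag_part y)) = 0"
      using F[OF functional_complexify[OF f(1-3)]] .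
    then show False using f(4) y by (simp add: real_part_of_selfadjoint complex_eq_iff)
  qed
  have zero: "y = \<zero>" if y: "y \<in> selfadjoint V" and F: "\<And>F. state F \<Longrightarrow> F y = 0" for y
  proof -
    have "y \<in> pos V" by (rule pos[OF y]) (rule F)
    moreover have "(- 1) \<odot>\<^bsub>V\<^esub> y \<in> pos V"
    proof (rule pos[OF selfadjoint_uminus[OF y]])
      show "F ((- 1) \<odot>\<^bsub>V\<^esub> y) = 0" if "state F" for F
        using that F[OF that] selfadjointD(1)[OF y] unfolding state_def by simp
    qed
    ultimately show ?thesis by (rule pos_antisym)
  qed
  have star0: "F (star V x) = 0" if "state F" for F
  proof -
    \<comment> \<open>Some r e + y is positive, so its value is real, and r is real as well.\<close>
    have herm: "Im (F y) = 0" if y: "y \<in> selfadjoint V" for y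
    proof -
      obtain r where r: "complex_of_real r \<odot>\<^bsub>V\<^esub> e \<oplus> y \<in> pos V"
        using order_unit_bounds[OF cone_pos order_unit_pos y] by blast
      have "F (complex_of_real r \<odot>\<^bsub>V\<^esub> e \<oplus> y) = complex_of_real r + F y"
        using \<open>state F\<close> selfadjointD[OF y] unfolding state_def by simp
      moreover have "0 \<le> F (complex_of_real r \<odot>\<^bsub>V\<^esub> e \<oplus> y)"
        using r \<open>state F\<close> unfolding state_def by blast
      ultimately show ?thesis by (simp add: less_eq_complex_def)
    qed
    have re: "F (real_part x) = F x / 2 + F (star V x) / 2"
      using \<open>state F\<close> assms(1) unfolding state_def real_part_def by (simp add: add_divide_distrib)
    have im: "F (imag_part x) = (- \<i> / 2) * (F x - F (star V x))"
      using \<open>state F\<close> assms(1) unfolding state_def imag_part_def by simp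
    have x0: "F x = 0" using assms(2) that by blast
    show ?thesis
      using herm[OF real_part_selfadjoint[OF assms(1)]] herm[OF imag_part_selfadjoint[OF assms(1)]] re im x0
      by (simp add: complex_eq_iff)
  qed
  have "real_part x = \<zero>"
  proof (rule zero)
    show "F (real_part x) = 0" if "state F" for F
      using that star0[OF that] assms unfolding state_def real_part_def by simp
  qed (use assms real_part_selfadjoint in blast)
  moreover have "imag_part x = \<zero>"
  proof (rule zero)
    show "F (imag_part x) = 0" if "state F" for F
      using that star0[OF that] assms unfolding state_def imag_part_def by simp
  qed (use assms imag_part_selfadjoint in blast)
  ultimately show ?thesis using real_imag_decomp[OF assms(1)] by simp
qed

end

section \<open>Positive semidefinite matrices\<close>

text \<open>Scalar matrices and vectors are functions of indices, of which only those below n are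
  read. Sums and Schur complements can then be written pointwise; in exchange, equality below n has
  to be handled by congruence rules.\<close>

definition quad_form :: "nat \<Rightarrow> (nat \<Rightarrow> nat \<Rightarrow> complex) \<Rightarrow> (nat \<Rightarrow> complex) \<Rightarrow> complex" where
  "quad_form n a v = (\<Sum>i<n. \<Sum>j<n. cnj (v i) * a i j * v j)"

definition psd :: "nat \<Rightarrow> (nat \<Rightarrow> nat \<Rightarrow> complex) \<Rightarrow> bool" where
  "psd n a \<longleftrightarrow> (\<forall>v. 0 \<le> quad_form n a v)"

lemma psd_matrices_iff:
  "a \<in> psd_matrices n \<longleftrightarrow> a \<in> carrier_mat n n \<and> psd n (\<lambda>i j. a $$ (i, j))"
proof (cases "a \<in> carrier_mat n n")
  case True
  have qf: "(a *\<^sub>v w) \<bullet>c w = quad_form n (\<lambda>i j. a $$ (i, j)) (\<lambda>i. w $ i)"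
    if w: "w \<in> carrier_vec n" for w
    using True w
    by (auto simp: quad_form_def scalar_prod_def mult_mat_vec_def sum_distrib_right atLeast0LessThan
        intro!: sum.cong)
  have "quad_form n (\<lambda>i j. a $$ (i, j)) v = quad_form n (\<lambda>i j. a $$ (i, j)) (\<lambda>i. vec n v $ i)" for v
    by (simp add: quad_form_def)
  then have "psd n (\<lambda>i j. a $$ (i, j)) \<longleftrightarrow> (\<forall>v\<in>carrier_vec n. 0 \<le> quad_form n (\<lambda>i j. a $$ (i, j)) (\<lambda>i. v $ i))"
    unfolding psd_def by (metis vec_carrier)
  then show ?thesis using True qf unfolding psd_matrices_def by auto
next
  case False
  then show ?thesis unfolding psd_matrices_def by blast
qed

lemma quad_form_cong:
  "(\<And>i j. i < n \<Longrightarrow> j < n \<Longrightarrow> a i j = b i j) \<Longrightarrow> quad_form n a v = quad_form n b v"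
  by (simp add: quad_form_def)

lemma quad_form_add: "quad_form n (\<lambda>i j. a i j + b i j) v = quad_form n a v + quad_form n b v"
  by (simp add: quad_form_def sum.distrib algebra_simps)

lemma quad_form_scale: "quad_form n (\<lambda>i j. c * a i j) v = c * quad_form n a v"
  by (simp add: quad_form_def sum_distrib_left mult.assoc mult.left_commute)

lemma quad_form_identity: "quad_form n (\<lambda>i j. if i = j then c else 0) v = c * (\<Sum>i<n. cnj (v i) * v i)"
  by (simp add: quad_form_def if_distrib[of "\<lambda>x. _ * x"] if_distrib[of "\<lambda>x. x * _"] sum_distrib_left
      mult_ac cong: if_cong)

text \<open>Changing a single coordinate yields the test vectors with two nonzero coordinates as
  well as the completed square of the Schur complement.\<close>

lemma quad_form_perturb:
  assumes "k < n"
  shows "quad_form n a (\<lambda>i. v i + (if i = k then t else 0)) =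
    quad_form n a v + cnj t * (\<Sum>j<n. a k j * v j) + t * (\<Sum>i<n. cnj (v i) * a i k) + cnj t * t * a k k"
proof -
  have "cnj (v i + (if i = k then t else 0)) * a i j * (v j + (if j = k then t else 0))
    = cnj (v i) * a i j * v j + (if i = k then cnj t * (a k j * v j) else 0)
      + (if j = k then t * (cnj (v i) * a i k) else 0) + (if i = k then if j = k then cnj t * t * a k k else 0 else 0)"
    for i j by (simp add: algebra_simps)
  moreover have "(\<Sum>i<n. \<Sum>j<n. if i = k then cnj t * (a k j * v j) else 0) = cnj t * (\<Sum>j<n. a k j * v j)"
    using assms by (subst sum.swap) (simp add: sum_distrib_left)
  moreover have "(\<Sum>i<n. \<Sum>j<n. if i = k then if j = k then cnj t * t * a k k else 0 else 0) = cnj t * t * a k k"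
    using assms by (subst sum.swap) simp
  ultimately show ?thesis
    using assms by (simp add: quad_form_def sum.distrib sum_distrib_left)
qed

lemma quad_form_two:
  assumes "i < n" "k < n"
  shows "quad_form n a (\<lambda>l. (if l = i then s else 0) + (if l = k then t else 0)) =
    cnj s * s * a i i + cnj t * s * a k i + t * cnj s * a i k + cnj t * t * a k k"
proof -
  have 1: "quad_form n a (\<lambda>l. if l = i then s else 0) = cnj s * s * a i i"
    using quad_form_perturb[OF assms(1), of a "\<lambda>_. 0" s] by (simp add: quad_form_def)
  have 2: "(\<Sum>j<n. a k j * (if j = i then s else 0)) = a k i * s"
    "(\<Sum>l<n. cnj (if l = i then s else 0) * a l k) = cnj s * a i k"
    using assms by (simp_all add: if_distrib[of "\<lambda>x. _ * x"] if_distrib[of "\<lambda>x. x * _"] if_distrib[of cnj] cong: if_cong)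
  show ?thesis
    unfolding quad_form_perturb[OF assms(2)] 1 2 by (simp add: mult_ac)
qed

text \<open>Polarisation: unit vectors give the diagonal, and the i-th unit vector plus 1 or \<i>
  times the j-th gives \<open>a j i + a i j\<close> and, up to a factor,
  \<open>a i j - a j i\<close>.\<close>

lemma quad_form_zero_imp_zero:
  assumes "\<And>v. quad_form n a v = 0" "i < n" "j < n"
  shows "a i j = 0"
proof -
  have d: "a k k = 0" if "k < n" for k
    using quad_form_two[OF that that, of a 1 0] assms(1) by simp
  have "a j i + a i j = 0"
    using quad_form_two[OF assms(2,3), of a 1 1] assms by (simp add: d)
  moreover have "- (\<i> * a j i) + \<i> * a i j = 0"
    using quad_form_two[OF assms(2,3), of a 1 \<i>] assms by (simp add: d)
  then have "\<i> * (a i j - a j i) = 0" by (simp add: algebra_simps)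
  then have "a i j = a j i" by simp
  ultimately show ?thesis by simp
qed

lemma quad_form_adjoint: "quad_form n (\<lambda>i j. cnj (a j i)) v = cnj (quad_form n a v)"
  unfolding quad_form_def by (subst sum.swap) (simp add: mult_ac)

text \<open>The form takes real values, so it does not distinguish a matrix from its adjoint, and a
  matrix is determined by its form.\<close>

lemma psd_hermitian:
  assumes "psd n a" "i < n" "j < n"
  shows "cnj (a j i) = a i j"
proof -
  have "quad_form n (\<lambda>i j. a i j + (- 1) * cnj (a j i)) v = 0" for v
    using assms(1) unfolding psd_def quad_form_add quad_form_scale quad_form_adjoint
    by (simp add: less_eq_complex_def complex_eq_iff)
  from quad_form_zero_imp_zero[OF this assms(2,3)] show ?thesis by simp
qed

lemma psd_diagonal: "psd n a \<Longrightarrow> i < n \<Longrightarrow> 0 \<le> a i i"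
  using quad_form_two[of i n i a 1 0] unfolding psd_def by (metis (no_types, lifting)
    add.right_neutral complex_cnj_one complex_cnj_zero mult_1 mult_zero_left)

text \<open>If \<open>a k i\<close> were nonzero, moving the i-th unit vector by
  \<open>- s * a k i\<close> in direction k would lower the form linearly in s, with no quadratic
  term to compensate since \<open>a k k = 0\<close>.\<close>

lemma psd_zero_diagonal:
  assumes "psd n a" "a k k = 0" "k < n" "i < n"
  shows "a k i = 0"
proof (rule ccontr)
  assume "a k i \<noteq> 0"
  have ik: "a i k = cnj (a k i)" using psd_hermitian[OF assms(1,4,3)] by simp
  have *: "2 * s * (cmod (a k i))\<^sup>2 \<le> Re (a i i)" for s :: real
  proof -
    have "0 \<le> quad_form n a (\<lambda>l. (if l = i then 1 else 0) + (if l = k then - complex_of_real s * a k i else 0))"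
      using assms(1) unfolding psd_def by blast
    also have "\<dots> = a i i - 2 * complex_of_real s * (a k i * cnj (a k i))"
      unfolding quad_form_two[OF assms(4,3)] using assms(2) ik by (simp add: algebra_simps)
    finally show ?thesis
      by (simp add: less_eq_complex_def complex_mult_cnj cmod_power2)
  qed
  have "(cmod (a k i))\<^sup>2 > 0" using \<open>a k i \<noteq> 0\<close> by simp
  then show False
    \<comment> \<open>For this s the left side of the inequality exceeds its right side by
      one.\<close>
    using *[of "(Re (a i i) + 1) / (2 * (cmod (a k i))\<^sup>2)"] by (simp add: field_simps)
qed

text \<open>Completing the square: the form of the complement at v is the form of a at v with the
  k-th coordinate lowered by \<open>s / a k k\<close>, where s is the k-th entry of the product of a
  and v.\<close>

lemma schur_complement_psd:
  assumes a: "psd n a" and k: "k < n" and nz: "a k k \<noteq> 0"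
  shows "psd n (\<lambda>i j. a i j - a i k * a k j / a k k)"
  unfolding psd_def
proof
  fix v
  define s where "s = (\<Sum>j<n. a k j * v j)"
  have real: "cnj (a k k) = a k k" using psd_hermitian[OF a k k] .
  have s': "(\<Sum>i<n. cnj (v i) * a i k) = cnj s"
    unfolding s_def cnj_sum complex_cnj_mult using psd_hermitian[OF a _ k]
    by (intro sum.cong) (auto simp: mult.commute)
  have "quad_form n (\<lambda>i j. a i k * a k j / a k k) v = (\<Sum>i<n. cnj (v i) * a i k) * (\<Sum>j<n. a k j * v j) / a k k"
    unfolding quad_form_def sum_product sum_divide_distrib by (intro sum.cong refl) (simp add: mult_ac)
  also have "\<dots> = cnj s * s / a k k" using s' s_def by simp
  finally have 1: "quad_form n (\<lambda>i j. a i j - a i k * a k j / a k k) v = quad_form n a v - cnj s * s / a k k"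
    using quad_form_add[of n a "\<lambda>i j. (- 1) * (a i k * a k j / a k k)" v]
      quad_form_scale[of n "- 1" "\<lambda>i j. a i k * a k j / a k k" v] by simp
  have "quad_form n a (\<lambda>i. v i + (if i = k then - s / a k k else 0)) = quad_form n a v - cnj s * s / a k k"
    unfolding quad_form_perturb[OF k] s_def[symmetric] s' using nz real by (simp add: field_simps)
  then show "0 \<le> quad_form n (\<lambda>i j. a i j - a i k * a k j / a k k) v"
    using a 1 unfolding psd_def by metis
qed

text \<open>
  Cholesky: splitting off the rank one matrix through the first nonzero row leaves the Schur
  complement, which is again positive semidefinite and has one more zero row.
\<close>

lemma psd_rank_one_induct [consumes 1, case_names cong zero add]:
  assumes "psd n a"
    and cong: "\<And>a b. (\<And>i j. i < n \<Longrightarrow> j < n \<Longrightarrow> a i j = b i j) \<Longrightarrow> Q a \<Longrightarrow> Q b"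
    and zero: "Q (\<lambda>_ _. 0)"
    and add: "\<And>a w. Q a \<Longrightarrow> Q (\<lambda>i j. a i j + cnj (w i) * w j)"
  shows "Q a"
proof -
  \<comment> \<open>The number m bounds the rows that may be nonzero: the first n - m rows vanish,
    so that in the induction step row n - Suc m is the pivot row.\<close>
  have "Q a" if "psd n a" "m \<le> n" "\<And>i j. i < n \<Longrightarrow> j < n \<Longrightarrow> i < n - m \<Longrightarrow> a i j = 0" for m a
    using that
  proof (induction m arbitrary: a)
    case 0
    then show ?case by (intro cong[OF _ zero]) auto
  next
    case (Suc m)
    define k where "k = n - Suc m"
    have k: "k < n" "n - m = Suc k" using Suc.prems(2) unfolding k_def by auto
    have rows: "a i j = 0" if "i < n" "j < n" "i < k" for i j
      using Suc.prems(3) that unfolding k_def by blast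
    show ?case
    proof (cases "a k k = 0")
      case True
      have "a i j = 0" if "i < n" "j < n" "i < n - m" for i j
        using that rows psd_zero_diagonal[OF Suc.prems(1) True k(1)] k(2) less_SucE by metis
      then show ?thesis using Suc.IH[OF Suc.prems(1)] Suc.prems(2) by simp
    next
      case False
      have herm: "cnj (a j i) = a i j" if "i < n" "j < n" for i j
        using psd_hermitian[OF Suc.prems(1) that] .
      have "a k k = complex_of_real (Re (a k k))" "0 \<le> Re (a k k)"
        using psd_diagonal[OF Suc.prems(1) k(1)] by (simp_all add: less_eq_complex_def complex_eq_iff)
      \<comment> \<open>With d a square root of the pivot, \<open>cnj (w i) * w j\<close> is exactly
        the term that the Schur complement subtracts.\<close>
      then obtain d where d: "a k k = complex_of_real d * complex_of_real d" "d \<noteq> 0"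
        using False by (metis mult_zero_left of_real_0 of_real_mult real_sqrt_mult_self abs_of_nonneg)
      define b where "b = (\<lambda>i j. a i j - a i k * a k j / a k k)"
      define w where "w j = a k j / complex_of_real d" for j
      have "Q b"
      proof (rule Suc.IH)
        show "psd n b" unfolding b_def using schur_complement_psd[OF Suc.prems(1) k(1) False] .
        show "m \<le> n" using Suc.prems(2) by simp
        fix i j assume ij: "i < n" "j < n" "i < n - m"
        then consider "i < k" | "i = k" using k(2) by linarith
        then show "b i j = 0"
          using rows[OF ij(1,2)] rows[OF ij(1) k(1)] False unfolding b_def by cases auto
      qed
      then have "Q (\<lambda>i j. b i j + cnj (w i) * w j)" by (rule add)
      moreover have "b i j + cnj (w i) * w j = a i j" if "i < n" "j < n" for i j
        using herm[OF that(1) k(1)] d unfolding b_def w_def by (simp add: field_simps)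
      ultimately show ?thesis by (rule cong[rotated])
    qed
  qed
  from this[of a n] show ?thesis using assms(1) by simp
qed

text \<open>The sum t of the moduli of all entries bounds the form by t times the squared length of
  v, because the product of two coordinates is at most this squared length in modulus. Hence t
  outweighs both the matrix and its negative.\<close>

lemma hermitian_shift_psd:
  assumes herm: "\<And>i j. i < n \<Longrightarrow> j < n \<Longrightarrow> cnj (a j i) = a i j"
  obtains t where "0 \<le> t" "psd n (\<lambda>i j. (if i = j then complex_of_real t else 0) + a i j)"
    "psd n (\<lambda>i j. (if i = j then complex_of_real t else 0) + (- 1) * a i j)"
proof -
  define t where "t = (\<Sum>i<n. \<Sum>j<n. cmod (a i j))"
  have "0 \<le> t" unfolding t_def by (intro sum_nonneg) auto
  have bound: "\<bar>Re (quad_form n a v)\<bar> \<le> t * (\<Sum>i<n. (cmod (v i))\<^sup>2)" for v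
  proof -
    define N where "N = (\<Sum>i<n. (cmod (v i))\<^sup>2)"
    have le: "(cmod (v i))\<^sup>2 \<le> N" if "i < n" for i
      unfolding N_def using that by (intro member_le_sum) auto
    have prod: "cmod (v i) * cmod (v j) \<le> N" if "i < n" "j < n" for i j
    proof -
      have "0 \<le> (cmod (v i) - cmod (v j))\<^sup>2" by simp
      then have "2 * (cmod (v i) * cmod (v j)) \<le> (cmod (v i))\<^sup>2 + (cmod (v j))\<^sup>2"
        by (simp add: power2_diff)
      then show ?thesis using le[OF that(1)] le[OF that(2)] by linarith
    qed
    have "cmod (quad_form n a v) \<le> (\<Sum>i<n. \<Sum>j<n. cmod (cnj (v i) * a i j * v j))"
      unfolding quad_form_def by (rule order_trans[OF norm_sum sum_mono[OF norm_sum]])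
    also have "\<dots> \<le> (\<Sum>i<n. \<Sum>j<n. cmod (a i j) * N)"
    proof (intro sum_mono)
      fix i j assume "i \<in> {..<n}" "j \<in> {..<n}"
      then show "cmod (cnj (v i) * a i j * v j) \<le> cmod (a i j) * N"
        using mult_left_mono[OF prod, of i j "cmod (a i j)"] by (simp add: norm_mult mult_ac)
    qed
    also have "\<dots> = t * N" unfolding t_def by (simp add: sum_distrib_right)
    finally show ?thesis using abs_Re_le_cmod[of "quad_form n a v"] unfolding N_def by linarith
  qed
  have "quad_form n a v = cnj (quad_form n a v)" for v
    unfolding quad_form_adjoint[symmetric] by (rule quad_form_cong) (simp add: herm)
  then have real: "Im (quad_form n a v) = 0" for v
    by (metis complex_In_mult_cnj_zero add.inverse_neutral cnj.simps(2) equal_neg_zero)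
  have id: "quad_form n (\<lambda>i j. if i = j then complex_of_real t else 0) v
      = complex_of_real (t * (\<Sum>i<n. (cmod (v i))\<^sup>2))" for v
    unfolding quad_form_identity by (simp add: complex_norm_square mult.commute del: of_real_power)
  have "psd n (\<lambda>i j. (if i = j then complex_of_real t else 0) + a i j)"
    using bound real by (simp add: psd_def quad_form_add id less_eq_complex_def abs_le_iff) (smt (verit))
  moreover have "psd n (\<lambda>i j. (if i = j then complex_of_real t else 0) + (- 1) * a i j)"
    unfolding psd_def quad_form_add quad_form_scale id
    using bound real by (simp add: less_eq_complex_def abs_le_iff)
  ultimately show thesis using that \<open>0 \<le> t\<close> by blast
qed

section \<open>Matrices over a star vector space\<close>

lemma mat_space_simps:
  "carrier (mat_space V n) = {X \<in> carrier_mat n n. \<forall>i<n. \<forall>j<n. X $$ (i, j) \<in> carrier V}"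
  "zero (mat_space V n) = mat n n (\<lambda>_. \<zero>\<^bsub>V\<^esub>)"
  "add (mat_space V n) X Y = mat n n (\<lambda>ij. X $$ ij \<oplus>\<^bsub>V\<^esub> Y $$ ij)"
  "smult (mat_space V n) c X = mat n n (\<lambda>ij. c \<odot>\<^bsub>V\<^esub> X $$ ij)"
  "star (mat_space V n) X = mat n n (\<lambda>(i, j). star V (X $$ (j, i)))"
  "order_unit (mat_space V n) = mat n n (\<lambda>(i, j). if i = j then order_unit V else \<zero>\<^bsub>V\<^esub>)"
  by (simp_all add: mat_space_def)

text \<open>Counterpart of \<open>elementary_tensor\<close> with explicit dimension and the scalar
  matrix given as a function of indices, to match \<open>psd\<close>.\<close>

definition tensor ::
  "('a, 'm) pointed_star_space_scheme \<Rightarrow> nat \<Rightarrow> (nat \<Rightarrow> nat \<Rightarrow> complex) \<Rightarrow> 'a \<Rightarrow> 'a mat" where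
  "tensor V n a x = mat n n (\<lambda>(i, j). a i j \<odot>\<^bsub>V\<^esub> x)"

lemma elementary_tensor_eq_tensor:
  "a \<in> carrier_mat n n \<Longrightarrow> elementary_tensor V a x = tensor V n (\<lambda>i j. a $$ (i, j)) x"
  by (auto simp: elementary_tensor_def tensor_def)

lemma tensor_cong:
  "(\<And>i j. i < n \<Longrightarrow> j < n \<Longrightarrow> a i j = b i j) \<Longrightarrow> tensor V n a x = tensor V n b x"
  by (auto simp: tensor_def)

lemma (in star_space) star_space_mat: "star_space (mat_space V n)"
proof
  show "star_vector_space (mat_space V n)"
    by (rule star_vector_spaceI)
      (auto intro!: eq_matI simp: mat_space_simps a_ac smult_add_left smult_add_right star_add star_smult)
qed

context star_space
begin

lemma tensor_closed [simp, intro]: "x \<in> carrier V \<Longrightarrow> tensor V n a x \<in> carrier (mat_space V n)"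
  by (simp add: tensor_def mat_space_simps)

lemma tensor_selfadjoint:
  assumes "x \<in> selfadjoint V" "\<And>i j. i < n \<Longrightarrow> j < n \<Longrightarrow> cnj (a j i) = a i j"
  shows "tensor V n a x \<in> selfadjoint (mat_space V n)"
  using assms selfadjointD[OF assms(1)]
  unfolding selfadjoint_def tensor_def by (auto simp: star_smult mat_space_simps)

lemma tensor_zero_left: "x \<in> carrier V \<Longrightarrow> tensor V n (\<lambda>_ _. 0) x = zero (mat_space V n)"
  by (auto simp: tensor_def mat_space_simps)

lemma tensor_add_left:
  "x \<in> carrier V \<Longrightarrow>
    tensor V n (\<lambda>i j. a i j + b i j) x = tensor V n a x \<oplus>\<^bsub>mat_space V n\<^esub> tensor V n b x"
  by (auto simp: tensor_def smult_add_left mat_space_simps)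

lemma unit_eq_tensor:
  "order_unit V \<in> carrier V \<Longrightarrow>
    order_unit (mat_space V n) = tensor V n (\<lambda>i j. if i = j then 1 else 0) (order_unit V)"
  by (auto simp: tensor_def mat_space_simps)

lemma smult_tensor:
  "x \<in> carrier V \<Longrightarrow> c \<odot>\<^bsub>mat_space V n\<^esub> tensor V n a x = tensor V n (\<lambda>i j. c * a i j) x"
  by (auto simp: tensor_def mat_space_simps)

lemma compression_closed [simp, intro]:
  assumes "X \<in> carrier (mat_space V n)" "\<alpha> \<in> carrier_mat n m"
  shows "compression V \<alpha> X \<in> carrier (mat_space V m)"
  using assms unfolding compression_def by (auto simp: mat_space_simps intro!: finsum_closed)

lemma compression_add:
  assumes "X \<in> carrier (mat_space V n)" "Y \<in> carrier (mat_space V n)" "\<alpha> \<in> carrier_mat n m"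
  shows "compression V \<alpha> (X \<oplus>\<^bsub>mat_space V n\<^esub> Y)
    = compression V \<alpha> X \<oplus>\<^bsub>mat_space V m\<^esub> compression V \<alpha> Y"
proof (rule eq_matI)
  fix i j
  assume "i < dim_row (compression V \<alpha> X \<oplus>\<^bsub>mat_space V m\<^esub> compression V \<alpha> Y)"
    "j < dim_col (compression V \<alpha> X \<oplus>\<^bsub>mat_space V m\<^esub> compression V \<alpha> Y)"
  then have ij: "i < m" "j < m" by (auto simp: mat_space_simps)
  have XY: "X $$ (k, l) \<in> carrier V" "Y $$ (k, l) \<in> carrier V" if "k < n" "l < n" for k l
    using assms that by (auto simp: mat_space_simps)
  define c where "c k l = cnj (\<alpha> $$ (k, i)) * \<alpha> $$ (l, j)" for k l
  have "(\<Oplus>k\<in>{..<n}. \<Oplus>l\<in>{..<n}. c k l \<odot>\<^bsub>V\<^esub> (X $$ (k, l) \<oplus> Y $$ (k, l)))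
    = (\<Oplus>k\<in>{..<n}. (\<Oplus>l\<in>{..<n}. c k l \<odot>\<^bsub>V\<^esub> X $$ (k, l)) \<oplus> (\<Oplus>l\<in>{..<n}. c k l \<odot>\<^bsub>V\<^esub> Y $$ (k, l)))"
  proof (intro finsum_cong' refl)
    fix k assume k: "k \<in> {..<n}"
    have "(\<Oplus>l\<in>{..<n}. c k l \<odot>\<^bsub>V\<^esub> (X $$ (k, l) \<oplus> Y $$ (k, l)))
      = (\<Oplus>l\<in>{..<n}. c k l \<odot>\<^bsub>V\<^esub> X $$ (k, l) \<oplus> c k l \<odot>\<^bsub>V\<^esub> Y $$ (k, l))"
      using XY k by (intro finsum_cong') (auto simp: smult_add_right)
    also have "\<dots> = (\<Oplus>l\<in>{..<n}. c k l \<odot>\<^bsub>V\<^esub> X $$ (k, l)) \<oplus> (\<Oplus>l\<in>{..<n}. c k l \<odot>\<^bsub>V\<^esub> Y $$ (k, l))"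
      using XY k by (intro finsum_addf) auto
    finally show "(\<Oplus>l\<in>{..<n}. c k l \<odot>\<^bsub>V\<^esub> (X $$ (k, l) \<oplus> Y $$ (k, l))) = \<dots>" .
  qed (use XY in \<open>auto intro!: finsum_closed\<close>)
  also have "\<dots> = (\<Oplus>k\<in>{..<n}. \<Oplus>l\<in>{..<n}. c k l \<odot>\<^bsub>V\<^esub> X $$ (k, l))
      \<oplus> (\<Oplus>k\<in>{..<n}. \<Oplus>l\<in>{..<n}. c k l \<odot>\<^bsub>V\<^esub> Y $$ (k, l))"
    using XY by (intro finsum_addf) (auto intro!: finsum_closed)
  finally have "(\<Oplus>k\<in>{..<n}. \<Oplus>l\<in>{..<n}. c k l \<odot>\<^bsub>V\<^esub> (X $$ (k, l) \<oplus> Y $$ (k, l))) = \<dots>" .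
  moreover have "(\<Oplus>k\<in>{..<n}. \<Oplus>l\<in>{..<n}. c k l \<odot>\<^bsub>V\<^esub> (X \<oplus>\<^bsub>mat_space V n\<^esub> Y) $$ (k, l))
    = (\<Oplus>k\<in>{..<n}. \<Oplus>l\<in>{..<n}. c k l \<odot>\<^bsub>V\<^esub> (X $$ (k, l) \<oplus> Y $$ (k, l)))"
    using XY by (intro finsum_cong' refl) (auto simp: mat_space_simps intro!: finsum_closed)
  ultimately show "compression V \<alpha> (X \<oplus>\<^bsub>mat_space V n\<^esub> Y) $$ (i, j)
      = (compression V \<alpha> X \<oplus>\<^bsub>mat_space V m\<^esub> compression V \<alpha> Y) $$ (i, j)"
    using ij assms(3) unfolding compression_def c_def by (simp add: mat_space_simps)
qed (use assms in \<open>auto simp: compression_def mat_space_simps\<close>)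

text \<open>Only the scalar factor is affected, so compressing the generators of
  \<open>D_max\<close> reduces to conjugating positive semidefinite matrices.\<close>

lemma compression_tensor:
  assumes "x \<in> carrier V" "\<alpha> \<in> carrier_mat n m"
  shows "compression V \<alpha> (tensor V n a x)
    = tensor V m (\<lambda>i j. \<Sum>k<n. \<Sum>l<n. cnj (\<alpha> $$ (k, i)) * a k l * \<alpha> $$ (l, j)) x"
proof (rule eq_matI)
  fix i j
  assume "i < dim_row (tensor V m (\<lambda>i j. \<Sum>k<n. \<Sum>l<n. cnj (\<alpha> $$ (k, i)) * a k l * \<alpha> $$ (l, j)) x)"
    "j < dim_col (tensor V m (\<lambda>i j. \<Sum>k<n. \<Sum>l<n. cnj (\<alpha> $$ (k, i)) * a k l * \<alpha> $$ (l, j)) x)"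
  then have ij: "i < m" "j < m" by (auto simp: tensor_def mat_space_simps)
  have "(\<Oplus>k\<in>{..<n}. \<Oplus>l\<in>{..<n}. (cnj (\<alpha> $$ (k, i)) * \<alpha> $$ (l, j)) \<odot>\<^bsub>V\<^esub> (tensor V n a x $$ (k, l)))
    = (\<Oplus>k\<in>{..<n}. (\<Sum>l<n. cnj (\<alpha> $$ (k, i)) * a k l * \<alpha> $$ (l, j)) \<odot>\<^bsub>V\<^esub> x)"
  proof (intro finsum_cong' refl)
    fix k assume k: "k \<in> {..<n}"
    have "(\<Oplus>l\<in>{..<n}. (cnj (\<alpha> $$ (k, i)) * \<alpha> $$ (l, j)) \<odot>\<^bsub>V\<^esub> (tensor V n a x $$ (k, l)))
      = (\<Oplus>l\<in>{..<n}. (cnj (\<alpha> $$ (k, i)) * a k l * \<alpha> $$ (l, j)) \<odot>\<^bsub>V\<^esub> x)"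
      using assms k by (intro finsum_cong') (auto simp: tensor_def mult_ac)
    also have "\<dots> = (\<Sum>l<n. cnj (\<alpha> $$ (k, i)) * a k l * \<alpha> $$ (l, j)) \<odot>\<^bsub>V\<^esub> x"
      using assms by (intro smult_sum_left) auto
    finally show "(\<Oplus>l\<in>{..<n}. (cnj (\<alpha> $$ (k, i)) * \<alpha> $$ (l, j)) \<odot>\<^bsub>V\<^esub> (tensor V n a x $$ (k, l))) = \<dots>" .
  qed (use assms in auto)
  also have "\<dots> = (\<Sum>k<n. \<Sum>l<n. cnj (\<alpha> $$ (k, i)) * a k l * \<alpha> $$ (l, j)) \<odot>\<^bsub>V\<^esub> x"
    using assms by (intro smult_sum_left) auto
  finally show "compression V \<alpha> (tensor V n a x) $$ (i, j)
      = tensor V m (\<lambda>i j. \<Sum>k<n. \<Sum>l<n. cnj (\<alpha> $$ (k, i)) * a k l * \<alpha> $$ (l, j)) x $$ (i, j)"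
    using ij assms(2) unfolding compression_def by (simp add: tensor_def mat_space_simps)
qed (use assms in \<open>auto simp: compression_def tensor_def\<close>)

lemma compression_zero:
  assumes "\<alpha> \<in> carrier_mat n m"
  shows "compression V \<alpha> (zero (mat_space V n)) = zero (mat_space V m)"
  using compression_tensor[OF zero_closed assms, of "\<lambda>_ _. 0"]
  unfolding tensor_zero_left[OF zero_closed] by (auto simp: tensor_def mat_space_simps)

end

text \<open>The form of \<alpha>* a \<alpha> at v is the form of a at the image of v under
  \<alpha>.\<close>

lemma psd_conjugate:
  assumes "psd n a"
  shows "psd m (\<lambda>i j. \<Sum>k<n. \<Sum>l<n. cnj (\<alpha> k i) * a k l * \<alpha> l j)"
  unfolding psd_def
proof
  fix v
  have "quad_form m (\<lambda>i j. \<Sum>k<n. \<Sum>l<n. cnj (\<alpha> k i) * a k l * \<alpha> l j) v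
    = (\<Sum>i<m. \<Sum>j<m. \<Sum>k<n. \<Sum>l<n. cnj (v i) * cnj (\<alpha> k i) * a k l * (\<alpha> l j * v j))"
    by (simp add: quad_form_def sum_distrib_left sum_distrib_right mult_ac)
  also have "\<dots> = (\<Sum>k<n. \<Sum>i<m. \<Sum>l<n. \<Sum>j<m. cnj (v i) * cnj (\<alpha> k i) * a k l * (\<alpha> l j * v j))"
    by (subst (2) sum.swap, subst sum.swap, subst (3) sum.swap) (rule refl)
  also have "\<dots> = (\<Sum>k<n. \<Sum>l<n. \<Sum>i<m. \<Sum>j<m. cnj (v i) * cnj (\<alpha> k i) * a k l * (\<alpha> l j * v j))"
    by (subst (2) sum.swap) (rule refl)
  also have "\<dots> = quad_form n a (\<lambda>k. \<Sum>j<m. \<alpha> k j * v j)"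
    unfolding quad_form_def cnj_sum complex_cnj_mult
    by (simp add: sum_distrib_left sum_distrib_right mult_ac)
  finally show "0 \<le> quad_form m (\<lambda>i j. \<Sum>k<n. \<Sum>l<n. cnj (\<alpha> k i) * a k l * \<alpha> l j) v"
    using assms unfolding psd_def by simp
qed

lemma psd_zero: "psd n (\<lambda>_ _. 0)"
  by (simp add: psd_def quad_form_def)

lemma psd_add: "psd n a \<Longrightarrow> psd n b \<Longrightarrow> psd n (\<lambda>i j. a i j + b i j)"
  by (simp add: psd_def quad_form_add)

lemma psd_scale: "psd n a \<Longrightarrow> 0 \<le> r \<Longrightarrow> psd n (\<lambda>i j. complex_of_real r * a i j)"
  unfolding psd_def quad_form_scale by (simp add: less_eq_complex_def)

lemma psd_identity: "psd n (\<lambda>i j. if i = j then 1 else 0)"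
  unfolding psd_def quad_form_identity
  by (auto simp: less_eq_complex_def intro!: add_nonneg_nonneg sum_nonneg)

section \<open>The maximal matrix ordering\<close>

context aou
begin

lemma D_max_zero: "zero (mat_space V n) \<in> D_max V n"
proof -
  interpret M: star_space "mat_space V n" by (rule star_space_mat)
  show ?thesis
    unfolding D_max_def
    by (rule CollectI, rule exI[of _ 0]) (simp only: lessThan_0 M.finsum_empty, simp)
qed

lemma D_max_add_tensor:
  assumes "psd n a" "x \<in> pos V" "X \<in> D_max V n"
  shows "tensor V n a x \<oplus>\<^bsub>mat_space V n\<^esub> X \<in> D_max V n"
proof -
  interpret M: star_space "mat_space V n" by (rule star_space_mat)
  obtain k :: nat and b y where X: "X = (\<Oplus>\<^bsub>mat_space V n\<^esub>i\<in>{..<k}. elementary_tensor V (b i) (y i))"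
    and bk: "\<forall>i<k. b i \<in> psd_matrices n \<and> y i \<in> pos V"
    using assms(3) unfolding D_max_def by blast
  define A where "A = mat n n (\<lambda>(i, j). a i j)"
  have "psd n (\<lambda>i j. A $$ (i, j))"
    using assms(1) quad_form_cong[of n "\<lambda>i j. A $$ (i, j)" a] unfolding psd_def A_def by simp
  then have A: "A \<in> psd_matrices n" unfolding psd_matrices_iff A_def by simp
  have At: "elementary_tensor V A x = tensor V n a x"
    by (auto simp: elementary_tensor_def tensor_def A_def)
  have cl: "elementary_tensor V (b i) (y i) \<in> carrier (mat_space V n)" if "i < k" for i
  proof -
    have "b i \<in> carrier_mat n n" "y i \<in> pos V" using bk that unfolding psd_matrices_iff by auto
    then show ?thesis by (simp only: elementary_tensor_eq_tensor) (intro tensor_closed posD(2))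
  qed
  have tc: "tensor V n a x \<in> carrier (mat_space V n)" using posD(2)[OF assms(2)] by blast
  have "(\<Oplus>\<^bsub>mat_space V n\<^esub>i\<in>{..<Suc k}. elementary_tensor V ((b(k := A)) i) ((y(k := x)) i))
    = elementary_tensor V A x \<oplus>\<^bsub>mat_space V n\<^esub>
      (\<Oplus>\<^bsub>mat_space V n\<^esub>i\<in>{..<k}. elementary_tensor V ((b(k := A)) i) ((y(k := x)) i))"
    unfolding lessThan_Suc
    by (subst M.finsum_insert) (use cl tc At in auto)
  also have "(\<Oplus>\<^bsub>mat_space V n\<^esub>i\<in>{..<k}. elementary_tensor V ((b(k := A)) i) ((y(k := x)) i)) = X"
    unfolding X by (rule M.finsum_cong') (use cl in auto)
  finally have "tensor V n a x \<oplus>\<^bsub>mat_space V n\<^esub> X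
    = (\<Oplus>\<^bsub>mat_space V n\<^esub>i\<in>{..<Suc k}. elementary_tensor V ((b(k := A)) i) ((y(k := x)) i))"
    unfolding At by simp
  moreover have "\<forall>i<Suc k. (b(k := A)) i \<in> psd_matrices n \<and> (y(k := x)) i \<in> pos V"
    using bk A assms(2) by (auto simp: less_Suc_eq)
  ultimately show ?thesis unfolding D_max_def by blast
qed

text \<open>Replaces sums over indexed families by the addition of one tensor at a time, so that
  closure properties of \<open>D_max\<close> need no index bookkeeping. The initial segments of the
  given sum carry the induction.\<close>

lemma D_max_induct [consumes 1, case_names zero add]:
  assumes "X \<in> D_max V n"
    and zero: "P (zero (mat_space V n))"
    and add: "\<And>a x X. psd n a \<Longrightarrow> x \<in> pos V \<Longrightarrow> X \<in> D_max V n \<Longrightarrow> X \<in> carrier (mat_space V n) \<Longrightarrow> P X \<Longrightarrow>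
      P (tensor V n a x \<oplus>\<^bsub>mat_space V n\<^esub> X)"
  shows "P X"
proof -
  interpret M: star_space "mat_space V n" by (rule star_space_mat)
  obtain k :: nat and b y where X: "X = (\<Oplus>\<^bsub>mat_space V n\<^esub>i\<in>{..<k}. elementary_tensor V (b i) (y i))"
    and bk: "\<forall>i<k. b i \<in> psd_matrices n \<and> y i \<in> pos V"
    using assms(1) unfolding D_max_def by blast
  define S where "S m = (\<Oplus>\<^bsub>mat_space V n\<^esub>i\<in>{..<m}. elementary_tensor V (b i) (y i))" for m
  have b: "b i \<in> carrier_mat n n" and et: "psd n (\<lambda>p q. b i $$ (p, q))" "y i \<in> pos V" if "i < k" for i
    using bk that unfolding psd_matrices_iff by auto
  note eq = elementary_tensor_eq_tensor[OF b]
  have cl: "elementary_tensor V (b i) (y i) \<in> carrier (mat_space V n)" if "i < k" for i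
    unfolding eq[OF that] by (intro tensor_closed posD(2) et(2)[OF that])
  have "P (S m) \<and> S m \<in> D_max V n \<and> S m \<in> carrier (mat_space V n)" if "m \<le> k" for m
    using that
  proof (induction m)
    case 0
    show ?case
      unfolding S_def lessThan_0 M.finsum_empty by (intro conjI zero D_max_zero M.zero_closed)
  next
    case (Suc m)
    then have m: "m < k" by simp
    have IH: "P (S m)" "S m \<in> D_max V n" "S m \<in> carrier (mat_space V n)"
      using Suc.IH m by auto
    have "S (Suc m) = elementary_tensor V (b m) (y m) \<oplus>\<^bsub>mat_space V n\<^esub> S m"
      unfolding S_def lessThan_Suc by (rule M.finsum_insert) (use cl m in auto)
    then have S: "S (Suc m) = tensor V n (\<lambda>p q. b m $$ (p, q)) (y m) \<oplus>\<^bsub>mat_space V n\<^esub> S m"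
      by (simp only: eq[OF m])
    show ?case
      unfolding S
      by (intro conjI add[OF et[OF m] IH(2,3,1)] D_max_add_tensor[OF et[OF m] IH(2)]
        M.a_closed[OF tensor_closed[OF posD(2)[OF et(2)[OF m]]] IH(3)])
  qed
  from this[of k] show ?thesis unfolding S_def X by simp
qed

lemma D_max_tensor:
  assumes "psd n a" "x \<in> pos V"
  shows "tensor V n a x \<in> D_max V n"
proof -
  interpret M: star_space "mat_space V n" by (rule star_space_mat)
  show ?thesis
    using D_max_add_tensor[OF assms D_max_zero]
    unfolding M.r_zero[OF tensor_closed[OF posD(2)[OF assms(2)]]] .
qed

lemma tensor_smult_pos:
  "x \<in> carrier V \<Longrightarrow> c \<odot>\<^bsub>mat_space V n\<^esub> tensor V n a x = tensor V n a (c \<odot>\<^bsub>V\<^esub> x)"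
  by (auto simp: tensor_def mat_space_simps mult.commute)

lemma cone_D_max: "is_cone (mat_space V n) (D_max V n)"
proof -
  interpret M: star_space "mat_space V n" by (rule star_space_mat)
  have sa: "X \<in> selfadjoint (mat_space V n)" if "X \<in> D_max V n" for X
    using that
  proof (induction rule: D_max_induct)
    case (add a x X)
    show ?case
      by (intro M.selfadjoint_add tensor_selfadjoint posD(1)) (use add psd_hermitian in auto)
  qed (rule M.selfadjoint_zero)
  note c = M.selfadjointD(1)[OF sa]
  have tc: "tensor V n a x \<in> carrier (mat_space V n)" if "x \<in> pos V" for a x
    using posD(2)[OF that] by blast
  have plus: "X \<oplus>\<^bsub>mat_space V n\<^esub> Y \<in> D_max V n" if "X \<in> D_max V n" and Y: "Y \<in> D_max V n" for X Y
    using that(1)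
  proof (induction rule: D_max_induct)
    case zero
    show ?case unfolding M.l_zero[OF c[OF Y]] by (rule Y)
  next
    case (add a x X)
    show ?case
      unfolding M.a_assoc[OF tc[OF add(2)] add(4) c[OF Y]] by (rule D_max_add_tensor[OF add(1,2,5)])
  qed
  have scale: "complex_of_real r \<odot>\<^bsub>mat_space V n\<^esub> X \<in> D_max V n" if "X \<in> D_max V n" and r: "0 \<le> r" for r X
    using that(1)
  proof (induction rule: D_max_induct)
    case zero
    show ?case unfolding M.smult_zero_right by (rule D_max_zero)
  next
    case (add a x X)
    show ?case
      unfolding M.smult_add_right[OF tc[OF add(2)] add(4)] tensor_smult_pos[OF posD(2)[OF add(2)]]
      by (rule D_max_add_tensor[OF add(1) posD(4)[OF add(2) r] add(5)])
  qed
  show ?thesis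
    unfolding is_cone_def using sa plus scale D_max_zero by blast
qed

lemma D_max_compression:
  assumes "X \<in> D_max V n" "\<alpha> \<in> carrier_mat n m"
  shows "compression V \<alpha> X \<in> D_max V m"
  using assms(1)
proof (induction rule: D_max_induct)
  case zero
  show ?case unfolding compression_zero[OF assms(2)] by (rule D_max_zero)
next
  case (add a x X)
  have "compression V \<alpha> (tensor V n a x) \<in> D_max V m"
    unfolding compression_tensor[OF posD(2)[OF add(2)] assms(2)]
    by (intro D_max_tensor psd_conjugate add)
  then show ?case
    unfolding compression_add[OF tensor_closed[OF posD(2)[OF add(2)]] add(4) assms(2)]
    by (rule star_space.coneD(3)[OF star_space_mat cone_D_max _ add(5)])
qed

lemma D_max_one:
  assumes "X \<in> D_max V 1"
  shows "X $$ (0, 0) \<in> pos V"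
  using assms
proof (induction rule: D_max_induct)
  case zero
  show ?case using cone_zero[OF cone_pos] by (simp add: mat_space_simps)
next
  case (add a x X)
  have "0 \<le> a 0 0" using psd_diagonal[OF add(1)] by simp
  then have "a 0 0 \<odot>\<^bsub>V\<^esub> x \<in> pos V"
    using posD(4)[OF add(2), of "Re (a 0 0)"] complex_eq[of "a 0 0"] by (simp add: less_eq_complex_def)
  then show ?case using posD(3) add(5) by (simp add: tensor_def mat_space_simps)
qed

text \<open>Applied entrywise, F turns a \<otimes> x into the nonnegative multiple F(x) a of a
  positive semidefinite matrix.\<close>

lemma D_max_state:
  assumes "X \<in> D_max V n" "state F"
  shows "psd n (\<lambda>i j. F (X $$ (i, j)))"
  using assms(1)
proof (induction rule: D_max_induct)
  case zero
  have "F \<zero> = 0" using assms(2) unfolding state_def by (auto dest!: spec[of _ 0] bspec[of _ _ \<zero>])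
  then have "quad_form n (\<lambda>i j. F (zero (mat_space V n) $$ (i, j))) v = quad_form n (\<lambda>_ _. 0) v" for v
    by (intro quad_form_cong) (simp add: mat_space_simps)
  then show ?case using psd_zero[of n] unfolding psd_def by simp
next
  case (add a x X)
  have Fx: "0 \<le> F x" using assms(2) add(2) unfolding state_def by blast
  then have "F x = complex_of_real (Re (F x))" "0 \<le> Re (F x)"
    by (simp_all add: less_eq_complex_def complex_eq_iff)
  moreover have "psd n (\<lambda>i j. complex_of_real (Re (F x)) * a i j + F (X $$ (i, j)))"
    using \<open>0 \<le> Re (F x)\<close> by (intro psd_add psd_scale add)
  ultimately have *: "psd n (\<lambda>i j. a i j * F x + F (X $$ (i, j)))"
    by (simp add: mult.commute)
  have "F ((tensor V n a x \<oplus>\<^bsub>mat_space V n\<^esub> X) $$ (i, j)) = a i j * F x + F (X $$ (i, j))"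
    if "i < n" "j < n" for i j
    using that assms(2) add(4) posD(2)[OF add(2)] unfolding state_def by (simp add: tensor_def mat_space_simps)
  then show ?case
    using * quad_form_cong[of n "\<lambda>i j. F ((tensor V n a x \<oplus>\<^bsub>mat_space V n\<^esub> X) $$ (i, j))"
        "\<lambda>i j. a i j * F x + F (X $$ (i, j))"]
    unfolding psd_def by simp
qed

end

section \<open>The Archimedean closure of the maximal matrix ordering\<close>

context star_space
begin

definition arch_closure :: "'a set \<Rightarrow> 'a \<Rightarrow> 'a set" where
  "arch_closure C e = {x \<in> selfadjoint V. \<forall>r>0. complex_of_real r \<odot>\<^bsub>V\<^esub> e \<oplus> x \<in> C}"

lemma arch_closureD:
  "x \<in> arch_closure C e \<Longrightarrow> 0 < r \<Longrightarrow> complex_of_real r \<odot>\<^bsub>V\<^esub> e \<oplus> x \<in> C"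
  unfolding arch_closure_def by blast

text \<open>Closing once is enough: a tolerance r is spent in two halves, one to stay inside the
  closure and one to get from there into \<open>C\<close>. The same halving handles sums.\<close>

lemma arch_closure:
  assumes C: "is_cone V C" and ou: "is_order_unit V C e"
  shows "is_cone V (arch_closure C e)" "C \<subseteq> arch_closure C e"
    "is_order_unit V (arch_closure C e) e" "is_archimedean V (arch_closure C e) e"
proof -
  note cD = coneD[OF C]
  have e: "e \<in> C" "e \<in> carrier V" using order_unitD(1)[OF ou C] cD(2) by auto
  have re: "complex_of_real r \<odot>\<^bsub>V\<^esub> e \<in> C" if "0 < r" for r using cD(4)[OF e(1)] that by simp
  have half: "complex_of_real r \<odot>\<^bsub>V\<^esub> e \<oplus> (x \<oplus> y)
      = (complex_of_real (r/2) \<odot>\<^bsub>V\<^esub> e \<oplus> x) \<oplus> (complex_of_real (r/2) \<odot>\<^bsub>V\<^esub> e \<oplus> y)"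
    if "x \<in> carrier V" "y \<in> carrier V" for r x y
  proof -
    have "complex_of_real r \<odot>\<^bsub>V\<^esub> e = complex_of_real (r/2) \<odot>\<^bsub>V\<^esub> e \<oplus> complex_of_real (r/2) \<odot>\<^bsub>V\<^esub> e"
      using e(2) by (simp flip: smult_add_left)
    then show ?thesis using that e(2) by (simp add: a_ac)
  qed
  show sub: "C \<subseteq> arch_closure C e"
    unfolding arch_closure_def using cD(1,3) re by blast
  show cone: "is_cone V (arch_closure C e)"
    unfolding is_cone_def
  proof (intro conjI ballI allI impI)
    show "arch_closure C e \<subseteq> selfadjoint V" unfolding arch_closure_def by blast
    show "arch_closure C e \<noteq> {}" using sub e by blast
    fix x assume x: "x \<in> arch_closure C e"
    then have xs: "x \<in> selfadjoint V" unfolding arch_closure_def by blast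
    note xc = selfadjointD(1)[OF xs]
    { fix y assume y: "y \<in> arch_closure C e"
      then have ys: "y \<in> selfadjoint V" unfolding arch_closure_def by blast
      have "complex_of_real r \<odot>\<^bsub>V\<^esub> e \<oplus> (x \<oplus> y) \<in> C" if "r > 0" for r
        unfolding half[OF xc selfadjointD(1)[OF ys]]
        using that by (intro cD(3) arch_closureD[OF x] arch_closureD[OF y] half_gt_zero)
      then show "x \<oplus> y \<in> arch_closure C e"
        using xs ys unfolding arch_closure_def by blast }
    fix t :: real assume t: "0 \<le> t"
    have "complex_of_real r \<odot>\<^bsub>V\<^esub> e \<oplus> complex_of_real t \<odot>\<^bsub>V\<^esub> x \<in> C" if r: "r > 0" for r
    \<comment> \<open>For t > 0 the tolerance r / t is scaled by t; for t = 0 only r e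
      remains.\<close>
    proof (cases "t = 0")
      case True
      then show ?thesis using re[OF r] xc e by simp
    next
      case False
      then have "complex_of_real (r / t) \<odot>\<^bsub>V\<^esub> e \<oplus> x \<in> C"
        using t r by (intro arch_closureD[OF x]) simp
      from cD(4)[OF this t] show ?thesis
        using False xc e by (simp add: smult_add_right)
    qed
    then show "complex_of_real t \<odot>\<^bsub>V\<^esub> x \<in> arch_closure C e"
      using selfadjoint_smult[OF xs] unfolding arch_closure_def by blast
  qed
  show "is_order_unit V (arch_closure C e) e"
    using ou sub unfolding is_order_unit_def by blast
  have "x \<in> arch_closure C e"
    if xs: "x \<in> selfadjoint V" and x: "\<forall>r>0. complex_of_real r \<odot>\<^bsub>V\<^esub> e \<oplus> x \<in> arch_closure C e" for x
  proof -
    have "complex_of_real r \<odot>\<^bsub>V\<^esub> e \<oplus> x \<in> C" if "r > 0" for r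
    proof -
      have "complex_of_real (r/2) \<odot>\<^bsub>V\<^esub> e \<oplus> (complex_of_real (r/2) \<odot>\<^bsub>V\<^esub> e \<oplus> x) \<in> C"
        using x half_gt_zero[OF that] by (intro arch_closureD[of _ C e]) blast+
      then show ?thesis
        using half[of \<zero> x r] e(2) selfadjointD(1)[OF xs] by simp
    qed
    then show ?thesis using xs unfolding arch_closure_def by blast
  qed
  moreover have "complex_of_real r \<odot>\<^bsub>V\<^esub> e \<oplus> x \<in> arch_closure C e"
    if "x \<in> arch_closure C e" "r > 0" for x r
    using coneD(3)[OF cone] that re sub by blast
  ultimately show "is_archimedean V (arch_closure C e) e"
    unfolding is_archimedean_def using coneD(1)[OF cone] by blast
qed

end

context aou
begin

section \<open>Domination of selfadjoint matrices by the order unit\<close>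

lemma unit_D_max: "order_unit (mat_space V n) \<in> D_max V n"
  unfolding unit_eq_tensor[OF unit_carrier] by (intro D_max_tensor psd_identity unit_pos)

lemma D_max_closed: "X \<in> D_max V n \<Longrightarrow> X \<in> carrier (mat_space V n)"
  by (rule star_space.coneD(2)[OF star_space_mat cone_D_max])

definition dominated :: "nat \<Rightarrow> 'a mat \<Rightarrow> bool" where
  "dominated n X \<longleftrightarrow> (\<exists>r>0. complex_of_real r \<odot>\<^bsub>mat_space V n\<^esub> order_unit (mat_space V n)
     \<oplus>\<^bsub>mat_space V n\<^esub> (- 1) \<odot>\<^bsub>mat_space V n\<^esub> X \<in> D_max V n)"

lemma dominated_add:
  assumes X: "X \<in> carrier (mat_space V n)" "dominated n X"
    and Y: "Y \<in> carrier (mat_space V n)" "dominated n Y"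
  shows "dominated n (X \<oplus>\<^bsub>mat_space V n\<^esub> Y)"
proof -
  interpret M: star_space "mat_space V n" by (rule star_space_mat)
  define u where "u = order_unit (mat_space V n)"
  have u: "u \<in> carrier (mat_space V n)" unfolding u_def by (rule D_max_closed[OF unit_D_max])
  obtain r s where rs: "r > 0" "s > 0"
    "complex_of_real r \<odot>\<^bsub>mat_space V n\<^esub> u \<oplus>\<^bsub>mat_space V n\<^esub> (- 1) \<odot>\<^bsub>mat_space V n\<^esub> X \<in> D_max V n"
    "complex_of_real s \<odot>\<^bsub>mat_space V n\<^esub> u \<oplus>\<^bsub>mat_space V n\<^esub> (- 1) \<odot>\<^bsub>mat_space V n\<^esub> Y \<in> D_max V n"
    using X(2) Y(2) unfolding dominated_def u_def by blast
  have "complex_of_real (r + s) \<odot>\<^bsub>mat_space V n\<^esub> u \<oplus>\<^bsub>mat_space V n\<^esub> (- 1) \<odot>\<^bsub>mat_space V n\<^esub> (X \<oplus>\<^bsub>mat_space V n\<^esub> Y)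
    = (complex_of_real r \<odot>\<^bsub>mat_space V n\<^esub> u \<oplus>\<^bsub>mat_space V n\<^esub> (- 1) \<odot>\<^bsub>mat_space V n\<^esub> X) \<oplus>\<^bsub>mat_space V n\<^esub>
      (complex_of_real s \<odot>\<^bsub>mat_space V n\<^esub> u \<oplus>\<^bsub>mat_space V n\<^esub> (- 1) \<odot>\<^bsub>mat_space V n\<^esub> Y)"
    unfolding of_real_add M.smult_add_left[OF u] M.smult_add_right[OF X(1) Y(1)]
    using u X(1) Y(1) by (simp only: M.a_ac M.smult_closed M.a_closed)
  then show ?thesis
    using M.coneD(3)[OF cone_D_max rs(3,4)] rs(1,2)
    unfolding dominated_def u_def[symmetric] by (intro exI[of _ "r + s"]) simp
qed

text \<open>
  \<open>2ts (1 \<otimes> e) - 2 (h \<otimes> p) = (t + h) \<otimes> (se - p) + (t - h) \<otimes> (se + p)\<close>, where \<open>t\<close> and \<open>s\<close> are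
  chosen so large that all four factors on the right are positive.
\<close>

lemma dominated_tensor:
  assumes herm: "\<And>i j. i < n \<Longrightarrow> j < n \<Longrightarrow> cnj (h j i) = h i j" and p: "p \<in> selfadjoint V"
  shows "dominated n (tensor V n h p)"
proof -
  obtain t where t: "0 \<le> t" "psd n (\<lambda>i j. (if i = j then complex_of_real t else 0) + h i j)"
    "psd n (\<lambda>i j. (if i = j then complex_of_real t else 0) + (- 1) * h i j)"
    by (rule hermitian_shift_psd[OF herm])
  \<comment> \<open>\<open>dominated\<close> asks for a strictly positive multiple of the unit,
    while t is only known to be nonnegative.\<close>
  define T where "T = t + 1"
  have T: "T > 0" "psd n (\<lambda>i j. (if i = j then complex_of_real T else 0) + h i j)"
    "psd n (\<lambda>i j. (if i = j then complex_of_real T else 0) + (- 1) * h i j)"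
  proof -
    have shift: "psd n (\<lambda>i j. (if i = j then complex_of_real T else 0) + g i j)"
      if "psd n (\<lambda>i j. (if i = j then complex_of_real t else 0) + g i j)" for g
    proof -
      have "(\<lambda>i j. (if i = j then complex_of_real T else 0) + g i j)
        = (\<lambda>i j. ((if i = j then complex_of_real t else 0) + g i j) + (if i = j then 1 else 0))"
        unfolding T_def by (intro ext) simp
      then show ?thesis using psd_add[OF that psd_identity[of n]] by simp
    qed
    show "T > 0" using t(1) T_def by simp
    show "psd n (\<lambda>i j. (if i = j then complex_of_real T else 0) + h i j)" by (rule shift[OF t(2)])
    show "psd n (\<lambda>i j. (if i = j then complex_of_real T else 0) + (- 1) * h i j)" by (rule shift[OF t(3)])
  qed
  obtain s where s: "s > 0" "complex_of_real s \<odot>\<^bsub>V\<^esub> e \<oplus> (- 1) \<odot>\<^bsub>V\<^esub> p \<in> pos V"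
    "complex_of_real s \<odot>\<^bsub>V\<^esub> e \<oplus> p \<in> pos V"
    using order_unit_bounds[OF cone_pos order_unit_pos p] by blast
  have pc: "p \<in> carrier V" using selfadjointD(1)[OF p] .
  \<comment> \<open>The factor 1/2 makes a + b the scalar matrix T and b - a the matrix -h.\<close>
  define a where "a i j = complex_of_real (1/2) * ((if i = j then complex_of_real T else 0) + h i j)" for i j
  define b where "b i j = complex_of_real (1/2) * ((if i = j then complex_of_real T else 0) + (- 1) * h i j)" for i j
  have a: "psd n a" unfolding a_def by (rule psd_scale[OF T(2)]) simp
  have b: "psd n b" unfolding b_def by (rule psd_scale[OF T(3)]) simp
  have mem: "tensor V n a (complex_of_real s \<odot>\<^bsub>V\<^esub> e \<oplus> (- 1) \<odot>\<^bsub>V\<^esub> p) \<oplus>\<^bsub>mat_space V n\<^esub>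
      tensor V n b (complex_of_real s \<odot>\<^bsub>V\<^esub> e \<oplus> p) \<in> D_max V n"
    by (intro D_max_add_tensor D_max_tensor a b s)
  have ident: "c \<odot>\<^bsub>V\<^esub> (complex_of_real s \<odot>\<^bsub>V\<^esub> e \<oplus> (- 1) \<odot>\<^bsub>V\<^esub> p) \<oplus> d \<odot>\<^bsub>V\<^esub> (complex_of_real s \<odot>\<^bsub>V\<^esub> e \<oplus> p)
      = ((c + d) * complex_of_real s) \<odot>\<^bsub>V\<^esub> e \<oplus> (d - c) \<odot>\<^bsub>V\<^esub> p" for c d
  proof -
    have "d - c = c * (- 1) + d" by simp
    then show ?thesis
      using pc unit_carrier
      by (simp only: smult_add_right smult_smult smult_add_left smult_closed a_closed distrib_right a_ac)
  qed
  have "tensor V n a (complex_of_real s \<odot>\<^bsub>V\<^esub> e \<oplus> (- 1) \<odot>\<^bsub>V\<^esub> p) \<oplus>\<^bsub>mat_space V n\<^esub>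
      tensor V n b (complex_of_real s \<odot>\<^bsub>V\<^esub> e \<oplus> p)
    = complex_of_real (T * s) \<odot>\<^bsub>mat_space V n\<^esub> order_unit (mat_space V n) \<oplus>\<^bsub>mat_space V n\<^esub>
      (- 1) \<odot>\<^bsub>mat_space V n\<^esub> tensor V n h p" (is "?L = ?R")
  proof (rule eq_matI)
    fix i j assume "i < dim_row ?R" "j < dim_col ?R"
    then have ij: "i < n" "j < n" by (simp_all add: mat_space_simps)
    have "?L $$ (i, j) = ((a i j + b i j) * complex_of_real s) \<odot>\<^bsub>V\<^esub> e \<oplus> (b i j - a i j) \<odot>\<^bsub>V\<^esub> p"
      using ij by (simp add: mat_space_simps tensor_def ident)
    also have "a i j + b i j = (if i = j then complex_of_real T else 0)"
      unfolding a_def b_def by (simp add: field_simps)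
    also have "b i j - a i j = - h i j"
      unfolding a_def b_def by (simp add: field_simps)
    finally show "?L $$ (i, j) = ?R $$ (i, j)"
      using ij pc by (simp add: mat_space_simps tensor_def)
  qed (simp_all add: mat_space_simps)
  with mem T(1) s(1) show ?thesis unfolding dominated_def by (intro exI[of _ "T * s"]) simp
qed

text \<open>The matrix is a sum over the index pairs (p, q) of pieces that carry half of the entry x
  at (p, q) and half of its adjoint at (q, p). Splitting x into its parts turns each piece into two
  tensors of a hermitian matrix with a selfadjoint element, and such tensors are dominated.\<close>

lemma dominated_selfadjoint:
  assumes X: "X \<in> selfadjoint (mat_space V n)"
  shows "dominated n X"
proof -
  interpret M: star_space "mat_space V n" by (rule star_space_mat)
  have Xc: "X \<in> carrier_mat n n" "\<And>i j. i < n \<Longrightarrow> j < n \<Longrightarrow> X $$ (i, j) \<in> carrier V"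
    using M.selfadjointD(1)[OF X] by (auto simp: mat_space_simps)
  have Xs: "star V (X $$ (j, i)) = X $$ (i, j)" if "i < n" "j < n" for i j
  proof -
    have "star (mat_space V n) X $$ (i, j) = star V (X $$ (j, i))"
      using that by (simp add: mat_space_simps)
    then show ?thesis unfolding M.selfadjointD(2)[OF X] by (rule sym)
  qed
  \<comment> \<open>Adds up the pieces of the pairs in A. For the full index square the entry at (i,
    j) is met twice, through (i, j) and through (j, i), hence the factors 1/2.\<close>
  define part where "part A = mat n n (\<lambda>(i, j).
      (if (i, j) \<in> A then (1/2) \<odot>\<^bsub>V\<^esub> X $$ (i, j) else \<zero>)
      \<oplus> (if (j, i) \<in> A then (1/2) \<odot>\<^bsub>V\<^esub> star V (X $$ (j, i)) else \<zero>))" for A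
  have part_closed: "part A \<in> carrier (mat_space V n)" for A
    using Xc(2) by (simp add: mat_space_simps part_def)
  have single: "dominated n (part {(p, q)})" if pq: "p < n" "q < n" for p q
  proof -
    define x where "x = X $$ (p, q)"
    have x: "x \<in> carrier V" using Xc(2)[OF pq] x_def by simp
    \<comment> \<open>In terms of matrix units, h is (E_pq + E_qp) / 2 and g is \<i> (E_pq - E_qp) /
      2. As sums of two conditionals they stay correct for p = q, where h is the unit E_pp and g
      vanishes.\<close>
    define h where "h i j = (if (i, j) = (p, q) then 1/2 else 0) + (if (j, i) = (p, q) then 1/2 else (0::complex))" for i j
    define g where "g i j = (if (i, j) = (p, q) then \<i>/2 else 0) + (if (j, i) = (p, q) then -\<i>/2 else (0::complex))" for i j
    have "cnj ((if P then 1/2 else 0) + (if Q then 1/2 else 0)) = (if Q then 1/2 else 0) + (if P then 1/2 else 0)"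
      "cnj ((if P then \<i>/2 else 0) + (if Q then -\<i>/2 else 0)) = (if Q then \<i>/2 else 0) + (if P then -\<i>/2 else 0)"
      for P Q by simp_all
    then have herm: "cnj (h j i) = h i j" "cnj (g j i) = g i j" for i j
      unfolding h_def g_def by blast+
    have re: "real_part x \<in> carrier V" "imag_part x \<in> carrier V"
      using real_part_selfadjoint[OF x] imag_part_selfadjoint[OF x] selfadjointD(1) by auto
    have hg: "dominated n (tensor V n h (real_part x) \<oplus>\<^bsub>mat_space V n\<^esub> tensor V n g (imag_part x))"
      by (intro dominated_add dominated_tensor tensor_closed re herm real_part_selfadjoint[OF x]
          imag_part_selfadjoint[OF x])
    have hx: "(1/2) \<odot>\<^bsub>V\<^esub> real_part x \<oplus> (\<i>/2) \<odot>\<^bsub>V\<^esub> imag_part x = (1/2) \<odot>\<^bsub>V\<^esub> x"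
      using arg_cong[OF real_imag_decomp[OF x], of "\<lambda>y. (1/2) \<odot>\<^bsub>V\<^esub> y"] re
      by (simp add: smult_add_right)
    have hs: "(1/2) \<odot>\<^bsub>V\<^esub> real_part x \<oplus> (-\<i>/2) \<odot>\<^bsub>V\<^esub> imag_part x = (1/2) \<odot>\<^bsub>V\<^esub> star V x"
      using arg_cong[OF hx, of "star V"] re x selfadjointD(2)[OF real_part_selfadjoint[OF x]]
        selfadjointD(2)[OF imag_part_selfadjoint[OF x]]
      by (simp add: star_add star_smult)
    have "part {(p, q)} = tensor V n h (real_part x) \<oplus>\<^bsub>mat_space V n\<^esub> tensor V n g (imag_part x)" (is "_ = ?R")
    proof (rule eq_matI)
      fix i j assume "i < dim_row ?R" "j < dim_col ?R"
      then have ij: "i < n" "j < n" by (simp_all add: mat_space_simps)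
      define \<delta> \<epsilon> where "\<delta> = (if (i, j) = (p, q) then 1 else (0::complex))"
        and "\<epsilon> = (if (j, i) = (p, q) then 1 else (0::complex))"
      have hgij: "h i j = \<delta> * (1/2) + \<epsilon> * (1/2)" "g i j = \<delta> * (\<i>/2) + \<epsilon> * (-\<i>/2)"
        proof -
        have "(if P then c else 0) + (if Q then d else 0) = (if P then 1 else 0) * c + (if Q then 1 else 0) * (d :: complex)"
          for P Q c d by simp
        then show "h i j = \<delta> * (1/2) + \<epsilon> * (1/2)" "g i j = \<delta> * (\<i>/2) + \<epsilon> * (-\<i>/2)"
          unfolding h_def g_def \<delta>_def \<epsilon>_def by blast+
      qed
      have "?R $$ (i, j) = h i j \<odot>\<^bsub>V\<^esub> real_part x \<oplus> g i j \<odot>\<^bsub>V\<^esub> imag_part x"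
        using ij by (simp add: mat_space_simps tensor_def)
      also have "\<dots> = ((\<delta> * (1/2)) \<odot>\<^bsub>V\<^esub> real_part x \<oplus> (\<epsilon> * (1/2)) \<odot>\<^bsub>V\<^esub> real_part x)
          \<oplus> ((\<delta> * (\<i>/2)) \<odot>\<^bsub>V\<^esub> imag_part x \<oplus> (\<epsilon> * (-\<i>/2)) \<odot>\<^bsub>V\<^esub> imag_part x)"
        unfolding hgij smult_add_left[OF re(1)] smult_add_left[OF re(2)] ..
      also have "\<dots> = ((\<delta> * (1/2)) \<odot>\<^bsub>V\<^esub> real_part x \<oplus> (\<delta> * (\<i>/2)) \<odot>\<^bsub>V\<^esub> imag_part x)
          \<oplus> ((\<epsilon> * (1/2)) \<odot>\<^bsub>V\<^esub> real_part x \<oplus> (\<epsilon> * (-\<i>/2)) \<odot>\<^bsub>V\<^esub> imag_part x)"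
        using re by (simp only: a_ac smult_closed a_closed)
      also have "\<dots> = \<delta> \<odot>\<^bsub>V\<^esub> ((1/2) \<odot>\<^bsub>V\<^esub> x) \<oplus> \<epsilon> \<odot>\<^bsub>V\<^esub> ((1/2) \<odot>\<^bsub>V\<^esub> star V x)"
        unfolding hx[symmetric] hs[symmetric] using re by (simp add: smult_add_right)
      also have "\<dots> = part {(p, q)} $$ (i, j)"
      proof -
        have "(if (i, j) \<in> {(p, q)} then (1/2) \<odot>\<^bsub>V\<^esub> X $$ (i, j) else \<zero>) = \<delta> \<odot>\<^bsub>V\<^esub> ((1/2) \<odot>\<^bsub>V\<^esub> x)"
          unfolding \<delta>_def using x by (cases "i = p"; cases "j = q"; simp add: x_def)
        moreover have "(if (j, i) \<in> {(p, q)} then (1/2) \<odot>\<^bsub>V\<^esub> star V (X $$ (j, i)) else \<zero>)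
            = \<epsilon> \<odot>\<^bsub>V\<^esub> ((1/2) \<odot>\<^bsub>V\<^esub> star V x)"
          unfolding \<epsilon>_def using x by (cases "j = p"; cases "i = q"; simp add: x_def)
        ultimately show ?thesis unfolding part_def using ij by (simp only: index_mat prod.case)
      qed
      finally show "part {(p, q)} $$ (i, j) = ?R $$ (i, j)" ..
    qed (simp_all add: mat_space_simps part_def)
    then show ?thesis using hg by simp
  qed
  have "dominated n (part A)" if "finite A" "A \<subseteq> {..<n} \<times> {..<n}" for A
    using that
  proof (induction A rule: finite_induct)
    case empty
    have "part {} = tensor V n (\<lambda>_ _. 0) \<zero>"
      unfolding part_def tensor_def by auto
    then show ?case using dominated_tensor[of n "\<lambda>_ _. 0" \<zero>] by simp
  next
    case (insert pq A)
    obtain p q where pq: "pq = (p, q)" "p < n" "q < n" using insert.prems by auto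
    \<comment> \<open>The new pair is not in A, so the two conditions exclude each other and a
      conditional on their disjunction is the sum of two conditionals.\<close>
    have split: "(if P \<or> P' then x else \<zero>) \<oplus> (if Q \<or> Q' then y else \<zero>)
        = ((if P then x else \<zero>) \<oplus> (if Q then y else \<zero>)) \<oplus> ((if P' then x else \<zero>) \<oplus> (if Q' then y else \<zero>))"
      if "x \<in> carrier V" "y \<in> carrier V" "\<not> (P \<and> P')" "\<not> (Q \<and> Q')" for P P' Q Q' x y
      using that by (cases P; cases P'; cases Q; cases Q') (simp_all add: a_comm)
    have "part (insert pq A) = part {(p, q)} \<oplus>\<^bsub>mat_space V n\<^esub> part A" (is "_ = ?R")
    proof (rule eq_matI)
      fix i j assume "i < dim_row ?R" "j < dim_col ?R"
      then have ij: "i < n" "j < n" by (simp_all add: mat_space_simps)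
      have "\<not> ((i, j) \<in> {(p, q)} \<and> (i, j) \<in> A)" "\<not> ((j, i) \<in> {(p, q)} \<and> (j, i) \<in> A)"
        using insert.hyps(2) pq(1) by auto
      note split[OF smult_closed[OF Xc(2)[OF ij]] smult_closed[OF star_closed[OF Xc(2)[OF ij(2,1)]]] this]
      then show "part (insert pq A) $$ (i, j) = ?R $$ (i, j)"
        using ij unfolding part_def pq(1) mat_space_simps
        by (simp only: index_mat prod.case insert_is_Un[of "(p, q)" A] Un_iff)
    qed (simp_all add: part_def mat_space_simps)
    moreover have "dominated n (part A)" using insert.IH insert.prems by blast
    ultimately show ?case
      using dominated_add[OF part_closed single[OF pq(2,3)] part_closed] by (simp only:)
  qed
  from this[of "{..<n} \<times> {..<n}"] have "dominated n (part ({..<n} \<times> {..<n}))" by simp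
  moreover have "part ({..<n} \<times> {..<n}) = X"
  proof (rule eq_matI)
    fix i j assume "i < dim_row X" "j < dim_col X"
    then have ij: "i < n" "j < n" unfolding carrier_matD[OF Xc(1)] .
    then have "part ({..<n} \<times> {..<n}) $$ (i, j) = (1/2) \<odot>\<^bsub>V\<^esub> X $$ (i, j) \<oplus> (1/2) \<odot>\<^bsub>V\<^esub> X $$ (i, j)"
      unfolding part_def by (simp add: Xs[OF ij])
    also have "\<dots> = X $$ (i, j)" using Xc(2)[OF ij] by (simp flip: smult_add_left)
    finally show "part ({..<n} \<times> {..<n}) $$ (i, j) = X $$ (i, j)" .
  qed (simp_all add: part_def carrier_matD[OF Xc(1)])
  ultimately show ?thesis by simp
qed

lemma order_unit_D_max: "is_order_unit (mat_space V n) (D_max V n) (order_unit (mat_space V n))"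
proof -
  interpret M: star_space "mat_space V n" by (rule star_space_mat)
  have "\<exists>r>0. complex_of_real r \<odot>\<^bsub>mat_space V n\<^esub> order_unit (mat_space V n) \<ominus>\<^bsub>mat_space V n\<^esub> X \<in> D_max V n"
    if X: "X \<in> selfadjoint (mat_space V n)" for X
    using dominated_selfadjoint[OF X]
    unfolding dominated_def M.minus_eq_smult[OF M.smult_closed[OF D_max_closed[OF unit_D_max]] M.selfadjointD(1)[OF X]] .
  then show ?thesis unfolding is_order_unit_def using unit_D_max by blast
qed

section \<open>Operator system axioms for the closed cones\<close>

definition C_max :: "nat \<Rightarrow> 'a mat set" where
  "C_max n = star_space.arch_closure (mat_space V n) (D_max V n) (order_unit (mat_space V n))"

lemma C_max_eq: "C_max n = {X \<in> selfadjoint (mat_space V n). \<forall>r>0.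
    complex_of_real r \<odot>\<^bsub>mat_space V n\<^esub> order_unit (mat_space V n) \<oplus>\<^bsub>mat_space V n\<^esub> X \<in> D_max V n}"
  unfolding C_max_def star_space.arch_closure_def[OF star_space_mat] ..

lemmas C_max_props = star_space.arch_closure[OF star_space_mat cone_D_max order_unit_D_max, folded C_max_def]

lemma C_max_closed: "X \<in> C_max n \<Longrightarrow> X \<in> carrier (mat_space V n)"
  unfolding C_max_eq selfadjoint_def by blast

text \<open>Holds for r e + X by \<open>D_max_state\<close>, and nonnegativity of the form survives
  the limit r \<rightarrow> 0.\<close>

lemma C_max_state:
  assumes X: "X \<in> C_max n" and F: "state F"
  shows "psd n (\<lambda>i j. F (X $$ (i, j)))"
  unfolding psd_def
proof
  fix v
  have Xc: "X $$ (i, j) \<in> carrier V" if "i < n" "j < n" for i j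
    using C_max_closed[OF X] that by (auto simp: mat_space_simps)
  have F0: "F \<zero> = 0" "F e = 1" using F unfolding state_def by (auto dest!: spec[of _ 0] bspec[of _ _ \<zero>])
  define N where "N = (\<Sum>i<n. cnj (v i) * v i)"
  have N: "N = complex_of_real (Re N)" "0 \<le> Re N"
    unfolding N_def by (auto simp: complex_eq_iff intro!: add_nonneg_nonneg sum_nonneg)
  define Q where "Q = quad_form n (\<lambda>i j. F (X $$ (i, j))) v"
  have ge: "0 \<le> complex_of_real r * N + Q" if r: "r > 0" for r
  proof -
    have "complex_of_real r \<odot>\<^bsub>mat_space V n\<^esub> order_unit (mat_space V n) \<oplus>\<^bsub>mat_space V n\<^esub> X \<in> D_max V n"
      using X r unfolding C_max_eq by blast
    from D_max_state[OF this F]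
    have "0 \<le> quad_form n (\<lambda>i j. F ((complex_of_real r \<odot>\<^bsub>mat_space V n\<^esub> order_unit (mat_space V n) \<oplus>\<^bsub>mat_space V n\<^esub> X) $$ (i, j))) v"
      unfolding psd_def by blast
    also have "\<dots> = quad_form n (\<lambda>i j. (if i = j then complex_of_real r else 0) + F (X $$ (i, j))) v"
      using F F0 Xc unfolding state_def by (intro quad_form_cong) (simp add: mat_space_simps)
    finally show ?thesis unfolding quad_form_add quad_form_identity N_def Q_def .
  qed
  have "0 \<le> Re Q"
  proof (rule ccontr)
    assume neg: "\<not> 0 \<le> Re Q"
    \<comment> \<open>Chosen so that \<open>r * Re N\<close> is at most \<open>- Re Q / 2\<close>,
      which leaves the sum negative; adding 1 covers the case N = 0.\<close>
    define r where "r = - Re Q / (2 * (Re N + 1))"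
    have "r > 0" unfolding r_def using neg N(2) by (simp add: divide_neg_pos)
    have "r * Re N \<le> r * (Re N + 1)" using \<open>r > 0\<close> by simp
    also have "\<dots> = - Re Q / 2" unfolding r_def using N(2) by (simp add: field_simps)
    finally show False using ge[OF \<open>r > 0\<close>] neg by (simp add: less_eq_complex_def)
  qed
  moreover have "Im Q = 0" using ge[of 1] N(1) by (simp add: less_eq_complex_def complex_eq_iff)
  ultimately show "0 \<le> quad_form n (\<lambda>i j. F (X $$ (i, j))) v" unfolding Q_def by (simp add: less_eq_complex_def)
qed

text \<open>If an element and its negative are in the cone, any state turns it entrywise into a
  matrix with vanishing form. Hence every state kills every entry, and states separate
  points.\<close>

lemma C_max_proper: "is_proper_cone (mat_space V n) (C_max n)"
proof -
  interpret M: star_space "mat_space V n" by (rule star_space_mat)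
  have "X = zero (mat_space V n)"
    if X: "X \<in> C_max n" and Y: "Y \<in> C_max n" and eq: "X = \<ominus>\<^bsub>mat_space V n\<^esub> Y" for X Y
  proof (rule eq_matI)
    have Yc: "Y $$ (i, j) \<in> carrier V" and Xc: "X $$ (i, j) \<in> carrier V" if "i < n" "j < n" for i j
      using C_max_closed[OF X] C_max_closed[OF Y] that by (auto simp: mat_space_simps)
    have XY: "X $$ (i, j) = (- 1) \<odot>\<^bsub>V\<^esub> Y $$ (i, j)" if "i < n" "j < n" for i j
      using that unfolding eq M.a_inv_eq_smult[OF C_max_closed[OF Y]] by (simp add: mat_space_simps)
    fix i j assume "i < dim_row (zero (mat_space V n))" "j < dim_col (zero (mat_space V n))"
    then have ij: "i < n" "j < n" by (simp_all add: mat_space_simps)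
    have "F (X $$ (i, j)) = 0" if F: "state F" for F
    proof (rule quad_form_zero_imp_zero[OF _ ij])
      fix v
      have "quad_form n (\<lambda>i j. F (X $$ (i, j))) v = quad_form n (\<lambda>i j. (- 1) * F (Y $$ (i, j))) v"
        using F XY Yc unfolding state_def by (intro quad_form_cong) simp
      then show "quad_form n (\<lambda>i j. F (X $$ (i, j))) v = 0"
        using C_max_state[OF X F, unfolded psd_def, THEN spec[of _ v]]
          C_max_state[OF Y F, unfolded psd_def, THEN spec[of _ v]]
        unfolding quad_form_scale by (simp add: less_eq_complex_def complex_eq_iff)
    qed
    then have "X $$ (i, j) = \<zero>" by (rule states_separate[OF Xc[OF ij]])
    then show "X $$ (i, j) = zero (mat_space V n) $$ (i, j)" using ij by (simp add: mat_space_simps)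
  qed (use C_max_closed[OF X] in \<open>auto simp: mat_space_simps\<close>)
  moreover have zK: "zero (mat_space V n) \<in> C_max n" by (rule M.cone_zero[OF C_max_props(1)])
  moreover have "zero (mat_space V n) = \<ominus>\<^bsub>mat_space V n\<^esub> zero (mat_space V n)"
    unfolding M.a_inv_eq_smult[OF M.zero_closed] by (rule M.smult_zero_right[symmetric])
  ultimately show ?thesis
    unfolding is_proper_cone_def using C_max_props(1) by blast
qed

text \<open>Compression turns the unit into \<alpha>* \<alpha> tensored with e. Since t - \<alpha>*
  \<alpha> is positive semidefinite for some t, a tolerance r before compression becomes r t
  afterwards.\<close>

lemma C_max_compression:
  assumes X: "X \<in> C_max n" and \<alpha>: "\<alpha> \<in> carrier_mat n m"
  shows "compression V \<alpha> X \<in> C_max m"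
proof -
  interpret M: star_space "mat_space V n" by (rule star_space_mat)
  interpret N: star_space "mat_space V m" by (rule star_space_mat)
  define u where "u = order_unit (mat_space V n)"
  define w where "w = order_unit (mat_space V m)"
  have u: "u \<in> carrier (mat_space V n)" and w: "w \<in> carrier (mat_space V m)"
    unfolding u_def w_def by (rule D_max_closed[OF unit_D_max])+
  define c where "c = (\<lambda>i j. \<Sum>k<n. \<Sum>l<n. cnj (\<alpha> $$ (k, i)) * (if k = l then 1 else 0) * \<alpha> $$ (l, j))"
  have c: "psd m c" unfolding c_def by (rule psd_conjugate[OF psd_identity])
  obtain t where t: "0 \<le> t" "psd m (\<lambda>i j. (if i = j then complex_of_real t else 0) + (- 1) * c i j)"
    by (rule hermitian_shift_psd[OF psd_hermitian[OF c]])
  have Xc: "X \<in> carrier (mat_space V n)" by (rule C_max_closed[OF X])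
  define Y where "Y = compression V \<alpha> X"
  have Yc: "Y \<in> carrier (mat_space V m)" unfolding Y_def by (rule compression_closed[OF Xc \<alpha>])
  have D: "complex_of_real (r * t) \<odot>\<^bsub>mat_space V m\<^esub> w \<oplus>\<^bsub>mat_space V m\<^esub> Y \<in> D_max V m" if r: "r > 0" for r
  proof -
    have "complex_of_real r \<odot>\<^bsub>mat_space V n\<^esub> u \<oplus>\<^bsub>mat_space V n\<^esub> X \<in> D_max V n"
      using X r unfolding C_max_eq u_def by blast
    from D_max_compression[OF this \<alpha>]
    have "compression V \<alpha> (complex_of_real r \<odot>\<^bsub>mat_space V n\<^esub> u) \<oplus>\<^bsub>mat_space V m\<^esub> Y \<in> D_max V m"
      unfolding compression_add[OF M.smult_closed[OF u] Xc \<alpha>] Y_def .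
    moreover have "compression V \<alpha> (complex_of_real r \<odot>\<^bsub>mat_space V n\<^esub> u) = tensor V m (\<lambda>i j. complex_of_real r * c i j) e"
      unfolding u_def unit_eq_tensor[OF unit_carrier] smult_tensor[OF unit_carrier]
        compression_tensor[OF unit_carrier \<alpha>] c_def sum_distrib_left
      by (rule tensor_cong, intro sum.cong refl) simp
    ultimately have Y: "tensor V m (\<lambda>i j. complex_of_real r * c i j) e \<oplus>\<^bsub>mat_space V m\<^esub> Y \<in> D_max V m"
      by (simp only:)
    have "tensor V m (\<lambda>i j. complex_of_real r * ((if i = j then complex_of_real t else 0) + (- 1) * c i j)) e
        \<oplus>\<^bsub>mat_space V m\<^esub> (tensor V m (\<lambda>i j. complex_of_real r * c i j) e \<oplus>\<^bsub>mat_space V m\<^esub> Y) \<in> D_max V m"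
      by (rule D_max_add_tensor[OF psd_scale[OF t(2) less_imp_le[OF r]] unit_pos Y])
    also have "tensor V m (\<lambda>i j. complex_of_real r * ((if i = j then complex_of_real t else 0) + (- 1) * c i j)) e
        \<oplus>\<^bsub>mat_space V m\<^esub> (tensor V m (\<lambda>i j. complex_of_real r * c i j) e \<oplus>\<^bsub>mat_space V m\<^esub> Y)
      = tensor V m (\<lambda>i j. complex_of_real r * ((if i = j then complex_of_real t else 0) + (- 1) * c i j) + complex_of_real r * c i j) e
        \<oplus>\<^bsub>mat_space V m\<^esub> Y"
      unfolding tensor_add_left[OF unit_carrier]
      by (rule N.a_assoc[symmetric]) (intro tensor_closed unit_carrier Yc)+
    also have "tensor V m (\<lambda>i j. complex_of_real r * ((if i = j then complex_of_real t else 0) + (- 1) * c i j) + complex_of_real r * c i j) e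
      = complex_of_real (r * t) \<odot>\<^bsub>mat_space V m\<^esub> w"
      unfolding w_def unit_eq_tensor[OF unit_carrier] smult_tensor[OF unit_carrier]
      by (rule tensor_cong) (simp add: algebra_simps)
    finally show ?thesis .
  qed
  \<comment> \<open>Read off from \<open>D\<close>: t w + Y lies in the cone, hence is selfadjoint,
    and the real multiple of the unit is subtracted again.\<close>
  have "Y \<in> selfadjoint (mat_space V m)"
  proof -
    have 1: "complex_of_real (1 * t) \<odot>\<^bsub>mat_space V m\<^esub> w \<oplus>\<^bsub>mat_space V m\<^esub> Y \<in> selfadjoint (mat_space V m)"
      by (rule N.coneD(1)[OF cone_D_max D]) simp
    have ws: "w \<in> selfadjoint (mat_space V m)"
      unfolding w_def by (rule N.coneD(1)[OF cone_D_max unit_D_max])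
    have "complex_of_real (- t) \<odot>\<^bsub>mat_space V m\<^esub> w \<oplus>\<^bsub>mat_space V m\<^esub>
        (complex_of_real (1 * t) \<odot>\<^bsub>mat_space V m\<^esub> w \<oplus>\<^bsub>mat_space V m\<^esub> Y) \<in> selfadjoint (mat_space V m)"
      by (rule N.selfadjoint_add[OF N.selfadjoint_smult[OF ws] 1])
    moreover have "complex_of_real (- t) \<odot>\<^bsub>mat_space V m\<^esub> w \<oplus>\<^bsub>mat_space V m\<^esub>
        (complex_of_real (1 * t) \<odot>\<^bsub>mat_space V m\<^esub> w \<oplus>\<^bsub>mat_space V m\<^esub> Y) = Y"
      unfolding N.a_assoc[OF N.smult_closed[OF w] N.smult_closed[OF w] Yc, symmetric]
        N.smult_add_left[OF w, symmetric]
      using N.smult_zero_left[OF w] N.l_zero[OF Yc] by simp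
    ultimately show ?thesis by (simp only:)
  qed
  moreover have "complex_of_real r \<odot>\<^bsub>mat_space V m\<^esub> w \<oplus>\<^bsub>mat_space V m\<^esub> Y \<in> D_max V m" if r: "r > 0" for r
  proof -
    \<comment> \<open>The tolerance r / (t + 1) costs r t / (t + 1); the missing r / (t + 1) is
      filled up with a multiple of the unit. The denominator is positive even for t = 0.\<close>
    have q: "r / (t + 1) > 0" using r t(1) by simp
    have split: "complex_of_real r = complex_of_real (r / (t + 1)) + complex_of_real (r / (t + 1) * t)"
    proof -
      have "r / (t + 1) + r / (t + 1) * t = r / (t + 1) * (1 + t)" by (simp only: distrib_left mult_1_right)
      also have "\<dots> = r" using t(1) by (simp add: add.commute[of 1 t])
      finally show ?thesis unfolding of_real_add[symmetric] by simp
    qed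
    have "complex_of_real (r / (t + 1)) \<odot>\<^bsub>mat_space V m\<^esub> w \<in> D_max V m"
      unfolding w_def using q by (intro N.coneD(4)[OF cone_D_max unit_D_max]) simp
    from N.coneD(3)[OF cone_D_max this D[OF q]] show ?thesis
      unfolding split N.smult_add_left[OF w] N.a_assoc[OF N.smult_closed[OF w] N.smult_closed[OF w] Yc] .
  qed
  ultimately show ?thesis unfolding C_max_eq Y_def[symmetric] w_def[symmetric] by blast
qed

text \<open>\<open>V\<close> is Archimedean itself, so the closure adds nothing at level
  one.\<close>

lemma C_max_one:
  assumes "X \<in> C_max 1"
  shows "X $$ (0, 0) \<in> pos V"
proof (rule pos_archimedean)
  interpret M: star_space "mat_space V 1" by (rule star_space_mat)
  have X: "X \<in> selfadjoint (mat_space V 1)" using assms unfolding C_max_eq by blast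
  have "star (mat_space V 1) X $$ (0, 0) = star V (X $$ (0, 0))"
    by (simp add: mat_space_simps)
  then have "star V (X $$ (0, 0)) = X $$ (0, 0)" unfolding M.selfadjointD(2)[OF X] by (rule sym)
  moreover have "X $$ (0, 0) \<in> carrier V" using C_max_closed[OF assms] by (auto simp: mat_space_simps)
  ultimately show "X $$ (0, 0) \<in> selfadjoint V" by (intro selfadjointI)
  fix r :: real assume "r > 0"
  then have "complex_of_real r \<odot>\<^bsub>mat_space V 1\<^esub> order_unit (mat_space V 1) \<oplus>\<^bsub>mat_space V 1\<^esub> X \<in> D_max V 1"
    using assms unfolding C_max_eq by blast
  from D_max_one[OF this] show "complex_of_real r \<odot>\<^bsub>V\<^esub> e \<oplus> X $$ (0, 0) \<in> pos V"
    by (simp add: mat_space_simps)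
qed

end

text \<open>A model of \<open>OMAX V\<close> without cosets, on the carrier of \<open>V\<close>. The
  operator system axioms are collected here and transported to \<open>OMAX V\<close> along x
  \<mapsto> {x}.\<close>

definition arch_max :: "'a ordered_star_space \<Rightarrow> 'a matrix_ordered_star_space" where
  "arch_max V = pointed_star_space.extend (pointed_star_space.truncate V)
     (matrix_ordered_star_space.fields (aou.C_max V))"

lemma arch_max_simps [simp]:
  "carrier (arch_max V) = carrier V" "zero (arch_max V) = zero V" "add (arch_max V) = add V"
  "smult (arch_max V) = smult V" "star (arch_max V) = star V" "order_unit (arch_max V) = order_unit V"
  "mat_pos (arch_max V) = aou.C_max V"
  by (simp_all add: arch_max_def pointed_star_space.defs matrix_ordered_star_space.defs)

lemma max_matrix_ordering_simps [simp]:
  "carrier (max_matrix_ordering V) = carrier V" "zero (max_matrix_ordering V) = zero V"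
  "add (max_matrix_ordering V) = add V" "smult (max_matrix_ordering V) = smult V"
  "star (max_matrix_ordering V) = star V" "order_unit (max_matrix_ordering V) = order_unit V"
  "mat_pos (max_matrix_ordering V) = D_max V"
  by (simp_all add: max_matrix_ordering_def pointed_star_space.defs matrix_ordered_star_space.defs)

lemma star_vector_space_cong:
  assumes "star_vector_space V"
    "carrier W = carrier V" "zero W = zero V" "add W = add V" "smult W = smult V" "star W = star V"
  shows "star_vector_space W"
proof -
  interpret star_space V using assms(1) by unfold_locales
  show ?thesis
    by (rule star_vector_spaceI)
      (auto simp: assms a_ac smult_add_left smult_add_right star_add star_smult)
qed

lemma mat_space_arch_max [simp]: "mat_space (arch_max V) n = mat_space V n"
  unfolding mat_space_def arch_max_simps ..

text \<open>Compressions over \<open>V\<close> and over \<open>arch_max V\<close> are sums in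
  records of different types, but \<open>finsum\<close> reads only carrier, zero and
  addition.\<close>

lemma finsum_cong_struct:
  "carrier W = carrier V \<Longrightarrow> zero W = zero V \<Longrightarrow> add W = add V \<Longrightarrow> finsum W f A = finsum V f A"
  by (simp add: finsum_def finprod_def)

lemma compression_arch_max [simp]: "compression (arch_max V) \<alpha> X = compression V \<alpha> X"
  by (simp add: compression_def finsum_cong_struct[of "arch_max V" V])

lemma (in aou) operator_system_arch_max: "operator_system (arch_max V)"
  unfolding operator_system_def matrix_ordered_def
  using star_vector_space_cong[OF star_vector_space, of "arch_max V"] C_max_proper C_max_compression C_max_props
  by simp

section \<open>Transport of structure\<close>

text \<open>The target is not assumed to be a vector space: h is onto and preserves all operations
  including zero, so the axioms pass over to it.\<close>

definition star_iso ::
  "('a \<Rightarrow> 'b) \<Rightarrow> ('a, 'm) pointed_star_space_scheme \<Rightarrow> ('b, 'n) pointed_star_space_scheme \<Rightarrow> bool" where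
  "star_iso h V W \<longleftrightarrow>
     bij_betw h (carrier V) (carrier W) \<and> h (zero V) = zero W \<and> h (order_unit V) = order_unit W \<and>
     (\<forall>x\<in>carrier V. \<forall>y\<in>carrier V. h (x \<oplus>\<^bsub>V\<^esub> y) = h x \<oplus>\<^bsub>W\<^esub> h y) \<and>
     (\<forall>c. \<forall>x\<in>carrier V. h (c \<odot>\<^bsub>V\<^esub> x) = c \<odot>\<^bsub>W\<^esub> h x) \<and>
     (\<forall>x\<in>carrier V. h (star V x) = star W (h x))"

lemma star_isoD:
  assumes "star_iso h V W"
  shows "h ` carrier V = carrier W" "inj_on h (carrier V)"
    "h (zero V) = zero W" "h (order_unit V) = order_unit W"
    "x \<in> carrier V \<Longrightarrow> y \<in> carrier V \<Longrightarrow> h (x \<oplus>\<^bsub>V\<^esub> y) = h x \<oplus>\<^bsub>W\<^esub> h y"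
    "x \<in> carrier V \<Longrightarrow> h (c \<odot>\<^bsub>V\<^esub> x) = c \<odot>\<^bsub>W\<^esub> h x"
    "x \<in> carrier V \<Longrightarrow> h (star V x) = star W (h x)"
    "x \<in> carrier V \<Longrightarrow> h x \<in> carrier W"
  using assms unfolding star_iso_def bij_betw_def by auto

lemma star_iso_mat:
  assumes "star_iso h V W"
  shows "star_iso (map_mat h) (mat_space V n) (mat_space W n)"
proof -
  note h = star_isoD[OF assms]
  have inj: "inj_on (map_mat h) (carrier (mat_space V n))"
  proof (rule inj_onI)
    fix X Y assume X: "X \<in> carrier (mat_space V n)" and Y: "Y \<in> carrier (mat_space V n)"
      and eq: "map_mat h X = map_mat h Y"
    show "X = Y"
    proof (rule eq_matI)
      fix i j assume "i < dim_row Y" "j < dim_col Y"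
      then have ij: "i < n" "j < n" using Y by (auto simp: mat_space_simps)
      have "h (X $$ (i, j)) = h (Y $$ (i, j))"
        using arg_cong[OF eq, of "\<lambda>Z. Z $$ (i, j)"] X Y ij by (auto simp: mat_space_simps)
      then show "X $$ (i, j) = Y $$ (i, j)"
        using inj_onD[OF h(2)] X Y ij by (auto simp: mat_space_simps)
    qed (use X Y in \<open>auto simp: mat_space_simps\<close>)
  qed
  have img: "map_mat h ` carrier (mat_space V n) = carrier (mat_space W n)"
  proof
    show "map_mat h ` carrier (mat_space V n) \<subseteq> carrier (mat_space W n)"
      using h(8) by (auto simp: mat_space_simps)
    show "carrier (mat_space W n) \<subseteq> map_mat h ` carrier (mat_space V n)"
    proof
      fix Y assume Y: "Y \<in> carrier (mat_space W n)"
      define X where "X = map_mat (inv_into (carrier V) h) Y"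
      have "X \<in> carrier (mat_space V n)"
        using Y inv_into_into[of _ h "carrier V"] h(1) by (auto simp: X_def mat_space_simps)
      moreover have "Y = map_mat h X"
        using Y f_inv_into_f[of _ h "carrier V"] h(1) by (auto simp: X_def mat_space_simps intro!: eq_matI)
      ultimately show "Y \<in> map_mat h ` carrier (mat_space V n)" by blast
    qed
  qed
  show ?thesis
    unfolding star_iso_def bij_betw_def
    using inj img h(3-7) by (auto simp: mat_space_simps intro!: eq_matI)
qed

context star_space
begin

lemma star_iso_star_space:
  assumes "star_iso h V W"
  shows "star_space W"
proof
  note h = star_isoD[OF assms]
  have ex: "\<exists>x\<in>carrier V. y = h x" if "y \<in> carrier W" for y
    using that h(1) by blast
  note hom = h(3,5-7)[symmetric]
  show "star_vector_space W"
  proof (rule star_vector_spaceI)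
    fix x y z c d assume W: "x \<in> carrier W" "y \<in> carrier W" "z \<in> carrier W"
    obtain x' where x: "x = h x'" "x' \<in> carrier V" using ex[OF W(1)] by blast
    obtain y' where y: "y = h y'" "y' \<in> carrier V" using ex[OF W(2)] by blast
    obtain z' where z: "z = h z'" "z' \<in> carrier V" using ex[OF W(3)] by blast
    show "(x \<oplus>\<^bsub>W\<^esub> y) \<oplus>\<^bsub>W\<^esub> z = x \<oplus>\<^bsub>W\<^esub> (y \<oplus>\<^bsub>W\<^esub> z)"
      using x y z by (simp add: hom a_assoc)
  next
    fix x y c d assume W: "x \<in> carrier W" "y \<in> carrier W"
    obtain x' where x: "x = h x'" "x' \<in> carrier V" using ex[OF W(1)] by blast
    obtain y' where y: "y = h y'" "y' \<in> carrier V" using ex[OF W(2)] by blast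
    show "x \<oplus>\<^bsub>W\<^esub> y \<in> carrier W" using x y h(8) by (simp add: hom)
    show "x \<oplus>\<^bsub>W\<^esub> y = y \<oplus>\<^bsub>W\<^esub> x" using x y by (simp add: hom a_comm)
    show "c \<odot>\<^bsub>W\<^esub> (x \<oplus>\<^bsub>W\<^esub> y) = c \<odot>\<^bsub>W\<^esub> x \<oplus>\<^bsub>W\<^esub> c \<odot>\<^bsub>W\<^esub> y"
      using x y by (simp add: hom smult_add_right)
    show "star W (x \<oplus>\<^bsub>W\<^esub> y) = star W x \<oplus>\<^bsub>W\<^esub> star W y"
      using x y by (simp add: hom star_add)
  next
    fix x c d assume W: "x \<in> carrier W"
    obtain x' where x: "x = h x'" "x' \<in> carrier V" using ex[OF W] by blast
    show "zero W \<oplus>\<^bsub>W\<^esub> x = x" "c \<odot>\<^bsub>W\<^esub> x \<in> carrier W" "1 \<odot>\<^bsub>W\<^esub> x = x" "0 \<odot>\<^bsub>W\<^esub> x = zero W"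
      "star W x \<in> carrier W" "star W (star W x) = x" "(c * d) \<odot>\<^bsub>W\<^esub> x = c \<odot>\<^bsub>W\<^esub> (d \<odot>\<^bsub>W\<^esub> x)"
      "star W (c \<odot>\<^bsub>W\<^esub> x) = cnj c \<odot>\<^bsub>W\<^esub> star W x"
      using x h(8) by (simp_all add: hom star_smult)
    show "(c + d) \<odot>\<^bsub>W\<^esub> x = c \<odot>\<^bsub>W\<^esub> x \<oplus>\<^bsub>W\<^esub> d \<odot>\<^bsub>W\<^esub> x"
      using x by (simp add: hom smult_add_left)
  next
    show "zero W \<in> carrier W" using h(8)[OF zero_closed] h(3) by simp
  qed
qed

lemma star_iso_selfadjoint:
  assumes "star_iso h V W"
  shows "selfadjoint W = h ` selfadjoint V"
proof -
  note h = star_isoD[OF assms]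
  have "star W (h x) = h x \<longleftrightarrow> star V x = x" if "x \<in> carrier V" for x
    using that h(7)[OF that] inj_onD[OF h(2), of "star V x" x] by auto
  then show ?thesis
    unfolding selfadjoint_def h(1)[symmetric] by auto
qed

text \<open>The left side is spelled out in the form in which \<open>archimedeanisation\<close>
  defines its cones, so that it applies to \<open>OMAX\<close>.\<close>

lemma star_iso_arch_closure:
  assumes "star_iso h V W" "C \<subseteq> carrier V" "e \<in> carrier V"
  shows "{x \<in> selfadjoint W. \<forall>r>0. complex_of_real r \<odot>\<^bsub>W\<^esub> h e \<oplus>\<^bsub>W\<^esub> x \<in> h ` C} = h ` arch_closure C e"
proof -
  note h = star_isoD[OF assms(1)]
  have "complex_of_real r \<odot>\<^bsub>W\<^esub> h e \<oplus>\<^bsub>W\<^esub> h x \<in> h ` C \<longleftrightarrow> complex_of_real r \<odot>\<^bsub>V\<^esub> e \<oplus> x \<in> C"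
    if "x \<in> carrier V" for r x
  proof -
    have "complex_of_real r \<odot>\<^bsub>W\<^esub> h e \<oplus>\<^bsub>W\<^esub> h x = h (complex_of_real r \<odot>\<^bsub>V\<^esub> e \<oplus> x)"
      using that assms(3) by (simp add: h(5,6))
    then show ?thesis
      using inj_on_image_mem_iff[OF h(2) _ assms(2), of "complex_of_real r \<odot>\<^bsub>V\<^esub> e \<oplus> x"] that assms(3) by simp
  qed
  then show ?thesis
    unfolding star_iso_selfadjoint[OF assms(1)] arch_closure_def
    using selfadjointD(1) by auto
qed

lemma star_iso_is_cone:
  assumes "star_iso h V W" "is_cone V C"
  shows "is_cone W (h ` C)"
proof -
  note h = star_isoD[OF assms(1)] and C = coneD[OF assms(2)]
  show ?thesis
    unfolding is_cone_def star_iso_selfadjoint[OF assms(1)]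
  proof (intro conjI ballI allI impI)
    show "h ` C \<subseteq> h ` selfadjoint V" using C(1) by blast
    show "h ` C \<noteq> {}" using assms(2) unfolding is_cone_def by blast
    fix x assume "x \<in> h ` C"
    then obtain x' where x: "x = h x'" "x' \<in> C" by blast
    show "complex_of_real r \<odot>\<^bsub>W\<^esub> x \<in> h ` C" if "0 \<le> r" for r
      unfolding x(1) h(6)[OF C(2)[OF x(2)], symmetric] by (rule imageI[OF C(4)[OF x(2) that]])
    fix y assume "y \<in> h ` C"
    then obtain y' where y: "y = h y'" "y' \<in> C" by blast
    show "x \<oplus>\<^bsub>W\<^esub> y \<in> h ` C"
      unfolding x(1) y(1) h(5)[OF C(2)[OF x(2)] C(2)[OF y(2)], symmetric]
      by (rule imageI[OF C(3)[OF x(2) y(2)]])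
  qed
qed

lemma star_iso_a_inv:
  assumes "star_iso h V W" "x \<in> carrier V"
  shows "\<ominus>\<^bsub>W\<^esub> h x = h (\<ominus> x)"
proof -
  interpret W: star_space W by (rule star_iso_star_space[OF assms(1)])
  note h = star_isoD[OF assms(1)]
  show ?thesis
    using W.a_inv_eq_smult[OF h(8)[OF assms(2)]] a_inv_eq_smult[OF assms(2)] h(6)[OF assms(2)] by simp
qed

lemma star_iso_is_proper_cone:
  assumes "star_iso h V W" "is_proper_cone V C"
  shows "is_proper_cone W (h ` C)"
proof -
  note h = star_isoD[OF assms(1)]
  have C: "is_cone V C" and proper: "C \<inter> (\<lambda>x. \<ominus> x) ` C = {\<zero>}"
    using assms(2) unfolding is_proper_cone_def by blast+
  have sub: "C \<subseteq> carrier V" using coneD(2)[OF C] by blast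
  have "(\<lambda>x. \<ominus>\<^bsub>W\<^esub> x) ` h ` C = h ` (\<lambda>x. \<ominus> x) ` C"
    unfolding image_image using star_iso_a_inv[OF assms(1)] sub by (intro image_cong) auto
  moreover have "h ` C \<inter> h ` (\<lambda>x. \<ominus> x) ` C = h ` (C \<inter> (\<lambda>x. \<ominus> x) ` C)"
    using sub by (intro inj_on_image_Int[symmetric, OF h(2)]) auto
  ultimately show ?thesis
    unfolding is_proper_cone_def using star_iso_is_cone[OF assms(1) C] proper h(3) by simp
qed

lemma star_iso_is_order_unit:
  assumes "star_iso h V W" "is_cone V C" "is_order_unit V C e"
  shows "is_order_unit W (h ` C) (h e)"
  unfolding is_order_unit_def star_iso_selfadjoint[OF assms(1)]
proof (intro conjI ballI)
  interpret W: star_space W by (rule star_iso_star_space[OF assms(1)])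
  note h = star_isoD[OF assms(1)]
  have e: "e \<in> C" "e \<in> carrier V" using order_unitD(1)[OF assms(3,2)] coneD(2)[OF assms(2)] by auto
  show "h e \<in> h ` C" using e by blast
  fix x assume "x \<in> h ` selfadjoint V"
  then obtain x' where x: "x = h x'" "x' \<in> selfadjoint V" by blast
  have xc: "x' \<in> carrier V" using selfadjointD(1)[OF x(2)] .
  obtain r where r: "r > 0" "complex_of_real r \<odot>\<^bsub>V\<^esub> e \<oplus> (- 1) \<odot>\<^bsub>V\<^esub> x' \<in> C"
    using order_unitD(2)[OF assms(3,2) x(2)] by blast
  have "complex_of_real r \<odot>\<^bsub>W\<^esub> h e \<ominus>\<^bsub>W\<^esub> x = h (complex_of_real r \<odot>\<^bsub>V\<^esub> e \<oplus> (- 1) \<odot>\<^bsub>V\<^esub> x')"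
    using e xc by (simp add: x(1) W.minus_eq_smult h(5,6,8))
  then show "\<exists>r>0. complex_of_real r \<odot>\<^bsub>W\<^esub> h e \<ominus>\<^bsub>W\<^esub> x \<in> h ` C" using r by auto
qed

lemma star_iso_is_archimedean:
  assumes "star_iso h V W" "is_cone V C" "e \<in> carrier V" "is_archimedean V C e"
  shows "is_archimedean W (h ` C) (h e)"
proof -
  have C: "C \<subseteq> carrier V" using coneD(2)[OF assms(2)] by blast
  have "arch_closure C e = C" using assms(4) unfolding is_archimedean_def arch_closure_def by blast
  then show ?thesis
    unfolding is_archimedean_def star_iso_arch_closure[OF assms(1) C assms(3)] by simp
qed

end

section \<open>Linear maps, finite sums and compressions\<close>

lemma star_iso_module_hom: "star_iso h V W \<Longrightarrow> h \<in> LinearCombinations.module_hom class_ring V W"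
  unfolding LinearCombinations.module_hom_def using star_isoD by fastforce

lemma module_homD:
  assumes "f \<in> LinearCombinations.module_hom class_ring V W"
  shows "x \<in> carrier V \<Longrightarrow> f x \<in> carrier W"
    "x \<in> carrier V \<Longrightarrow> y \<in> carrier V \<Longrightarrow> f (x \<oplus>\<^bsub>V\<^esub> y) = f x \<oplus>\<^bsub>W\<^esub> f y"
    "x \<in> carrier V \<Longrightarrow> f (c \<odot>\<^bsub>V\<^esub> x) = c \<odot>\<^bsub>W\<^esub> f x"
  using assms unfolding LinearCombinations.module_hom_def by auto

lemma module_homI:
  assumes "\<And>x. x \<in> carrier V \<Longrightarrow> f x \<in> carrier W"
    "\<And>x y. x \<in> carrier V \<Longrightarrow> y \<in> carrier V \<Longrightarrow> f (x \<oplus>\<^bsub>V\<^esub> y) = f x \<oplus>\<^bsub>W\<^esub> f y"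
    "\<And>c x. x \<in> carrier V \<Longrightarrow> f (c \<odot>\<^bsub>V\<^esub> x) = c \<odot>\<^bsub>W\<^esub> f x"
  shows "f \<in> LinearCombinations.module_hom class_ring V W"
  using assms unfolding LinearCombinations.module_hom_def by auto

lemma module_hom_zero:
  assumes f: "f \<in> LinearCombinations.module_hom class_ring V W" and "star_space V" "star_space W"
  shows "f (zero V) = zero W"
proof -
  interpret V: star_space V by fact
  interpret W: star_space W by fact
  show ?thesis
    using module_homD(3)[OF f V.zero_closed, of 0] V.smult_zero_right
      W.smult_zero_left[OF module_homD(1)[OF f V.zero_closed]] by simp
qed

lemma module_hom_finsum:
  assumes f: "f \<in> LinearCombinations.module_hom class_ring V W" and V: "star_space V" and W: "star_space W"
    and "finite A" "g \<in> A \<rightarrow> carrier V"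
  shows "f (\<Oplus>\<^bsub>V\<^esub>k\<in>A. g k) = (\<Oplus>\<^bsub>W\<^esub>k\<in>A. f (g k))"
proof -
  interpret V: star_space V by fact
  interpret W: star_space W by fact
  show ?thesis
    using assms(4,5)
  proof (induction A rule: finite_induct)
    case empty
    then show ?case using module_hom_zero[OF f V W] by simp
  next
    case (insert a A)
    have g: "g \<in> A \<rightarrow> carrier V" "g a \<in> carrier V" using insert.prems by auto
    have cl: "(\<Oplus>\<^bsub>V\<^esub>k\<in>A. g k) \<in> carrier V" by (rule V.finsum_closed[OF g(1)])
    have "(\<lambda>k. f (g k)) \<in> A \<rightarrow> carrier W" using g(1) module_homD(1)[OF f] by auto
    then show ?case
      using V.finsum_insert[OF insert.hyps g] W.finsum_insert[OF insert.hyps, of "\<lambda>k. f (g k)"]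
        module_homD(1)[OF f g(2)] module_homD(2)[OF f g(2) cl] insert.IH[OF g(1)] by simp
  qed
qed

lemma compression_hom:
  assumes f: "f \<in> LinearCombinations.module_hom class_ring V W" and V: "star_space V" and W: "star_space W"
    and X: "X \<in> carrier (mat_space V n)" and \<alpha>: "\<alpha> \<in> carrier_mat n m"
  shows "map_mat f (compression V \<alpha> X) = compression W \<alpha> (map_mat f X)"
proof (rule eq_matI)
  interpret V: star_space V by fact
  interpret W: star_space W by fact
  note fD = module_homD[OF f]
  have Xc: "X $$ (k, l) \<in> carrier V" if "k < n" "l < n" for k l
    using X that by (auto simp: mat_space_simps)
  have dims: "dim_row X = n" "dim_col X = n" using X by (auto simp: mat_space_simps)
  fix i j assume "i < dim_row (compression W \<alpha> (map_mat f X))" "j < dim_col (compression W \<alpha> (map_mat f X))"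
  then have ij: "i < m" "j < m" using \<alpha> by (auto simp: compression_def)
  define c where "c k l = cnj (\<alpha> $$ (k, i)) * \<alpha> $$ (l, j)" for k l
  have "f (\<Oplus>\<^bsub>V\<^esub>k\<in>{..<n}. \<Oplus>\<^bsub>V\<^esub>l\<in>{..<n}. c k l \<odot>\<^bsub>V\<^esub> X $$ (k, l))
    = (\<Oplus>\<^bsub>W\<^esub>k\<in>{..<n}. f (\<Oplus>\<^bsub>V\<^esub>l\<in>{..<n}. c k l \<odot>\<^bsub>V\<^esub> X $$ (k, l)))"
    by (rule module_hom_finsum[OF f V W]) (use Xc in \<open>auto intro!: V.finsum_closed\<close>)
  also have "\<dots> = (\<Oplus>\<^bsub>W\<^esub>k\<in>{..<n}. \<Oplus>\<^bsub>W\<^esub>l\<in>{..<n}. c k l \<odot>\<^bsub>W\<^esub> map_mat f X $$ (k, l))"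
  proof (rule W.finsum_cong')
    fix k assume k: "k \<in> {..<n}"
    have "f (\<Oplus>\<^bsub>V\<^esub>l\<in>{..<n}. c k l \<odot>\<^bsub>V\<^esub> X $$ (k, l)) = (\<Oplus>\<^bsub>W\<^esub>l\<in>{..<n}. f (c k l \<odot>\<^bsub>V\<^esub> X $$ (k, l)))"
      by (rule module_hom_finsum[OF f V W]) (use Xc k in auto)
    also have "\<dots> = (\<Oplus>\<^bsub>W\<^esub>l\<in>{..<n}. c k l \<odot>\<^bsub>W\<^esub> map_mat f X $$ (k, l))"
      by (rule W.finsum_cong') (use Xc k fD dims in auto)
    finally show "f (\<Oplus>\<^bsub>V\<^esub>l\<in>{..<n}. c k l \<odot>\<^bsub>V\<^esub> X $$ (k, l)) = \<dots>" .
  qed (use Xc fD dims in \<open>auto intro!: W.finsum_closed\<close>)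
  finally show "map_mat f (compression V \<alpha> X) $$ (i, j) = compression W \<alpha> (map_mat f X) $$ (i, j)"
    using ij \<alpha> unfolding compression_def c_def by simp
qed (use \<alpha> in \<open>auto simp: compression_def\<close>)

lemma star_iso_aou_space:
  assumes "aou_space V" "star_iso h V W" "pos W = h ` pos V"
  shows "aou_space W"
proof -
  interpret aou V by (rule aouI[OF assms(1)])
  show ?thesis
    unfolding aou_space_def assms(3) star_isoD(4)[OF assms(2), symmetric]
    using star_space.star_vector_space[OF star_iso_star_space[OF assms(2)]]
      star_iso_is_proper_cone[OF assms(2)] star_iso_is_order_unit[OF assms(2) cone_pos order_unit_pos]
      star_iso_is_archimedean[OF assms(2) cone_pos unit_carrier archimedean_pos] aou_space
    unfolding aou_space_def by blast
qed

lemma star_iso_operator_system: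
  assumes S: "operator_system S" and h: "star_iso h S T"
    and pos: "\<And>n. 0 < n \<Longrightarrow> mat_pos T n = map_mat h ` mat_pos S n"
  shows "operator_system T"
proof -
  have mo: "star_vector_space S" "\<And>n. 0 < n \<Longrightarrow> is_proper_cone (mat_space S n) (mat_pos S n)"
    "\<And>n m \<alpha> X. 0 < n \<Longrightarrow> 0 < m \<Longrightarrow> \<alpha> \<in> carrier_mat n m \<Longrightarrow> X \<in> mat_pos S n \<Longrightarrow> compression S \<alpha> X \<in> mat_pos S m"
    and ou: "\<And>n. 0 < n \<Longrightarrow> is_order_unit (mat_space S n) (mat_pos S n) (order_unit (mat_space S n))"
    "\<And>n. 0 < n \<Longrightarrow> is_archimedean (mat_space S n) (mat_pos S n) (order_unit (mat_space S n))"
    using S unfolding operator_system_def matrix_ordered_def by blast+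
  interpret S: star_space S using mo(1) by unfold_locales
  have T: "star_space T" by (rule S.star_iso_star_space[OF h])
  note hm = star_iso_mat[OF h]
  have cone: "is_cone (mat_space S n) (mat_pos S n)" if "0 < n" for n
    using mo(2)[OF that] unfolding is_proper_cone_def by blast
  have Xc: "X \<in> carrier (mat_space S n)" if "0 < n" "X \<in> mat_pos S n" for n X
    using star_space.coneD(2)[OF S.star_space_mat cone] that by blast
  have "is_proper_cone (mat_space T n) (mat_pos T n)" if n: "0 < n" for n
    unfolding pos[OF n] by (rule star_space.star_iso_is_proper_cone[OF S.star_space_mat hm mo(2)[OF n]])
  moreover have "compression T \<alpha> X \<in> mat_pos T m"
    if nm: "0 < n" "0 < m" and \<alpha>: "\<alpha> \<in> carrier_mat n m" and X: "X \<in> mat_pos T n" for n m \<alpha> X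
  proof -
    obtain Y where Y: "X = map_mat h Y" "Y \<in> mat_pos S n" using X pos[OF nm(1)] by blast
    have "compression T \<alpha> X = map_mat h (compression S \<alpha> Y)"
      unfolding Y(1) using compression_hom[OF star_iso_module_hom[OF h] S.star_space_axioms T Xc[OF nm(1) Y(2)] \<alpha>] by simp
    then show ?thesis using mo(3)[OF nm \<alpha> Y(2)] pos[OF nm(2)] by blast
  qed
  moreover have "is_order_unit (mat_space T n) (mat_pos T n) (order_unit (mat_space T n))" if n: "0 < n" for n
    unfolding pos[OF n] star_isoD(4)[OF hm, symmetric]
    by (rule star_space.star_iso_is_order_unit[OF S.star_space_mat hm cone[OF n] ou(1)[OF n]])
  moreover have "is_archimedean (mat_space T n) (mat_pos T n) (order_unit (mat_space T n))" if n: "0 < n" for n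
  proof -
    have "order_unit (mat_space S n) \<in> carrier (mat_space S n)"
      by (rule Xc[OF n star_space.order_unitD(1)[OF S.star_space_mat ou(1)[OF n] cone[OF n]]])
    from star_space.star_iso_is_archimedean[OF S.star_space_mat hm cone[OF n] this ou(2)[OF n]]
    show ?thesis unfolding pos[OF n] star_isoD(4)[OF hm, symmetric] .
  qed
  ultimately show ?thesis
    unfolding operator_system_def matrix_ordered_def using star_space.star_vector_space[OF T] by blast
qed

section \<open>OMAX\<close>

context aou
begin

text \<open>Every state is a unital positive functional for the maximal ordering, because the
  entries of matrices in \<open>D_max V 1\<close> are positive; and states separate points.\<close>

lemma null_space_max: "null_space (max_matrix_ordering V) = {\<zero>}"
proof -
  have upf: "unital_positive_functional (max_matrix_ordering V) f" if f: "state f" for f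
  proof -
    have "0 \<le> f x" if "mat 1 1 (\<lambda>_. x) \<in> D_max V 1" for x
      using D_max_one[OF that] f unfolding state_def by simp
    then show ?thesis
      using f unfolding unital_positive_functional_def state_def by simp
  qed
  have "f \<zero> = 0" if "unital_positive_functional (max_matrix_ordering V) f" for f
  proof -
    have "f (0 \<odot>\<^bsub>V\<^esub> \<zero>) = 0 * f \<zero>"
      using that zero_closed unfolding unital_positive_functional_def max_matrix_ordering_simps by blast
    then show ?thesis by simp
  qed
  then show ?thesis
    unfolding null_space_def using upf states_separate by auto
qed

lemma max_coset: "x \<in> carrier V \<Longrightarrow> {\<zero>} +>\<^bsub>max_matrix_ordering V\<^esub> x = {x}"
  by (simp add: a_r_coset_def')

lemma max_coset': "x \<in> carrier V \<Longrightarrow> {\<zero>} +> x = {x}"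
  by (simp add: a_r_coset_def')

text \<open>The space underlying \<open>OMAX V\<close>, by \<open>null_space_max\<close>; its cosets
  are singletons.\<close>

definition "quot = quotient_space (max_matrix_ordering V) {\<zero>}"

lemma OMAX_simps:
  "carrier (OMAX V) = carrier quot" "zero (OMAX V) = zero quot" "add (OMAX V) = add quot"
  "smult (OMAX V) = smult quot" "star (OMAX V) = star quot" "order_unit (OMAX V) = order_unit quot"
  "mat_pos (OMAX V) n = {X \<in> selfadjoint (mat_space quot n).
     \<forall>r>0. complex_of_real r \<odot>\<^bsub>mat_space quot n\<^esub> order_unit (mat_space quot n) \<oplus>\<^bsub>mat_space quot n\<^esub> X
       \<in> map_mat (\<lambda>x. {\<zero>} +>\<^bsub>max_matrix_ordering V\<^esub> x) ` D_max V n}"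
  unfolding OMAX_def archimedeanisation_def Let_def null_space_max quot_def[symmetric]
  by (simp_all add: pointed_star_space.defs matrix_ordered_star_space.defs)

lemma star_iso_quot: "star_iso (\<lambda>x. {x}) V quot"
proof -
  have "carrier quot = (\<lambda>x. {x}) ` carrier V"
    unfolding quot_def quotient_space_def by (auto simp: A_RCOSETS_def' max_coset)
  then show ?thesis
    unfolding star_iso_def bij_betw_def quot_def
    by (auto simp: quotient_space_def max_coset set_add_def' inj_on_def)
qed

lemma star_iso_OMAX: "star_iso (\<lambda>x. {x}) (arch_max V) (OMAX V)"
  using star_iso_quot unfolding star_iso_def OMAX_simps arch_max_simps .

lemma mat_pos_OMAX: "mat_pos (OMAX V) n = map_mat (\<lambda>x. {x}) ` C_max n"
proof -
  have Xc: "X \<in> carrier (mat_space V n)" if "X \<in> D_max V n" for X using D_max_closed[OF that] .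
  have "map_mat (\<lambda>x. {\<zero>} +>\<^bsub>max_matrix_ordering V\<^esub> x) X = map_mat (\<lambda>x. {x}) X" if "X \<in> D_max V n" for X
    using Xc[OF that] by (intro eq_matI) (auto simp: mat_space_simps max_coset)
  then have img: "map_mat (\<lambda>x. {\<zero>} +>\<^bsub>max_matrix_ordering V\<^esub> x) ` D_max V n = map_mat (\<lambda>x. {x}) ` D_max V n"
    by (intro image_cong) auto
  have sub: "D_max V n \<subseteq> carrier (mat_space V n)" using Xc by blast
  show ?thesis
    unfolding OMAX_simps img
    using star_space.star_iso_arch_closure[OF star_space_mat star_iso_mat[OF star_iso_quot] sub Xc[OF unit_D_max]]
    unfolding star_isoD(4)[OF star_iso_mat[OF star_iso_quot]] C_max_def .
qed

theorem operator_system_OMAX: "operator_system (OMAX V)"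
  by (rule star_iso_operator_system[OF operator_system_arch_max star_iso_OMAX]) (simp add: mat_pos_OMAX)

lemma OMAX_map_singleton: "f x \<in> carrier V \<Longrightarrow> OMAX_map V f {x} = {f x}"
  by (simp add: OMAX_map_def null_space_max max_coset')

end

section \<open>OMAX is left adjoint to taking the first matrix level\<close>

lemma unital_positive_mapD:
  assumes "unital_positive_map V W f"
  shows "f \<in> LinearCombinations.module_hom class_ring V W" "f (order_unit V) = order_unit W"
    "x \<in> pos V \<Longrightarrow> f x \<in> pos W"
  using assms unfolding unital_positive_map_def by auto

lemma ucp_mapD:
  assumes "ucp_map S T f"
  shows "f \<in> LinearCombinations.module_hom class_ring S T" "f (order_unit S) = order_unit T"
    "0 < n \<Longrightarrow> X \<in> mat_pos S n \<Longrightarrow> map_mat f X \<in> mat_pos T n"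
  using assms unfolding ucp_map_def completely_positive_def by auto

lemma unital_positive_map_comp:
  assumes f: "unital_positive_map U V f" and g: "unital_positive_map V W g"
  shows "unital_positive_map U W (\<lambda>x. g (f x))"
  unfolding unital_positive_map_def
proof (intro conjI)
  note fD = module_homD[OF unital_positive_mapD(1)[OF f]] and gD = module_homD[OF unital_positive_mapD(1)[OF g]]
  show "(\<lambda>x. g (f x)) \<in> LinearCombinations.module_hom class_ring U W"
    by (rule module_homI) (simp_all add: fD gD)
  show "g (f (order_unit U)) = order_unit W"
    by (simp add: unital_positive_mapD(2)[OF f] unital_positive_mapD(2)[OF g])
  show "(\<lambda>x. g (f x)) ` pos U \<subseteq> pos W"
    using unital_positive_mapD(3)[OF f] unital_positive_mapD(3)[OF g] by blast
qed

lemma map_mat_cong_carrier: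
  assumes "X \<in> carrier (mat_space V n)" "\<And>x. x \<in> carrier V \<Longrightarrow> f x = g x"
  shows "map_mat f X = map_mat g X"
  using assms by (intro eq_matI) (auto simp: mat_space_simps)

lemma module_hom_map_mat:
  assumes f: "f \<in> LinearCombinations.module_hom class_ring V W"
  shows "map_mat f \<in> LinearCombinations.module_hom class_ring (mat_space V n) (mat_space W n)"
  by (rule module_homI) (auto simp: mat_space_simps module_homD[OF f] intro!: eq_matI)

lemma zero_less_one_nat: "0 < (1 :: nat)"
  by simp

section \<open>The first matrix level of an operator system\<close>

locale opsys =
  fixes S :: "'a matrix_ordered_star_space" (structure)
  assumes operator_system: "operator_system S"
begin

sublocale star_space S
  using operator_system unfolding operator_system_def matrix_ordered_def by unfold_locales blast

lemma proper_cone_mat_pos: "0 < n \<Longrightarrow> is_proper_cone (mat_space S n) (mat_pos S n)"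
  and compression_mat_pos: "0 < n \<Longrightarrow> 0 < m \<Longrightarrow> \<alpha> \<in> carrier_mat n m \<Longrightarrow> X \<in> mat_pos S n \<Longrightarrow>
    compression S \<alpha> X \<in> mat_pos S m"
  and order_unit_mat_pos: "0 < n \<Longrightarrow> is_order_unit (mat_space S n) (mat_pos S n) (order_unit (mat_space S n))"
  and archimedean_mat_pos: "0 < n \<Longrightarrow> is_archimedean (mat_space S n) (mat_pos S n) (order_unit (mat_space S n))"
  using operator_system unfolding operator_system_def matrix_ordered_def by blast+

lemma cone_mat_pos: "0 < n \<Longrightarrow> is_cone (mat_space S n) (mat_pos S n)"
  using proper_cone_mat_pos unfolding is_proper_cone_def by blast

lemma mat_pos_closed: "0 < n \<Longrightarrow> X \<in> mat_pos S n \<Longrightarrow> X \<in> carrier (mat_space S n)"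
  by (rule star_space.coneD(2)[OF star_space_mat cone_mat_pos])

definition level_one :: "'a ordered_star_space" where
  "level_one = pointed_star_space.extend (pointed_star_space.truncate S)
     (ordered_star_space.fields ((\<lambda>X. X $$ (0, 0)) ` mat_pos S 1))"

lemma level_one_simps [simp]:
  "carrier level_one = carrier S" "zero level_one = zero S" "add level_one = add S"
  "smult level_one = smult S" "star level_one = star S" "order_unit level_one = order_unit S"
  "pos level_one = (\<lambda>X. X $$ (0, 0)) ` mat_pos S 1"
  by (simp_all add: level_one_def pointed_star_space.defs ordered_star_space.defs)

lemma mat_one_eq: "X \<in> carrier (mat_space S 1) \<Longrightarrow> mat 1 1 (\<lambda>_. X $$ (0, 0)) = X"
  by (intro eq_matI) (auto simp: mat_space_simps)

lemma pos_level_one_iff: "x \<in> pos level_one \<longleftrightarrow> mat 1 1 (\<lambda>_. x) \<in> mat_pos S 1"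
proof
  assume "x \<in> pos level_one"
  then obtain X where X: "x = X $$ (0, 0)" "X \<in> mat_pos S 1" unfolding level_one_simps by blast
  show "mat 1 1 (\<lambda>_. x) \<in> mat_pos S 1"
    unfolding X(1) mat_one_eq[OF mat_pos_closed[OF zero_less_one_nat X(2)]] by (rule X(2))
next
  assume "mat 1 1 (\<lambda>_. x) \<in> mat_pos S 1"
  then have "mat 1 1 (\<lambda>_. x) $$ (0, 0) \<in> pos level_one" unfolding level_one_simps by (rule imageI)
  then show "x \<in> pos level_one" by simp
qed

text \<open>Makes the identification of 1 by 1 matrices with their entries explicit; the AOU axioms
  are transported along it.\<close>

lemma star_iso_level_one: "star_iso (\<lambda>X. X $$ (0, 0)) (mat_space S 1) level_one"
proof -
  have "bij_betw (\<lambda>X. X $$ (0, 0)) (carrier (mat_space S 1)) (carrier level_one)"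
    by (rule bij_betw_byWitness[where f' = "\<lambda>x. mat 1 1 (\<lambda>_. x)"])
      (use mat_one_eq in \<open>auto simp: mat_space_simps\<close>)
  then show ?thesis
    unfolding star_iso_def by (simp add: mat_space_simps)
qed

lemma aou_level_one: "aou_space level_one"
proof -
  note M = star_space_mat[of 1] and iso = star_iso_level_one and c = cone_mat_pos[OF zero_less_one_nat]
  have u: "order_unit (mat_space S 1) \<in> carrier (mat_space S 1)"
    by (rule mat_pos_closed[OF zero_less_one_nat star_space.order_unitD(1)[OF M order_unit_mat_pos[OF zero_less_one_nat] c]])
  show ?thesis
    unfolding aou_space_def level_one_simps(7) star_isoD(4)[OF iso, symmetric]
    using star_space.star_vector_space[OF star_space.star_iso_star_space[OF M iso]]
      star_space.star_iso_is_proper_cone[OF M iso proper_cone_mat_pos[OF zero_less_one_nat]]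
      star_space.star_iso_is_order_unit[OF M iso c order_unit_mat_pos[OF zero_less_one_nat]]
      star_space.star_iso_is_archimedean[OF M iso c u archimedean_mat_pos[OF zero_less_one_nat]]
    by blast
qed

lemma tensor_mat_pos:
  assumes n: "0 < n" and "psd n a" and y: "y \<in> pos level_one"
  shows "tensor S n a y \<in> mat_pos S n"
proof -
  interpret M: star_space "mat_space S n" by (rule star_space_mat)
  have yc: "y \<in> carrier S" using aou.posD(2)[OF aouI[OF aou_level_one] y] by simp
  show ?thesis
    using assms(2)
  proof (induction rule: psd_rank_one_induct)
    case (cong a b)
    have "tensor S n a y = tensor S n b y" by (rule tensor_cong) (rule cong(1))
    then show ?case using cong(2) by simp
  next
    case zero
    show ?case unfolding tensor_zero_left[OF yc] by (rule M.cone_zero[OF cone_mat_pos[OF n]])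
  next
    case (add a w)
    \<comment> \<open>The row w, as a 1 by n matrix, compresses the 1 by 1 matrix y to the matrix
      with entries \<open>cnj (w i) * w j\<close> times y.\<close>
    define \<alpha> where "\<alpha> = mat 1 n (\<lambda>(_, j). w j)"
    have \<alpha>: "\<alpha> \<in> carrier_mat 1 n" unfolding \<alpha>_def by simp
    have one: "mat 1 1 (\<lambda>_. y) = tensor S 1 (\<lambda>_ _. 1) y"
      using yc by (intro eq_matI) (auto simp: tensor_def)
    have "compression S \<alpha> (mat 1 1 (\<lambda>_. y)) \<in> mat_pos S n"
      using compression_mat_pos[OF zero_less_one_nat n \<alpha>] y[unfolded pos_level_one_iff] .
    also have "compression S \<alpha> (mat 1 1 (\<lambda>_. y)) = tensor S n (\<lambda>i j. cnj (w i) * w j) y"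
      unfolding one compression_tensor[OF yc \<alpha>] by (rule tensor_cong) (simp add: \<alpha>_def)
    finally show ?case
      unfolding tensor_add_left[OF yc] by (rule M.coneD(3)[OF cone_mat_pos[OF n] add])
  qed
qed

text \<open>Morphisms matter only on carriers. This passes from a convenient formula to
  \<open>OMAX_map\<close> or to \<open>inv_into\<close>, whose values elsewhere differ.\<close>

lemma ucp_map_cong:
  assumes f: "ucp_map S T f" and eq: "\<And>x. x \<in> carrier S \<Longrightarrow> g x = f x" and u: "order_unit S \<in> carrier S"
  shows "ucp_map S T g"
proof -
  note fD = module_homD[OF ucp_mapD(1)[OF f]]
  have "g \<in> LinearCombinations.module_hom class_ring S T"
    by (rule module_homI) (simp_all add: eq fD)
  moreover have "map_mat g X \<in> mat_pos T n" if "0 < n" "X \<in> mat_pos S n" for n X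
    using ucp_mapD(3)[OF f that] map_mat_cong_carrier[OF mat_pos_closed[OF that] eq] by simp
  ultimately show ?thesis
    unfolding ucp_map_def completely_positive_def using eq[OF u] ucp_mapD(2)[OF f] by auto
qed

lemma ucp_map_level_one:
  assumes T: "opsys T" and g: "ucp_map S T g"
  shows "unital_positive_map level_one (opsys.level_one T) g"
  unfolding unital_positive_map_def
proof (intro conjI subsetI)
  note gD = module_homD[OF ucp_mapD(1)[OF g]]
  show "g \<in> LinearCombinations.module_hom class_ring level_one (opsys.level_one T)"
    by (rule module_homI) (simp_all add: gD opsys.level_one_simps[OF T])
  show "g (order_unit level_one) = order_unit (opsys.level_one T)"
    by (simp add: ucp_mapD(2)[OF g] opsys.level_one_simps[OF T])
  fix y assume "y \<in> g ` pos level_one"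
  then obtain x where x: "y = g x" "x \<in> pos level_one" by blast
  have "map_mat g (mat 1 1 (\<lambda>_. x)) \<in> mat_pos T 1"
    by (rule ucp_mapD(3)[OF g zero_less_one_nat x(2)[unfolded pos_level_one_iff]])
  moreover have "map_mat g (mat 1 1 (\<lambda>_. x)) = mat 1 1 (\<lambda>_. g x)" by (intro eq_matI) auto
  ultimately show "y \<in> pos (opsys.level_one T)" unfolding x(1) opsys.pos_level_one_iff[OF T] by simp
qed

end

section \<open>Extension of positive maps to OMAX\<close>

context aou
begin

lemma opsys_OMAX: "opsys (OMAX V)"
  by unfold_locales (rule operator_system_OMAX)

text \<open>Follows from positivity: for selfadjoint y some r e + y is positive, so its image is
  selfadjoint, and r times the unit can be subtracted. General elements are split into their
  parts.\<close>

lemma positive_map_star: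
  assumes W: "aou_space W" and f: "unital_positive_map V W f" and x: "x \<in> carrier V"
  shows "f (star V x) = star W (f x)"
proof -
  interpret W: aou W by (rule aouI[OF W])
  note fD = module_homD[OF unital_positive_mapD(1)[OF f]] and fp = unital_positive_mapD(2,3)[OF f]
  have sa: "star W (f y) = f y" if y: "y \<in> selfadjoint V" for y
  proof -
    have yc: "y \<in> carrier V" using selfadjointD(1)[OF y] .
    obtain r where r: "complex_of_real r \<odot>\<^bsub>V\<^esub> e \<oplus> y \<in> pos V"
      using order_unit_bounds[OF cone_pos order_unit_pos y] by blast
    have eq: "f (complex_of_real r \<odot>\<^bsub>V\<^esub> e \<oplus> y) = complex_of_real r \<odot>\<^bsub>W\<^esub> W.e \<oplus>\<^bsub>W\<^esub> f y"
      using yc by (simp add: fD fp)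
    have "complex_of_real r \<odot>\<^bsub>W\<^esub> W.e \<oplus>\<^bsub>W\<^esub> f y \<in> selfadjoint W"
      using W.posD(1)[OF fp(2)[OF r]] unfolding eq .
    from W.selfadjointD(2)[OF this]
    have "complex_of_real r \<odot>\<^bsub>W\<^esub> W.e \<oplus>\<^bsub>W\<^esub> star W (f y) = complex_of_real r \<odot>\<^bsub>W\<^esub> W.e \<oplus>\<^bsub>W\<^esub> f y"
      using fD(1)[OF yc] W.selfadjointD(2)[OF W.posD(1)[OF W.unit_pos]]
      by (simp add: W.star_add W.star_smult)
    then show ?thesis using fD(1)[OF yc] by simp
  qed
  have p: "real_part x \<in> selfadjoint V" "imag_part x \<in> selfadjoint V"
    using real_part_selfadjoint[OF x] imag_part_selfadjoint[OF x] by auto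
  note pc = selfadjointD(1)[OF p(1)] selfadjointD(1)[OF p(2)]
  have "star V x = real_part x \<oplus> (- \<i>) \<odot>\<^bsub>V\<^esub> imag_part x"
    using arg_cong[OF real_imag_decomp[OF x], of "star V"] pc selfadjointD(2)[OF p(1)] selfadjointD(2)[OF p(2)]
    by (simp add: star_add star_smult)
  then have "f (star V x) = f (real_part x) \<oplus>\<^bsub>W\<^esub> (- \<i>) \<odot>\<^bsub>W\<^esub> f (imag_part x)"
    using pc by (simp add: fD)
  moreover have "f x = f (real_part x) \<oplus>\<^bsub>W\<^esub> \<i> \<odot>\<^bsub>W\<^esub> f (imag_part x)"
    using arg_cong[OF real_imag_decomp[OF x], of f] pc by (simp add: fD)
  ultimately show ?thesis
    using fD(1)[OF pc(1)] fD(1)[OF pc(2)] sa[OF p(1)] sa[OF p(2)] by (simp add: W.star_add W.star_smult)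
qed

lemma map_mat_D_max:
  assumes T: "opsys T" and f: "unital_positive_map V (opsys.level_one T) f" and n: "0 < n"
    and X: "X \<in> D_max V n"
  shows "map_mat f X \<in> mat_pos T n"
proof -
  interpret T: opsys T by (rule T)
  interpret MT: star_space "mat_space T n" by (rule T.star_space_mat)
  note fD = module_homD[OF unital_positive_mapD(1)[OF f], unfolded T.level_one_simps]
  show ?thesis
    using X
  proof (induction rule: D_max_induct)
    case zero
    have "f \<zero> = zero T" using fD(3)[of \<zero> 0] fD(1)[of \<zero>] by simp
    then have "map_mat f (zero (mat_space V n)) = zero (mat_space T n)"
      by (intro eq_matI) (auto simp: mat_space_simps)
    then show ?case using MT.cone_zero[OF T.cone_mat_pos[OF n]] by simp
  next
    case (add a x X)
    have xc: "x \<in> carrier V" using posD(2)[OF add(2)] .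
    have "map_mat f (tensor V n a x \<oplus>\<^bsub>mat_space V n\<^esub> X) = tensor T n a (f x) \<oplus>\<^bsub>mat_space T n\<^esub> map_mat f X"
      using xc add(4) by (intro eq_matI) (auto simp: mat_space_simps tensor_def fD)
    then show ?case
      using MT.coneD(3)[OF T.cone_mat_pos[OF n] T.tensor_mat_pos[OF n add(1) unital_positive_mapD(3)[OF f add(2)]] add(5)]
      by (simp only:)
  qed
qed

text \<open>The cones of \<open>T\<close> are Archimedean, so the result for \<open>D_max\<close>
  passes to the closure. The Archimedean property also asks for selfadjointness of the image, which
  is where \<open>positive_map_star\<close> enters.\<close>

lemma map_mat_C_max:
  assumes T: "opsys T" and f: "unital_positive_map V (opsys.level_one T) f" and n: "0 < n"
    and X: "X \<in> C_max n"
  shows "map_mat f X \<in> mat_pos T n"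
proof -
  interpret T: opsys T by (rule T)
  interpret MT: star_space "mat_space T n" by (rule T.star_space_mat)
  interpret MV: star_space "mat_space V n" by (rule star_space_mat)
  note f_hom = unital_positive_mapD(1)[OF f]
  note fD = module_homD[OF f_hom, unfolded T.level_one_simps]
  have hom: "map_mat f \<in> LinearCombinations.module_hom class_ring (mat_space V n) (mat_space T n)"
    by (rule module_hom_map_mat, rule module_homI) (simp_all add: fD)
  note F = module_homD[OF hom]
  have Xc: "X \<in> carrier (mat_space V n)" by (rule C_max_closed[OF X])
  have Xs: "star (mat_space V n) X = X" using X unfolding C_max_eq selfadjoint_def by blast
  have f0: "f \<zero> = zero T" using fD(3)[of \<zero> 0] fD(1)[of \<zero>] by simp
  have u: "map_mat f (order_unit (mat_space V n)) = order_unit (mat_space T n)"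
    using unital_positive_mapD(2)[OF f] f0 by (intro eq_matI) (auto simp: mat_space_simps)
  have "map_mat f (star (mat_space V n) X) = star (mat_space T n) (map_mat f X)"
    using Xc positive_map_star[OF T.aou_level_one f]
    by (intro eq_matI) (auto simp: mat_space_simps)
  then have "map_mat f X \<in> selfadjoint (mat_space T n)"
    unfolding Xs by (intro MT.selfadjointI F(1)[OF Xc]) (rule sym)
  moreover have "complex_of_real r \<odot>\<^bsub>mat_space T n\<^esub> order_unit (mat_space T n) \<oplus>\<^bsub>mat_space T n\<^esub> map_mat f X \<in> mat_pos T n"
    if r: "r > 0" for r
  proof -
    have "complex_of_real r \<odot>\<^bsub>mat_space V n\<^esub> order_unit (mat_space V n) \<oplus>\<^bsub>mat_space V n\<^esub> X \<in> D_max V n"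
      using X r unfolding C_max_eq by blast
    from map_mat_D_max[OF T f n this] show ?thesis
      unfolding F(2)[OF MV.smult_closed[OF D_max_closed[OF unit_D_max]] Xc]
        F(3)[OF D_max_closed[OF unit_D_max]] u .
  qed
  ultimately show ?thesis
    using T.archimedean_mat_pos[OF n] unfolding is_archimedean_def by blast
qed

lemma carrier_OMAX: "carrier (OMAX V) = (\<lambda>x. {x}) ` carrier V"
  using star_isoD(1)[OF star_iso_OMAX] by simp

lemma OMAX_hom:
  "x \<in> carrier V \<Longrightarrow> y \<in> carrier V \<Longrightarrow> {x} \<oplus>\<^bsub>OMAX V\<^esub> {y} = {x \<oplus> y}"
  "x \<in> carrier V \<Longrightarrow> c \<odot>\<^bsub>OMAX V\<^esub> {x} = {c \<odot>\<^bsub>V\<^esub> x}"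
  "order_unit (OMAX V) = {e}"
  using star_isoD(4-6)[OF star_iso_OMAX] by simp_all

text \<open>Transposition in the adjunction. Elements of \<open>OMAX V\<close> are singletons, so
  \<open>the_elem\<close> leads back to \<open>V\<close>, where f can be applied to the closed
  cones.\<close>

lemma ucp_map_OMAX:
  assumes T: "opsys T" and f: "unital_positive_map V (opsys.level_one T) f"
  shows "ucp_map (OMAX V) T (\<lambda>A. f (the_elem A))"
  unfolding ucp_map_def completely_positive_def
proof (intro conjI allI impI subsetI)
  interpret T: opsys T by (rule T)
  note fD = module_homD[OF unital_positive_mapD(1)[OF f], unfolded T.level_one_simps]
  show "(\<lambda>A. f (the_elem A)) \<in> LinearCombinations.module_hom class_ring (OMAX V) T"
    by (rule module_homI) (auto simp: carrier_OMAX OMAX_hom fD)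
  show "f (the_elem (order_unit (OMAX V))) = order_unit T"
    using unital_positive_mapD(2)[OF f] by (simp add: OMAX_hom)
  fix n Y assume n: "0 < (n::nat)" and "Y \<in> map_mat (\<lambda>A. f (the_elem A)) ` mat_pos (OMAX V) n"
  then obtain X where X: "Y = map_mat (\<lambda>A. f (the_elem A)) (map_mat (\<lambda>x. {x}) X)" "X \<in> C_max n"
    unfolding mat_pos_OMAX by blast
  have "Y = map_mat f X" unfolding X(1) by (intro eq_matI) auto
  then show "Y \<in> mat_pos T n" using map_mat_C_max[OF T f n X(2)] by simp
qed

text \<open>The unit of the adjunction; composition with it turns a morphism out of
  \<open>OMAX V\<close> into a positive map out of \<open>V\<close>.\<close>

lemma unital_positive_map_singleton: "unital_positive_map V (opsys.level_one (OMAX V)) (\<lambda>x. {x})"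
  unfolding unital_positive_map_def
proof (intro conjI subsetI)
  note s = opsys.level_one_simps[OF opsys_OMAX]
  show "(\<lambda>x. {x}) \<in> LinearCombinations.module_hom class_ring V (opsys.level_one (OMAX V))"
    by (rule module_homI) (auto simp: s carrier_OMAX OMAX_hom)
  show "{e} = order_unit (opsys.level_one (OMAX V))" by (simp add: s OMAX_hom)
  fix A assume "A \<in> (\<lambda>x. {x}) ` pos V"
  then obtain x where x: "A = {x}" "x \<in> pos V" by blast
  have "tensor V 1 (\<lambda>_ _. 1) x \<in> D_max V 1"
    by (rule D_max_tensor[OF _ x(2)]) (simp add: psd_def quad_form_def less_eq_complex_def)
  then have "tensor V 1 (\<lambda>_ _. 1) x \<in> C_max 1" using C_max_props(2) by blast
  moreover have "mat 1 1 (\<lambda>_. A) = map_mat (\<lambda>x. {x}) (tensor V 1 (\<lambda>_ _. 1) x)"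
    using posD(2)[OF x(2)] unfolding x(1) by (intro eq_matI) (auto simp: tensor_def)
  ultimately show "A \<in> pos (opsys.level_one (OMAX V))"
    unfolding opsys.pos_level_one_iff[OF opsys_OMAX] mat_pos_OMAX by blast
qed

text \<open>Inverse of the unit of the adjunction, positive because the closed cone has no new
  elements at level one.\<close>

lemma unital_positive_map_the_elem: "unital_positive_map (opsys.level_one (OMAX V)) V the_elem"
  unfolding unital_positive_map_def
proof (intro conjI subsetI)
  note s = opsys.level_one_simps[OF opsys_OMAX]
  show "the_elem \<in> LinearCombinations.module_hom class_ring (opsys.level_one (OMAX V)) V"
    by (rule module_homI) (auto simp: s carrier_OMAX OMAX_hom)
  show "the_elem (order_unit (opsys.level_one (OMAX V))) = e" by (simp add: s OMAX_hom)
  fix x assume "x \<in> the_elem ` pos (opsys.level_one (OMAX V))"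
  then obtain X where X: "x = the_elem (map_mat (\<lambda>x. {x}) X $$ (0, 0))" "X \<in> C_max 1"
    unfolding s mat_pos_OMAX by blast
  have "x = X $$ (0, 0)" using C_max_closed[OF X(2)] unfolding X(1) by (auto simp: mat_space_simps)
  then show "x \<in> pos V" using C_max_one[OF X(2)] by simp
qed

end

lemma ucp_map_OMAX_map:
  assumes V: "aou_space V" and W: "aou_space W" and f: "unital_positive_map V W f"
  shows "ucp_map (OMAX V) (OMAX W) (OMAX_map W f)"
proof -
  interpret V: aou V by (rule aouI[OF V])
  interpret W: aou W by (rule aouI[OF W])
  have "ucp_map (OMAX V) (OMAX W) (\<lambda>A. {f (the_elem A)})"
    by (rule V.ucp_map_OMAX[OF W.opsys_OMAX unital_positive_map_comp[OF f W.unital_positive_map_singleton]])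
  moreover have "OMAX_map W f A = {f (the_elem A)}" if "A \<in> carrier (OMAX V)" for A
    using that module_homD(1)[OF unital_positive_mapD(1)[OF f]]
    by (auto simp: V.carrier_OMAX W.OMAX_map_singleton)
  moreover have "order_unit (OMAX V) \<in> carrier (OMAX V)"
    by (simp add: V.OMAX_hom V.carrier_OMAX)
  ultimately show ?thesis by (rule opsys.ucp_map_cong[OF V.opsys_OMAX])
qed

section \<open>Realising subspaces on a given type\<close>

definition restrict_space :: "'a ordered_star_space \<Rightarrow> 'a set \<Rightarrow> 'a ordered_star_space" where
  "restrict_space W R = W\<lparr>carrier := R, pos := pos W \<inter> R\<rparr>"

lemma restrict_space_simps [simp]:
  "carrier (restrict_space W R) = R" "zero (restrict_space W R) = zero W"
  "add (restrict_space W R) = add W" "smult (restrict_space W R) = smult W"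
  "star (restrict_space W R) = star W" "order_unit (restrict_space W R) = order_unit W"
  "pos (restrict_space W R) = pos W \<inter> R"
  by (simp_all add: restrict_space_def)

text \<open>The elements tested in the order unit and Archimedean conditions are combinations of e
  and the given element, so they stay in a subspace that contains e.\<close>

lemma (in aou) restrict_space_aou:
  assumes R: "R \<subseteq> carrier V" "e \<in> R"
    and add: "\<And>x y. x \<in> R \<Longrightarrow> y \<in> R \<Longrightarrow> x \<oplus> y \<in> R"
    and smult: "\<And>c x. x \<in> R \<Longrightarrow> c \<odot>\<^bsub>V\<^esub> x \<in> R"
    and star: "\<And>x. x \<in> R \<Longrightarrow> star V x \<in> R"
  shows "aou_space (restrict_space V R)"
proof -
  have Rc: "x \<in> carrier V" if "x \<in> R" for x using R(1) that by blast
  have z: "\<zero> \<in> R" using smult[OF R(2), of 0] by simp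
  have svs: "star_vector_space (restrict_space V R)"
    by (rule star_vector_spaceI)
      (simp_all add: Rc z add smult star a_ac smult_add_left smult_add_right star_add star_smult)
  interpret R: star_space "restrict_space V R" using svs by unfold_locales
  have sa: "selfadjoint (restrict_space V R) = selfadjoint V \<inter> R"
    unfolding selfadjoint_def using Rc by auto
  have cone: "is_cone (restrict_space V R) (pos V \<inter> R)"
    unfolding is_cone_def sa using posD add smult cone_zero[OF cone_pos] z by auto
  have inv: "\<ominus>\<^bsub>restrict_space V R\<^esub> x = \<ominus> x" if "x \<in> R" for x
    using R.a_inv_eq_smult[of x] a_inv_eq_smult[OF Rc[OF that]] that by simp
  have "(pos V \<inter> R) \<inter> (\<lambda>x. \<ominus>\<^bsub>restrict_space V R\<^esub> x) ` (pos V \<inter> R) = {\<zero>}"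
  proof
    show "(pos V \<inter> R) \<inter> (\<lambda>x. \<ominus>\<^bsub>restrict_space V R\<^esub> x) ` (pos V \<inter> R) \<subseteq> {\<zero>}"
    proof
      fix x assume "x \<in> (pos V \<inter> R) \<inter> (\<lambda>x. \<ominus>\<^bsub>restrict_space V R\<^esub> x) ` (pos V \<inter> R)"
      then obtain y where "x \<in> pos V" "y \<in> pos V" "y \<in> R" "x = \<ominus>\<^bsub>restrict_space V R\<^esub> y" by blast
      then have "x \<in> pos V \<inter> (\<lambda>x. \<ominus> x) ` pos V" by (simp add: inv)
      then show "x \<in> {\<zero>}" unfolding proper_pos .
    qed
    have "\<ominus>\<^bsub>restrict_space V R\<^esub> \<zero> = \<zero>" unfolding inv[OF z] by (simp add: a_inv_eq_smult)
    then show "{\<zero>} \<subseteq> (pos V \<inter> R) \<inter> (\<lambda>x. \<ominus>\<^bsub>restrict_space V R\<^esub> x) ` (pos V \<inter> R)"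
      using z cone_zero[OF cone_pos] by force
  qed
  then have proper: "is_proper_cone (restrict_space V R) (pos V \<inter> R)"
    using cone unfolding is_proper_cone_def by simp
  have ou: "is_order_unit (restrict_space V R) (pos V \<inter> R) e"
    unfolding is_order_unit_def
  proof (intro conjI ballI)
    show "e \<in> pos V \<inter> R" using R(2) unit_pos by blast
    fix x assume "x \<in> selfadjoint (restrict_space V R)"
    then have x: "x \<in> selfadjoint V" "x \<in> R" unfolding sa by auto
    obtain r where r: "r > 0" "complex_of_real r \<odot>\<^bsub>V\<^esub> e \<oplus> (- 1) \<odot>\<^bsub>V\<^esub> x \<in> pos V"
      using order_unitD(2)[OF order_unit_pos cone_pos x(1)] by blast
    have "complex_of_real r \<odot>\<^bsub>restrict_space V R\<^esub> e \<ominus>\<^bsub>restrict_space V R\<^esub> x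
        = complex_of_real r \<odot>\<^bsub>V\<^esub> e \<oplus> (- 1) \<odot>\<^bsub>V\<^esub> x"
      using R.minus_eq_smult[of "complex_of_real r \<odot>\<^bsub>V\<^esub> e" x] smult[OF R(2)] x(2) by simp
    moreover have "complex_of_real r \<odot>\<^bsub>V\<^esub> e \<oplus> (- 1) \<odot>\<^bsub>V\<^esub> x \<in> R"
      by (intro add smult R(2) x(2))
    ultimately show "\<exists>r>0. complex_of_real r \<odot>\<^bsub>restrict_space V R\<^esub> e \<ominus>\<^bsub>restrict_space V R\<^esub> x \<in> pos V \<inter> R"
      using r by (intro exI[of _ r]) simp
  qed
  have arch: "is_archimedean (restrict_space V R) (pos V \<inter> R) e"
    unfolding is_archimedean_def sa restrict_space_simps
  proof (intro equalityI subsetI CollectI conjI allI impI)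
    fix x assume x: "x \<in> pos V \<inter> R"
    then show "x \<in> selfadjoint V \<inter> R" using posD(1) by blast
    fix r :: real assume "r > 0"
    then have "complex_of_real r \<odot>\<^bsub>V\<^esub> e \<in> pos V" using posD(4)[OF unit_pos, of r] by simp
    then show "complex_of_real r \<odot>\<^bsub>V\<^esub> e \<oplus> x \<in> pos V \<inter> R"
      using x posD(3) add[OF smult[OF R(2)]] by blast
  next
    fix x assume "x \<in> {x \<in> selfadjoint V \<inter> R. \<forall>r>0. complex_of_real r \<odot>\<^bsub>V\<^esub> e \<oplus> x \<in> pos V \<inter> R}"
    then show "x \<in> pos V \<inter> R" using pos_archimedean[of x] by blast
  qed
  show ?thesis
    unfolding aou_space_def using svs proper ou arch by simp
qed

section \<open>Copies along an injection\<close>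

definition copy_space :: "('b \<Rightarrow> 'a) \<Rightarrow> 'b ordered_star_space \<Rightarrow> 'a ordered_star_space" where
  "copy_space j U = (let i = inv_into (carrier U) j in
    \<lparr>carrier = j ` carrier U, monoid.mult = undefined, one = undefined, zero = j (zero U),
     add = (\<lambda>a b. j (i a \<oplus>\<^bsub>U\<^esub> i b)), smult = (\<lambda>c a. j (c \<odot>\<^bsub>U\<^esub> i a)),
     star = (\<lambda>a. j (star U (i a))), order_unit = j (order_unit U), pos = j ` pos U\<rparr>)"

lemma star_iso_copy_space:
  assumes "inj_on j (carrier U)"
  shows "star_iso j U (copy_space j U)"
  using assms unfolding star_iso_def bij_betw_def copy_space_def Let_def by simp

lemma copy_space_aou: "aou_space U \<Longrightarrow> inj_on j (carrier U) \<Longrightarrow> aou_space (copy_space j U)"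
  by (rule star_iso_aou_space[OF _ star_iso_copy_space]) (simp_all add: copy_space_def Let_def)

lemma unital_positive_map_copy:
  assumes "inj_on j (carrier U)"
  shows "unital_positive_map U (copy_space j U) j"
  using star_iso_module_hom[OF star_iso_copy_space[OF assms]]
  unfolding unital_positive_map_def by (simp add: copy_space_def Let_def)

lemma unital_positive_map_copy_inv:
  assumes U: "aou_space U" and j: "inj_on j (carrier U)"
  shows "unital_positive_map (copy_space j U) U (inv_into (carrier U) j)"
  unfolding unital_positive_map_def
proof (intro conjI)
  interpret aou U by (rule aouI[OF U])
  note h = star_isoD[OF star_iso_copy_space[OF j]]
  note inv = inv_into_f_f[OF j]
  have ex: "\<exists>x\<in>carrier U. a = j x" if "a \<in> carrier (copy_space j U)" for a
    using that unfolding h(1)[symmetric] by blast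
  show "inv_into (carrier U) j \<in> LinearCombinations.module_hom class_ring (copy_space j U) U"
  proof (rule module_homI)
    fix a c assume "a \<in> carrier (copy_space j U)"
    from ex[OF this] obtain x where x: "x \<in> carrier U" "a = j x" by blast
    show "inv_into (carrier U) j a \<in> carrier U" using x by (simp add: inv)
    show "inv_into (carrier U) j (c \<odot>\<^bsub>copy_space j U\<^esub> a) = c \<odot>\<^bsub>U\<^esub> inv_into (carrier U) j a"
      unfolding x(2) h(6)[OF x(1), symmetric] using x by (simp add: inv)
    fix b assume "b \<in> carrier (copy_space j U)"
    from ex[OF this] obtain y where y: "y \<in> carrier U" "b = j y" by blast
    show "inv_into (carrier U) j (a \<oplus>\<^bsub>copy_space j U\<^esub> b) = inv_into (carrier U) j a \<oplus>\<^bsub>U\<^esub> inv_into (carrier U) j b"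
      unfolding x(2) y(2) h(5)[OF x(1) y(1), symmetric] using x y by (simp add: inv)
  qed
  show "inv_into (carrier U) j (order_unit (copy_space j U)) = order_unit U"
    unfolding h(4)[symmetric] by (rule inv[OF unit_carrier])
  show "inv_into (carrier U) j ` pos (copy_space j U) \<subseteq> pos U"
    using posD(2) by (auto simp: copy_space_def Let_def inv)
qed

text \<open>There are infinitely many scalars, so c x = d x for some c different from d, and
  division by c - d gives x = 0.\<close>

lemma (in star_space) finite_carrier_trivial:
  assumes "finite (carrier V)"
  shows "carrier V = {\<zero>}"
proof -
  have "x = \<zero>" if x: "x \<in> carrier V" for x
  proof -
    have "finite ((\<lambda>c. c \<odot>\<^bsub>V\<^esub> x) ` (UNIV :: complex set))"
      by (rule finite_subset[OF _ assms]) (use x in blast)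
    then have "\<not> inj_on (\<lambda>c. c \<odot>\<^bsub>V\<^esub> x) (UNIV :: complex set)"
      using infinite_UNIV_char_0 finite_imageD by blast
    then obtain c d where cd: "c \<noteq> d" "c \<odot>\<^bsub>V\<^esub> x = d \<odot>\<^bsub>V\<^esub> x" unfolding inj_on_def by blast
    have "(c - d) \<odot>\<^bsub>V\<^esub> x = c \<odot>\<^bsub>V\<^esub> x \<oplus> (- d) \<odot>\<^bsub>V\<^esub> x" using smult_add_left[OF x, of c "- d"] by simp
    also have "\<dots> = (d + - d) \<odot>\<^bsub>V\<^esub> x" unfolding cd(2) smult_add_left[OF x] ..
    finally have "(1 / (c - d)) \<odot>\<^bsub>V\<^esub> ((c - d) \<odot>\<^bsub>V\<^esub> x) = \<zero>" using x by simp
    then show ?thesis using x cd(1) by simp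
  qed
  then show ?thesis using zero_closed by blast
qed

text \<open>
  The union has at most \<open>max(\<aleph>\<^sub>0, |'a|)\<close> elements, which settles the case of infinite \<open>'a\<close>;
  a finite type carries only the zero space.
\<close>

lemma inj_on_union_of_images:
  fixes V :: "nat \<Rightarrow> ('a, 'm) pointed_star_space_scheme" and \<beta> :: "nat \<Rightarrow> 'a \<Rightarrow> 'b"
  assumes V: "\<And>k. star_space (V k)" and \<beta>: "\<And>k. \<beta> k (zero (V k)) = z"
  shows "\<exists>j :: 'b \<Rightarrow> 'a. inj_on j (\<Union>k. \<beta> k ` carrier (V k))"
proof (cases "finite (UNIV :: 'a set)")
  case True
  have "carrier (V k) = {zero (V k)}" for k
    by (rule star_space.finite_carrier_trivial[OF V]) (rule finite_subset[OF subset_UNIV True])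
  then have "(\<Union>k. \<beta> k ` carrier (V k)) = {z}" using \<beta> by simp
  then show ?thesis by simp
next
  case False
  have "(card_of (\<beta> k ` carrier (V k)), card_of (UNIV :: 'a set)) \<in> ordLeq" for k
    using ordLeq_transitive[OF card_of_image card_of_mono1[OF subset_UNIV]] .
  moreover have "(card_of (UNIV :: nat set), card_of (UNIV :: 'a set)) \<in> ordLeq"
    using False infinite_iff_card_of_nat by blast
  ultimately have "(card_of (\<Union>k. \<beta> k ` carrier (V k)), card_of (UNIV :: 'a set)) \<in> ordLeq"
    by (intro card_of_UNION_ordLeq_infinite[OF False] ballI)
  then show ?thesis unfolding card_of_ordLeq[symmetric] by blast
qed

section \<open>Inductive limits\<close>

lemma inductive_limit_factorisation:
  assumes "is_inductive_limit obj mor A \<alpha> L \<iota>" "cocone obj mor A \<alpha> B \<beta>"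
  shows "\<exists>u. mor L B u \<and> (\<forall>k. \<forall>x\<in>carrier (A k). u (\<iota> k x) = \<beta> k x)"
  using assms unfolding is_inductive_limit_def factorisation_def by blast

text \<open>Both u and the identity factor the limit cocone through itself, and factorisations are
  unique.\<close>

lemma inductive_limit_endo:
  assumes lim: "is_inductive_limit obj mor A \<alpha> L \<iota>"
    and u: "mor L L u" "\<And>k x. x \<in> carrier (A k) \<Longrightarrow> u (\<iota> k x) = \<iota> k x"
    and id: "mor L L (\<lambda>x. x)" and x: "x \<in> carrier L"
  shows "u x = x"
proof -
  have "cocone obj mor A \<alpha> L \<iota>" using lim unfolding is_inductive_limit_def by blast
  moreover have "factorisation mor A L \<iota> L \<iota> u" unfolding factorisation_def using u by blast
  moreover have "factorisation mor A L \<iota> L \<iota> (\<lambda>x. x)" unfolding factorisation_def using id by blast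
  ultimately have "\<forall>x\<in>carrier L. u x = (\<lambda>x. x) x"
    using lim unfolding is_inductive_limit_def by blast
  then show ?thesis using x by blast
qed

text \<open>Compatibility with the \<phi> k makes the images increase with k, so two elements of the
  union lie in a common image and so does their sum. Closure under the involution comes from
  \<open>positive_map_star\<close>.\<close>

lemma union_of_images_restrict_aou:
  assumes V: "\<And>k. aou_space (V k)" and W: "aou_space W"
    and \<phi>: "\<And>k. unital_positive_map (V k) (V (Suc k)) (\<phi> k)"
    and \<beta>: "\<And>k. unital_positive_map (V k) W (\<beta> k)"
    and comp: "\<And>k x. x \<in> carrier (V k) \<Longrightarrow> \<beta> (Suc k) (\<phi> k x) = \<beta> k x"
  shows "aou_space (restrict_space W (\<Union>k. \<beta> k ` carrier (V k)))"
proof -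
  interpret W: aou W by (rule aouI[OF W])
  define R where "R = (\<Union>k. \<beta> k ` carrier (V k))"
  note bD = module_homD[OF unital_positive_mapD(1)[OF \<beta>]]
  have step: "\<beta> k ` carrier (V k) \<subseteq> \<beta> (Suc k) ` carrier (V (Suc k))" for k
  proof
    fix y assume "y \<in> \<beta> k ` carrier (V k)"
    then obtain x where x: "y = \<beta> k x" "x \<in> carrier (V k)" by blast
    show "y \<in> \<beta> (Suc k) ` carrier (V (Suc k))"
      unfolding x(1) comp[OF x(2), symmetric]
      by (rule imageI[OF module_homD(1)[OF unital_positive_mapD(1)[OF \<phi>] x(2)]])
  qed
  have mono: "\<beta> k ` carrier (V k) \<subseteq> \<beta> l ` carrier (V l)" if "k \<le> l" for k l
    by (rule lift_Suc_mono_le[of "\<lambda>k. \<beta> k ` carrier (V k)", OF step that])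
  have RI: "\<beta> k x \<in> R" if "x \<in> carrier (V k)" for k x unfolding R_def using that by blast
  have unit: "order_unit (V k) \<in> carrier (V k)" for k
    by (rule aou.unit_carrier[OF aouI[OF V]])
  have "aou_space (restrict_space W R)"
  proof (rule W.restrict_space_aou)
    show "R \<subseteq> carrier W" unfolding R_def using bD(1) by blast
    show "order_unit W \<in> R"
      using RI[OF unit[of 0]] unital_positive_mapD(2)[OF \<beta>] by simp
    fix x assume "x \<in> R"
    then obtain k x' where x: "x = \<beta> k x'" "x' \<in> carrier (V k)" unfolding R_def by blast
    interpret Vk: aou "V k" by (rule aouI[OF V])
    show "c \<odot>\<^bsub>W\<^esub> x \<in> R" for c
      unfolding x(1) bD(3)[OF x(2), symmetric] by (rule RI[OF Vk.smult_closed[OF x(2)]])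
    show "star W x \<in> R"
      unfolding x(1) Vk.positive_map_star[OF W \<beta> x(2), symmetric] by (rule RI[OF Vk.star_closed[OF x(2)]])
    fix y assume "y \<in> R"
    then obtain l y' where y: "y = \<beta> l y'" "y' \<in> carrier (V l)" unfolding R_def by blast
    define m where "m = max k l"
    interpret Vm: aou "V m" by (rule aouI[OF V])
    have "x \<in> \<beta> m ` carrier (V m)" "y \<in> \<beta> m ` carrier (V m)"
      using mono[of k m] mono[of l m] x y unfolding m_def by auto
    then obtain x'' y'' where xy: "x = \<beta> m x''" "x'' \<in> carrier (V m)" "y = \<beta> m y''" "y'' \<in> carrier (V m)"
      by blast
    show "x \<oplus>\<^bsub>W\<^esub> y \<in> R"
      unfolding xy(1,3) bD(2)[OF xy(2,4), symmetric] by (rule RI[OF Vm.a_closed[OF xy(2,4)]])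
  qed
  then show ?thesis unfolding R_def .
qed

text \<open>
  The universal property of \<open>L\<close> is only assumed for spaces on the type \<open>'a\<close>. It extends to an
  arbitrary AOU space \<open>W\<close> because the images of the \<open>V k\<close> span a subspace that embeds into \<open>'a\<close>.
\<close>

lemma inductive_limit_lift:
  fixes V :: "nat \<Rightarrow> 'a ordered_star_space" and W :: "'b ordered_star_space"
  assumes sys: "inductive_system aou_space unital_positive_map V \<phi>"
    and lim: "is_inductive_limit aou_space unital_positive_map V \<phi> L \<iota>"
    and W: "aou_space W" and \<beta>: "\<And>k. unital_positive_map (V k) W (\<beta> k)"
    and comp: "\<And>k x. x \<in> carrier (V k) \<Longrightarrow> \<beta> (Suc k) (\<phi> k x) = \<beta> k x"
  shows "\<exists>f. unital_positive_map L W f \<and> (\<forall>k. \<forall>x\<in>carrier (V k). f (\<iota> k x) = \<beta> k x)"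
proof -
  have V: "\<And>k. aou_space (V k)" and \<phi>: "\<And>k. unital_positive_map (V k) (V (Suc k)) (\<phi> k)"
    using sys unfolding inductive_system_def by auto
  interpret W: aou W by (rule aouI[OF W])
  define R where "R = (\<Union>k. \<beta> k ` carrier (V k))"
  define U where "U = restrict_space W R"
  have U: "aou_space U"
    unfolding U_def R_def by (rule union_of_images_restrict_aou[of V W \<phi> \<beta>, OF V W \<phi> \<beta> comp])
  have Vs: "star_space (V k)" for k using aouI[OF V] unfolding aou_def by blast
  have "\<beta> k (zero (V k)) = zero W" for k
    by (rule module_hom_zero[OF unital_positive_mapD(1)[OF \<beta>] Vs W.star_space_axioms])
  from inj_on_union_of_images[of V \<beta>, OF Vs this] obtain j :: "'b \<Rightarrow> 'a" where "inj_on j R"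
    unfolding R_def by blast
  then have j: "inj_on j (carrier U)" unfolding U_def by simp
  define C where "C = copy_space j U"
  have RI: "\<beta> k x \<in> R" if "x \<in> carrier (V k)" for k x unfolding R_def using that by blast
  have \<beta>U: "unital_positive_map (V k) U (\<beta> k)" for k
    unfolding unital_positive_map_def
  proof (intro conjI)
    note bD = module_homD[OF unital_positive_mapD(1)[OF \<beta>]]
    show "\<beta> k \<in> LinearCombinations.module_hom class_ring (V k) U"
      by (rule module_homI) (simp_all add: U_def RI bD)
    show "\<beta> k (order_unit (V k)) = order_unit U"
      using unital_positive_mapD(2)[OF \<beta>] by (simp add: U_def)
    show "\<beta> k ` pos (V k) \<subseteq> pos U"
      using unital_positive_mapD(3)[OF \<beta>] RI aou.posD(2)[OF aouI[OF V]] by (auto simp: U_def)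
  qed
  \<comment> \<open>The copy \<open>C\<close> of \<open>U\<close> lives on the type of the V k, so
    the universal property of \<open>L\<close> applies to it; the resulting map is led back through
    \<open>U\<close> into \<open>W\<close>.\<close>
  have "cocone aou_space unital_positive_map V \<phi> C (\<lambda>k x. j (\<beta> k x))"
    unfolding cocone_def C_def
    using copy_space_aou[OF U j] unital_positive_map_comp[OF \<beta>U unital_positive_map_copy[OF j]] comp by simp
  from inductive_limit_factorisation[OF lim this] obtain g where
    g: "unital_positive_map L C g" "\<forall>k. \<forall>x\<in>carrier (V k). g (\<iota> k x) = j (\<beta> k x)"
    by blast
  have incl: "unital_positive_map U W (\<lambda>x. x)"
    unfolding unital_positive_map_def
  proof (intro conjI)
    show "(\<lambda>x. x) \<in> LinearCombinations.module_hom class_ring U W"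
      using module_homD(1)[OF unital_positive_mapD(1)[OF \<beta>]] by (intro module_homI) (auto simp: U_def R_def)
  qed (simp_all add: U_def)
  have "unital_positive_map L W (\<lambda>x. inv_into (carrier U) j (g x))"
    by (rule unital_positive_map_comp[OF unital_positive_map_comp[OF g(1)[unfolded C_def]
            unital_positive_map_copy_inv[OF U j]] incl])
  moreover have "inv_into (carrier U) j (g (\<iota> k x)) = \<beta> k x" if "x \<in> carrier (V k)" for k x
    unfolding g(2)[rule_format, OF that] by (rule inv_into_f_f[OF j]) (simp add: U_def RI[OF that])
  ultimately show ?thesis by blast
qed

lemma unital_positive_map_id: "unital_positive_map V V (\<lambda>x. x)"
  unfolding unital_positive_map_def by (auto intro: module_homI)

lemma ucp_map_comp:
  assumes f: "ucp_map S T f" and g: "ucp_map T U g"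
  shows "ucp_map S U (\<lambda>x. g (f x))"
  unfolding ucp_map_def completely_positive_def
proof (intro conjI allI impI subsetI)
  note fD = module_homD[OF ucp_mapD(1)[OF f]] and gD = module_homD[OF ucp_mapD(1)[OF g]]
  show "(\<lambda>x. g (f x)) \<in> LinearCombinations.module_hom class_ring S U"
    by (rule module_homI) (simp_all add: fD gD)
  show "g (f (order_unit S)) = order_unit U"
    by (simp add: ucp_mapD(2)[OF f] ucp_mapD(2)[OF g])
  fix n Y assume n: "0 < (n::nat)" and "Y \<in> map_mat (\<lambda>x. g (f x)) ` mat_pos S n"
  then obtain X where X: "Y = map_mat (\<lambda>x. g (f x)) X" "X \<in> mat_pos S n" by blast
  have "Y = map_mat g (map_mat f X)" unfolding X(1) by (intro eq_matI) auto
  then show "Y \<in> mat_pos U n"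
    using ucp_mapD(3)[OF g n ucp_mapD(3)[OF f n X(2)]] by simp
qed

lemma ucp_map_id: "ucp_map S S (\<lambda>x. x)"
proof -
  have "map_mat (\<lambda>x. x) X = X" for X :: "'a mat" by (intro eq_matI) auto
  then show ?thesis
    unfolding ucp_map_def completely_positive_def by (auto intro: module_homI)
qed

theorem theorem4p21:
  fixes V :: "nat \<Rightarrow> 'a ordered_star_space" and \<phi> :: "nat \<Rightarrow> 'a \<Rightarrow> 'a"
    and L :: "'a ordered_star_space" and \<iota> :: "nat \<Rightarrow> 'a \<Rightarrow> 'a"
    and S :: "'a set matrix_ordered_star_space" and \<sigma> :: "nat \<Rightarrow> 'a set \<Rightarrow> 'a set"
  assumes "inductive_system aou_space unital_positive_map V \<phi>"
    and "is_inductive_limit aou_space unital_positive_map V \<phi> L \<iota>"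
    and "is_inductive_limit operator_system ucp_map
           (\<lambda>k. OMAX (V k)) (\<lambda>k. OMAX_map (V (Suc k)) (\<phi> k)) S \<sigma>"
  shows "\<exists>f. unital_complete_order_iso (OMAX L) S f"
proof -
  let ?O = "\<lambda>k. OMAX (V k)" and ?\<Phi> = "\<lambda>k. OMAX_map (V (Suc k)) (\<phi> k)"
  have V: "\<And>k. aou_space (V k)" and \<phi>: "\<And>k. unital_positive_map (V k) (V (Suc k)) (\<phi> k)"
    using assms(1) unfolding inductive_system_def by auto
  have L: "aou_space L" and \<iota>: "\<And>k. unital_positive_map (V k) L (\<iota> k)"
    and \<iota>\<phi>: "\<And>k x. x \<in> carrier (V k) \<Longrightarrow> \<iota> (Suc k) (\<phi> k x) = \<iota> k x"
    using assms(2) unfolding is_inductive_limit_def cocone_def by auto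
  have S: "operator_system S" and \<sigma>: "\<And>k. ucp_map (?O k) S (\<sigma> k)"
    and \<sigma>\<phi>: "\<And>k A. A \<in> carrier (?O k) \<Longrightarrow> \<sigma> (Suc k) (?\<Phi> k A) = \<sigma> k A"
    using assms(3) unfolding is_inductive_limit_def cocone_def by auto
  interpret L: aou L by (rule aouI[OF L])
  interpret S: opsys S by unfold_locales (rule S)
  have OV: "carrier (?O k) = (\<lambda>x. {x}) ` carrier (V k)" for k
    by (rule aou.carrier_OMAX[OF aouI[OF V]])
  have \<phi>c: "\<phi> k x \<in> carrier (V (Suc k))" and \<iota>c: "\<iota> k x \<in> carrier L" if "x \<in> carrier (V k)" for k x
    using module_homD(1)[OF unital_positive_mapD(1)[OF \<phi>] that]
      module_homD(1)[OF unital_positive_mapD(1)[OF \<iota>] that] by auto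
  have \<Phi>: "?\<Phi> k {x} = {\<phi> k x}" if "x \<in> carrier (V k)" for k x
    by (rule aou.OMAX_map_singleton[OF aouI[OF V], of "\<phi> k", OF \<phi>c[OF that]])

  \<comment> \<open>Through singletons and the first level of \<open>S\<close>, the cocone over the
    \<open>OMAX (V k)\<close> becomes one over the \<open>V k\<close>, with a target on
    \<open>'a set\<close>.\<close>
  define \<beta> where "\<beta> k x = \<sigma> k {x}" for k x
  have \<beta>: "unital_positive_map (V k) S.level_one (\<beta> k)" for k
    unfolding \<beta>_def
    by (rule unital_positive_map_comp[OF aou.unital_positive_map_singleton[OF aouI[OF V]]
          opsys.ucp_map_level_one[OF aou.opsys_OMAX[OF aouI[OF V]] S.opsys_axioms \<sigma>]])
  have "\<beta> (Suc k) (\<phi> k x) = \<beta> k x" if "x \<in> carrier (V k)" for k x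
    using \<sigma>\<phi>[of "{x}" k] \<Phi>[OF that] that OV unfolding \<beta>_def by simp
  from inductive_limit_lift[OF assms(1,2) S.aou_level_one \<beta> this]
  obtain f where f: "unital_positive_map L S.level_one f" "\<forall>k. \<forall>x\<in>carrier (V k). f (\<iota> k x) = \<beta> k x"
    by blast
  define F where "F A = f (the_elem A)" for A
  have F: "ucp_map (OMAX L) S F"
    unfolding F_def by (rule L.ucp_map_OMAX[OF S.opsys_axioms f(1)])

  \<comment> \<open>In this direction no change of type occurs: \<open>OMAX L\<close> is a space on
    \<open>'a set\<close>, as the universal property of \<open>S\<close> demands.\<close>
  have "cocone operator_system ucp_map ?O ?\<Phi> (OMAX L) (\<lambda>k. OMAX_map L (\<iota> k))"
    unfolding cocone_def
  proof (intro conjI allI ballI)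
    show "operator_system (OMAX L)" by (rule L.operator_system_OMAX)
    show "ucp_map (?O k) (OMAX L) (OMAX_map L (\<iota> k))" for k by (rule ucp_map_OMAX_map[OF V L \<iota>])
    fix k A assume "A \<in> carrier (?O k)"
    then obtain x where x: "A = {x}" "x \<in> carrier (V k)" unfolding OV by blast
    show "OMAX_map L (\<iota> (Suc k)) (?\<Phi> k A) = OMAX_map L (\<iota> k) A"
      unfolding x(1) \<Phi>[OF x(2)] L.OMAX_map_singleton[of "\<iota> k", OF \<iota>c[OF x(2)]]
        L.OMAX_map_singleton[of "\<iota> (Suc k)", OF \<iota>c[OF \<phi>c[OF x(2)]]] \<iota>\<phi>[OF x(2)] ..
  qed
  from inductive_limit_factorisation[OF assms(3) this] obtain u where u: "ucp_map S (OMAX L) u"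
    "\<forall>k. \<forall>A\<in>carrier (?O k). u (\<sigma> k A) = OMAX_map L (\<iota> k) A"
    by blast
  have u_single: "u (\<sigma> k {x}) = {\<iota> k x}" if "x \<in> carrier (V k)" for k x
    using u(2) L.OMAX_map_singleton[of "\<iota> k", OF \<iota>c[OF that]] that OV by simp

  have Fu: "F (u y) = y" if "y \<in> carrier S" for y
  proof (rule inductive_limit_endo[OF assms(3) ucp_map_comp[OF u(1) F] _ ucp_map_id that])
    fix k A assume "A \<in> carrier (?O k)"
    then obtain x where x: "A = {x}" "x \<in> carrier (V k)" unfolding OV by blast
    show "F (u (\<sigma> k A)) = \<sigma> k A"
      unfolding x(1) u_single[OF x(2)] F_def using f(2) x(2) by (simp add: \<beta>_def)
  qed
  \<comment> \<open>\<open>OMAX L\<close> is not known to be a limit, so this composite is compared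
    with the identity on \<open>L\<close>, to which \<open>the_elem\<close> returns from the first
    level of \<open>OMAX L\<close>.\<close>
  have uf: "the_elem (u (f x)) = x" if "x \<in> carrier L" for x
  proof (rule inductive_limit_endo[OF assms(2) _ _ unital_positive_map_id that])
    show "unital_positive_map L L (\<lambda>x. the_elem (u (f x)))"
      by (rule unital_positive_map_comp[OF unital_positive_map_comp[OF f(1)
              S.ucp_map_level_one[OF L.opsys_OMAX u(1)]] L.unital_positive_map_the_elem])
    show "the_elem (u (f (\<iota> k x))) = \<iota> k x" if "x \<in> carrier (V k)" for k x
      using f(2) that u_single[OF that] by (simp add: \<beta>_def)
  qed
  note Fc = module_homD(1)[OF ucp_mapD(1)[OF F]] and uc = module_homD(1)[OF ucp_mapD(1)[OF u(1)]]
  have uF: "u (F A) = A" if A: "A \<in> carrier (OMAX L)" for A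
  proof -
    obtain x where x: "A = {x}" "x \<in> carrier L" using A unfolding L.carrier_OMAX by blast
    \<comment> \<open>The value is an element of \<open>OMAX L\<close>, hence a singleton and
      determined by its \<open>the_elem\<close>.\<close>
    obtain y where y: "u (F A) = {y}" using uc[OF Fc[OF A]] unfolding L.carrier_OMAX by blast
    show ?thesis using uf[OF x(2)] y unfolding x(1) F_def by simp
  qed

  have bij: "bij_betw F (carrier (OMAX L)) (carrier S)"
    by (rule bij_betw_byWitness[where f' = u]) (use uF Fu Fc uc in auto)
  \<comment> \<open>Agreement with u on the carrier of \<open>S\<close> is enough for complete
    positivity of the inverse.\<close>
  have "inv_into (carrier (OMAX L)) F y = u y" if "y \<in> carrier S" for y
    using inv_into_f_f[OF bij_betw_imp_inj_on[OF bij] uc[OF that]] Fu[OF that] by simp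
  moreover have "order_unit S \<in> carrier S"
    using aou.unit_carrier[OF aouI[OF S.aou_level_one]] by simp
  ultimately have "ucp_map S (OMAX L) (inv_into (carrier (OMAX L)) F)"
    by (intro S.ucp_map_cong[OF u(1)])
  then show ?thesis
    unfolding unital_complete_order_iso_def using bij F unfolding ucp_map_def by blast
qed

end
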